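(* Let $\mathbb{G}$ be a step-two Carnot group with Lie algebra stratification $\mathfrak{g}=\mathfrak{g}_1\oplus\mathfrak{g}_2$, and let $Q=\dim\mathfrak{g}_1+2\dim\mathfrak{g}_2$ be its homogeneous dimension. Let $\mathcal{L}(\mathbb{G})$ be the set of all left-invariant Riemannian metrics on $\mathbb{G}$. Then $$D(\mathbb{G}) := \sup_{g\in\mathcal{L}(\mathbb{G}),\ p\in\mathbb{G},\ r>0}\frac{\nu_g(B_g(p,2r))}{\nu_g(B_g(p,r))} = 2^Q,$$ where $\nu_g$ is the Riemannian volume of $g$ and $B_g(p,r)$ is the open ball of center $p$ and radius $r$ for the Riemannian distance of $g$.
   Context: A step-two Carnot group is a connected and simply connected (real, finite-dimensional) Lie group $\mathbb{G}$ whose Lie algebra $\mathfrak{g}$ of left-invariant vector fields admits a stratification, i.e. a direct sum decomposition into linear subspaces $\mathfrak{g}=\mathfrak{g}_1\oplus\mathfrak{g}_2$ with $[\mathfrak{g}_1,\mathfrak{g}_1]=\mathfrak{g}_2$ and $[\mathfrak{g}_1,\mathfrak{g}_2]=\{0\}$. The stratification need not be unique, but $\mathfrak{g}_2=[\mathfrak{g},\mathfrak{g}]$ always, so $Q=\dim\mathfrak{g}_1+2\dim\mathfrak{g}_2$ does not depend on the choice. Left-invariant Riemannian metrics on $\mathbb{G}$ correspond to inner products on $\mathfrak{g}$: given an inner product with orthonormal basis $X_1,\dots,X_n$ of $\mathfrak{g}$, the associated metric $g$ is the one for which the left-invariant vector fields $X_1(p),\dots,X_n(p)$ are orthonormal in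 $T_p\mathbb{G}$ for every $p$. The Riemannian distance $d_g(p,q)$ is the infimum of the lengths $\int_0^1\sqrt{g_{\gamma(\tau)}(\dot\gamma(\tau),\dot\gamma(\tau))}\,d\tau$ over smooth paths $\gamma:[0,1]\to\mathbb{G}$ with $\gamma(0)=p$, $\gamma(1)=q$, and $B_g(p,r)=\{q\in\mathbb{G}: d_g(p,q)<r\}$. *)

theory Defs
  imports "HOL-Analysis.Analysis" "HOL-Library.Function_Algebras"
begin

text \<open>
  Tangent vectors and vector fields are represented by functions, so that their linear algebra
  is that of function spaces with pointwise operations.
\<close>

instantiation "fun" :: (type, real_vector) real_vector
begin

definition scaleR_fun :: "real \<Rightarrow> ('a \<Rightarrow> 'b) \<Rightarrow> 'a \<Rightarrow> 'b"
  where "scaleR_fun c f = (\<lambda>x. c *\<^sub>R f x)"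

instance
  by standard (auto simp: scaleR_fun_def fun_eq_iff scaleR_add_right scaleR_add_left)

end


section \<open>Smooth maps and smooth manifolds\<close>

text \<open>
  The set \<open>S\<close> below is always an open set or a relatively open subset of \<open>{0..1}\<close>. In both cases
  the derivative within \<open>S\<close> is unique, and the definition is the usual one: \<open>f\<close> is of class
  \<open>C\<^sup>k\<^sup>+\<^sup>1\<close> iff it is differentiable and all its directional derivatives are of class \<open>C\<^sup>k\<close>.
\<close>

fun Ck_on :: "nat \<Rightarrow> 'a::real_normed_vector set \<Rightarrow> ('a \<Rightarrow> 'b::real_normed_vector) \<Rightarrow> bool" where
  "Ck_on 0 S f \<longleftrightarrow> continuous_on S f"
| "Ck_on (Suc k) S f \<longleftrightarrow>
     (\<exists>f'. (\<forall>x\<in>S. (f has_derivative f' x) (at x within S)) \<and> (\<forall>v. Ck_on k S (\<lambda>x. f' x v)))"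

definition smooth_on :: "'a::real_normed_vector set \<Rightarrow> ('a \<Rightarrow> 'b::real_normed_vector) \<Rightarrow> bool"
  where "smooth_on S f \<longleftrightarrow> (\<forall>k. Ck_on k S f)"

text \<open>
  A chart is a pair of its domain and its coordinate map. An atlas need not be maximal.
\<close>

type_synonym ('g, 'n) chart = "'g set \<times> ('g \<Rightarrow> real ^ 'n)"

definition chart_inv :: "('g, 'n::finite) chart \<Rightarrow> real ^ 'n \<Rightarrow> 'g"
  where "chart_inv c = inv_into (fst c) (snd c)"

definition smooth_atlas :: "('g::topological_space, 'n::finite) chart set \<Rightarrow> bool"
  where "smooth_atlas A \<longleftrightarrow>
    (\<forall>c\<in>A. open (fst c) \<and> open (snd c ` fst c) \<and>
            homeomorphism (fst c) (snd c ` fst c) (snd c) (chart_inv c)) \<and>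
    (\<Union>c\<in>A. fst c) = UNIV \<and>
    (\<forall>c\<in>A. \<forall>d\<in>A. smooth_on (snd c ` (fst c \<inter> fst d)) (snd d \<circ> chart_inv c))"

definition smooth_fun :: "('g::topological_space, 'n::finite) chart set \<Rightarrow> ('g \<Rightarrow> real) \<Rightarrow> bool"
  where "smooth_fun A f \<longleftrightarrow> (\<forall>c\<in>A. smooth_on (snd c ` fst c) (f \<circ> chart_inv c))"

definition smooth_path :: "('g::topological_space, 'n::finite) chart set \<Rightarrow> (real \<Rightarrow> 'g) \<Rightarrow> bool"
  where "smooth_path A \<gamma> \<longleftrightarrow> continuous_on {0..1} \<gamma> \<and>
    (\<forall>c\<in>A. smooth_on {t\<in>{0..1}. \<gamma> t \<in> fst c} (snd c \<circ> \<gamma>))"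


section \<open>Tangent vectors and vector fields\<close>

text \<open>
  A tangent vector at \<open>p\<close> is a derivation at \<open>p\<close> of the algebra of smooth functions. It is extended
  by \<open>0\<close> to the functions that are not smooth, so that equality of tangent vectors and the
  dimension of spaces of tangent vectors have their usual meaning.
\<close>

type_synonym 'g tvec = "('g \<Rightarrow> real) \<Rightarrow> real"

definition tangent_space ::
    "('g::topological_space, 'n::finite) chart set \<Rightarrow> 'g \<Rightarrow> 'g tvec set"
  where "tangent_space A p = {v.
    (\<forall>f h. smooth_fun A f \<longrightarrow> smooth_fun A h \<longrightarrow>
       v (\<lambda>x. f x + h x) = v f + v h \<and> v (\<lambda>x. f x * h x) = f p * v h + h p * v f) \<and>
    (\<forall>c f. smooth_fun A f \<longrightarrow> v (\<lambda>x. c * f x) = c * v f) \<and>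
    (\<forall>f. \<not> smooth_fun A f \<longrightarrow> v f = 0)}"

definition coord_vector ::
    "('g::topological_space, 'n::finite) chart set \<Rightarrow> ('g, 'n) chart \<Rightarrow> 'g \<Rightarrow> 'n \<Rightarrow> 'g tvec"
  where "coord_vector A c p i = (\<lambda>f. if smooth_fun A f
    then frechet_derivative (f \<circ> chart_inv c) (at (snd c p)) (axis i 1) else 0)"

definition velocity ::
    "('g::topological_space, 'n::finite) chart set \<Rightarrow> (real \<Rightarrow> 'g) \<Rightarrow> real \<Rightarrow> 'g tvec"
  where "velocity A \<gamma> t = (\<lambda>f. if smooth_fun A f
    then vector_derivative (f \<circ> \<gamma>) (at t within {0..1}) else 0)"

definition smooth_vector_field ::
    "('g::topological_space, 'n::finite) chart set \<Rightarrow> ('g \<Rightarrow> 'g tvec) \<Rightarrow> bool"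
  where "smooth_vector_field A X \<longleftrightarrow>
    (\<forall>p. X p \<in> tangent_space A p) \<and> (\<forall>f. smooth_fun A f \<longrightarrow> smooth_fun A (\<lambda>p. X p f))"

definition lie_bracket :: "('g \<Rightarrow> 'g tvec) \<Rightarrow> ('g \<Rightarrow> 'g tvec) \<Rightarrow> 'g \<Rightarrow> 'g tvec"
  where "lie_bracket X Y = (\<lambda>p f. X p (\<lambda>q. Y q f) - Y p (\<lambda>q. X q f))"


section \<open>Lie groups and step-two Carnot groups\<close>

text \<open>
  The group is a type of class \<open>topological_group_add\<close>, the library's class of (not necessarily
  commutative) topological groups; the group law is therefore written \<open>+\<close>, although it does not
  commute in general.
\<close>

definition lie_group ::
    "('g::{topological_group_add, t2_space, second_countable_topology}, 'n::finite) chart set \<Rightarrow> bool"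
  where "lie_group A \<longleftrightarrow> smooth_atlas A \<and>
    (\<forall>a\<in>A. \<forall>b\<in>A. \<forall>c\<in>A.
       smooth_on {(x, y). x \<in> snd a ` fst a \<and> y \<in> snd b ` fst b \<and> chart_inv a x + chart_inv b y \<in> fst c}
         (\<lambda>(x, y). snd c (chart_inv a x + chart_inv b y))) \<and>
    (\<forall>a\<in>A. \<forall>c\<in>A.
       smooth_on {x. x \<in> snd a ` fst a \<and> - chart_inv a x \<in> fst c} (\<lambda>x. snd c (- chart_inv a x)))"

text \<open>The differential of the left translation \<open>q \<mapsto> a + q\<close>.\<close>

definition dL :: "'g::plus \<Rightarrow> 'g tvec \<Rightarrow> 'g tvec"
  where "dL a v = (\<lambda>f. v (\<lambda>q. f (a + q)))"

definition lie_algebra ::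
    "('g::{topological_space, plus}, 'n::finite) chart set \<Rightarrow> ('g \<Rightarrow> 'g tvec) set"
  where "lie_algebra A = {X. smooth_vector_field A X \<and> (\<forall>a p. X (a + p) = dL a (X p))}"

definition step_two_stratification ::
    "('g::{topological_space, plus}, 'n::finite) chart set \<Rightarrow>
      ('g \<Rightarrow> 'g tvec) set \<Rightarrow> ('g \<Rightarrow> 'g tvec) set \<Rightarrow> bool"
  where "step_two_stratification A V1 V2 \<longleftrightarrow>
    subspace V1 \<and> subspace V2 \<and>
    {X + Y | X Y. X \<in> V1 \<and> Y \<in> V2} = lie_algebra A \<and> V1 \<inter> V2 = {0} \<and>
    span {lie_bracket X Y | X Y. X \<in> V1 \<and> Y \<in> V1} = V2 \<and>
    (\<forall>X\<in>V1. \<forall>Y\<in>V2. lie_bracket X Y = 0)"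

definition step_two_carnot_group ::
    "('g::{topological_group_add, t2_space, second_countable_topology}, 'n::finite) chart set \<Rightarrow> bool"
  where "step_two_carnot_group A \<longleftrightarrow>
    lie_group A \<and> connected (UNIV :: 'g set) \<and> simply_connected (UNIV :: 'g set) \<and>
    (\<exists>V1 V2. step_two_stratification A V1 V2)"

definition homogeneous_dim :: "('g \<Rightarrow> 'g tvec) set \<Rightarrow> ('g \<Rightarrow> 'g tvec) set \<Rightarrow> nat"
  where "homogeneous_dim V1 V2 = dim V1 + 2 * dim V2"


section \<open>Riemannian metrics\<close>

type_synonym 'g metric_tensor = "'g \<Rightarrow> 'g tvec \<Rightarrow> 'g tvec \<Rightarrow> real"

definition riemannian_metric ::
    "('g::topological_space, 'n::finite) chart set \<Rightarrow> 'g metric_tensor \<Rightarrow> bool"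
  where "riemannian_metric A g \<longleftrightarrow>
    (\<forall>p. \<forall>u\<in>tangent_space A p. \<forall>v\<in>tangent_space A p. \<forall>w\<in>tangent_space A p. \<forall>c.
       g p u v = g p v u \<and>
       g p (u + v) w = g p u w + g p v w \<and>
       g p (c *\<^sub>R u) v = c * g p u v \<and>
       (u \<noteq> 0 \<longrightarrow> g p u u > 0)) \<and>
    (\<forall>X Y. smooth_vector_field A X \<longrightarrow> smooth_vector_field A Y \<longrightarrow>
       smooth_fun A (\<lambda>p. g p (X p) (Y p)))"

definition left_invariant_metrics ::
    "('g::{topological_space, plus}, 'n::finite) chart set \<Rightarrow> 'g metric_tensor set"
  where "left_invariant_metrics A = {g. riemannian_metric A g \<and>
    (\<forall>a p. \<forall>u\<in>tangent_space A p. \<forall>v\<in>tangent_space A p.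
       g (a + p) (dL a u) (dL a v) = g p u v)}"

definition path_length ::
    "('g::topological_space, 'n::finite) chart set \<Rightarrow> 'g metric_tensor \<Rightarrow> (real \<Rightarrow> 'g) \<Rightarrow> real"
  where "path_length A g \<gamma> =
    integral {0..1} (\<lambda>t. sqrt (g (\<gamma> t) (velocity A \<gamma> t) (velocity A \<gamma> t)))"

definition riemannian_dist ::
    "('g::topological_space, 'n::finite) chart set \<Rightarrow> 'g metric_tensor \<Rightarrow> 'g \<Rightarrow> 'g \<Rightarrow> real"
  where "riemannian_dist A g p q =
    Inf {path_length A g \<gamma> | \<gamma>. smooth_path A \<gamma> \<and> \<gamma> 0 = p \<and> \<gamma> 1 = q}"

definition riemannian_ball ::
    "('g::topological_space, 'n::finite) chart set \<Rightarrow> 'g metric_tensor \<Rightarrow> 'g \<Rightarrow> real \<Rightarrow> 'g set"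
  where "riemannian_ball A g p r = {q. riemannian_dist A g p q < r}"

text \<open>
  The density \<open>sqrt (det (g\<^sub>i\<^sub>j))\<close> of the volume in the coordinates of the chart \<open>c\<close>. The Riemannian
  volume is the unique Borel measure that has this density in every chart of the atlas.
\<close>

definition volume_density ::
    "('g::topological_space, 'n::finite) chart set \<Rightarrow> 'g metric_tensor \<Rightarrow>
      ('g, 'n) chart \<Rightarrow> real ^ 'n \<Rightarrow> real"
  where "volume_density A g c x =
    (let p = chart_inv c x in
     sqrt (det (\<chi> i j. g p (coord_vector A c p i) (coord_vector A c p j))))"

definition is_riemannian_volume ::
    "('g::topological_space, 'n::finite) chart set \<Rightarrow> 'g metric_tensor \<Rightarrow> 'g measure \<Rightarrow> bool"
  where "is_riemannian_volume A g \<mu> \<longleftrightarrow> sets \<mu> = sets borel \<and>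
    (\<forall>c\<in>A. \<forall>B\<in>sets borel. B \<subseteq> fst c \<longrightarrow>
       emeasure \<mu> B = (\<integral>\<^sup>+x. ennreal (volume_density A g c x) * indicator (snd c ` B) x \<partial>lborel))"

definition riemannian_volume ::
    "('g::topological_space, 'n::finite) chart set \<Rightarrow> 'g metric_tensor \<Rightarrow> 'g measure"
  where "riemannian_volume A g = (THE \<mu>. is_riemannian_volume A g \<mu>)"

definition doubling_constant ::
    "('g::{topological_space, plus}, 'n::finite) chart set \<Rightarrow> ennreal"
  where "doubling_constant A =
    (SUP (g, p, r) \<in> left_invariant_metrics A \<times> UNIV \<times> {0<..}.
       emeasure (riemannian_volume A g) (riemannian_ball A g p (2 * r)) /
       emeasure (riemannian_volume A g) (riemannian_ball A g p r))"

end

theory Submission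
  imports Defs
begin

text \<open>
  Let \<open>g\<close> be a left-invariant metric. A basis of the Lie algebra that is orthonormal for \<open>g\<close> and contains
  a basis of the second layer identifies the group with \<open>real^'n\<close> carrying the law \<open>x + y + C x y / 2\<close>,
  where \<open>C\<close> is the bracket. In these coordinates the Riemannian volume is Lebesgue measure, and the speed
  of a path is the norm of \<open>\<gamma>' - C \<gamma> \<gamma>' / 2\<close>. The dilation by \<open>2\<close> on the first and by \<open>4\<close> on the second
  layer is an automorphism that multiplies volumes by \<open>2 ^ Q\<close>. Its inverse at least halves the length of
  every path from the identity, so it maps the ball of radius \<open>r\<close> onto a superset of the ball of radius
  \<open>2 r\<close>. This gives the upper bound.

  Conversely, an element of the second layer is a product of commutators. So the image of a cube
  under the dilation with factor \<open>R \<ge> 1\<close> lies in a ball of radius \<open>c R\<close>, and the volume of this ball is at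
  least \<open>R ^ Q\<close>. A ratio bounded by some \<open>s < 2 ^ Q\<close> would make the volume grow more slowly along
  \<open>R = 2 ^ j\<close>.

  The coordinates are constructed without flows. Near the identity they are a primitive of the
  Maurer-Cartan form. The local exponential map extends to a homomorphism from \<open>real^'n\<close> to the group,
  which is onto by connectedness and injective because the group is simply connected.
\<close>

text \<open>The first layer need not be orthogonal to the second for the given metric. The
  orthogonal complement of the second layer takes its place in the basis: the bracket depends on its
  arguments only modulo the second layer, so the dilations built from this complement are still
  automorphisms, and the dimensions agree. The metric is not homogeneous under these dilations. The
  inverse dilation divides second-layer velocities by 4 where 2 would suffice, so the ball of twice
  the radius is merely contained in the dilated ball, and the factor \<open>2 ^ Q\<close> shows only
  in the growth of large balls. It does so for each left-invariant metric separately, not just along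
  a sequence of metrics. The supremum is therefore found from one metric, whose existence has to be
  shown because the supremum of an empty family of extended nonnegative reals is 0.\<close>

section \<open>Calculus of smooth maps\<close>

text \<open>At every point of a thick set each coordinate direction can be approached inside the set,
  so derivatives within the set are unique.\<close>

definition thick :: "'a::euclidean_space set \<Rightarrow> bool"
  where "thick S \<longleftrightarrow> (\<forall>x\<in>S. \<forall>i\<in>Basis. \<forall>e>0. \<exists>d. 0 < \<bar>d\<bar> \<and> \<bar>d\<bar> < e \<and> x + d *\<^sub>R i \<in> S)"

lemma thick_derivative_unique:
  assumes "thick S" "x \<in> S" "(f has_derivative f') (at x within S)" "(f has_derivative f'') (at x within S)"
  shows "f' = f''"
  by (rule frechet_derivative_unique_within[OF assms(3,4)]) (use assms(1,2) in \<open>auto simp: thick_def\<close>)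

lemma thick_Int_open:
  assumes "thick S" "open U" shows "thick (S \<inter> U)"
  unfolding thick_def
proof (intro ballI allI impI)
  fix x i :: 'a and e :: real assume x: "x \<in> S \<inter> U" and i: "i \<in> Basis" and e: "e > 0"
  obtain r where r: "r > 0" "ball x r \<subseteq> U" using x assms(2) openE by blast
  obtain d where d: "0 < \<bar>d\<bar>" "\<bar>d\<bar> < min e r" "x + d *\<^sub>R i \<in> S"
    using assms(1) x i e r unfolding thick_def by (metis IntD1 min_less_iff_conj)
  then have "x + d *\<^sub>R i \<in> ball x r" using i by (simp add: dist_norm)
  then show "\<exists>d. 0 < \<bar>d\<bar> \<and> \<bar>d\<bar> < e \<and> x + d *\<^sub>R i \<in> S \<inter> U" using d r by auto
qed

lemma thick_UNIV: "thick UNIV"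
  unfolding thick_def by (metis UNIV_I abs_of_pos dense)

lemma thick_open: "open U \<Longrightarrow> thick U"
  using thick_Int_open[OF thick_UNIV, of U] by simp

lemma thick_unit_interval: "thick {0..1::real}"
  unfolding thick_def
proof (intro ballI allI impI)
  fix x i e :: real assume x: "x \<in> {0..1}" and i: "i \<in> Basis" and e: "e > 0"
  show "\<exists>d. 0 < \<bar>d\<bar> \<and> \<bar>d\<bar> < e \<and> x + d *\<^sub>R i \<in> {0..1}"
  proof (cases "x < 1/2")
    case True
    then show ?thesis using x i e by (intro exI[of _ "min (e/2) (1/2)"]) (auto simp: min_def)
  next
    case False
    then show ?thesis using x i e by (intro exI[of _ "- min (e/2) (1/2)"]) (auto simp: min_def)
  qed
qed

lemma Ck_on_cong: "(\<And>x. x \<in> S \<Longrightarrow> f x = g x) \<Longrightarrow> Ck_on k S f \<longleftrightarrow> Ck_on k S g"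
proof (cases k)
  case 0
  then show "(\<And>x. x \<in> S \<Longrightarrow> f x = g x) \<Longrightarrow> ?thesis" by (simp cong: continuous_on_cong)
next
  case (Suc m)
  assume "\<And>x. x \<in> S \<Longrightarrow> f x = g x"
  then have "(f has_derivative D) (at x within S) \<longleftrightarrow> (g has_derivative D) (at x within S)" if "x \<in> S" for x D
    using that has_derivative_transform by metis
  then show ?thesis unfolding Suc Ck_on.simps by (metis (no_types))
qed

lemma Ck_on_eqI: "Ck_on k S g \<Longrightarrow> (\<And>x. x \<in> S \<Longrightarrow> f x = g x) \<Longrightarrow> Ck_on k S f"
  using Ck_on_cong[of S f g k] by blast

lemma Ck_on_subset: "Ck_on k S f \<Longrightarrow> T \<subseteq> S \<Longrightarrow> Ck_on k T f"
proof (induction k arbitrary: f)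
  case 0 then show ?case using continuous_on_subset by auto
next
  case (Suc k)
  then show ?case unfolding Ck_on.simps by (meson has_derivative_subset subsetD)
qed

lemma Ck_on_Suc_imp: "Ck_on (Suc k) S f \<Longrightarrow> Ck_on k S f"
proof (induction k arbitrary: f)
  case 0
  then show ?case using has_derivative_continuous continuous_on_eq_continuous_within by (metis Ck_on.simps)
next
  case (Suc k)
  from Suc.prems obtain f' where f': "\<forall>x\<in>S. (f has_derivative f' x) (at x within S)"
    "\<forall>v. Ck_on (Suc k) S (\<lambda>x. f' x v)" using Ck_on.simps(2)[of "Suc k" S f] by blast
  have "Ck_on k S (\<lambda>x. f' x v)" for v using f'(2) by (intro Suc.IH) blast
  then show ?case using f'(1) unfolding Ck_on.simps(2)[of k] by blast
qed

lemma Ck_on_const: "Ck_on k S (\<lambda>x. c)"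
proof (induction k arbitrary: c)
  case (Suc k)
  then show ?case by (auto intro!: exI[of _ "\<lambda>x v. 0"])
qed simp

lemma Ck_on_bounded_linear_o:
  assumes L: "bounded_linear L" shows "Ck_on k S f \<Longrightarrow> Ck_on k S (\<lambda>x. L (f x))"
proof (induction k arbitrary: f)
  case 0
  then show ?case using bounded_linear.continuous_on[OF L] by simp
next
  case (Suc k)
  then obtain f' where f': "\<forall>x\<in>S. (f has_derivative f' x) (at x within S)" "\<forall>v. Ck_on k S (\<lambda>x. f' x v)" by auto
  then show ?case using Suc.IH
    by (auto intro!: exI[of _ "\<lambda>x v. L (f' x v)"] bounded_linear.has_derivative[OF L])
qed

lemma Ck_on_add: "Ck_on k S f \<Longrightarrow> Ck_on k S g \<Longrightarrow> Ck_on k S (\<lambda>x. f x + g x)"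
proof (induction k arbitrary: f g)
  case 0 then show ?case by (simp add: continuous_on_add)
next
  case (Suc k)
  then obtain f' g' where "\<forall>x\<in>S. (f has_derivative f' x) (at x within S)" "\<forall>v. Ck_on k S (\<lambda>x. f' x v)"
    "\<forall>x\<in>S. (g has_derivative g' x) (at x within S)" "\<forall>v. Ck_on k S (\<lambda>x. g' x v)" by auto
  then show ?case using Suc.IH unfolding Ck_on.simps
    by (intro exI[of _ "\<lambda>x v. f' x v + g' x v"]) (auto simp: has_derivative_add)
qed

lemma Ck_on_bilinear:
  assumes p: "bounded_bilinear p"
  shows "Ck_on k S f \<Longrightarrow> Ck_on k S g \<Longrightarrow> Ck_on k S (\<lambda>x. p (f x) (g x))"
proof (induction k arbitrary: f g)
  case 0 then show ?case using bounded_bilinear.continuous_on[OF p] by simp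
next
  case (Suc k)
  have fg: "Ck_on k S f" "Ck_on k S g" using Suc.prems by (blast intro: Ck_on_Suc_imp)+
  from Suc obtain f' g' where D: "\<forall>x\<in>S. (f has_derivative f' x) (at x within S)" "\<forall>v. Ck_on k S (\<lambda>x. f' x v)"
    "\<forall>x\<in>S. (g has_derivative g' x) (at x within S)" "\<forall>v. Ck_on k S (\<lambda>x. g' x v)" by auto
  show ?case unfolding Ck_on.simps
  proof (intro exI[of _ "\<lambda>x v. p (f x) (g' x v) + p (f' x v) (g x)"] conjI ballI allI)
    show "((\<lambda>x. p (f x) (g x)) has_derivative (\<lambda>v. p (f x) (g' x v) + p (f' x v) (g x))) (at x within S)"
      if "x \<in> S" for x using D that by (intro bounded_bilinear.FDERIV[OF p]) auto
    show "Ck_on k S (\<lambda>x. p (f x) (g' x v) + p (f' x v) (g x))" for v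
      using D fg by (intro Ck_on_add Suc.IH) auto
  qed
qed

lemma Ck_on_id: "Ck_on k S (\<lambda>x. x)"
  by (cases k) (auto intro!: exI[of _ "\<lambda>x v. v"] Ck_on_const)

lemma Ck_on_sum: "finite I \<Longrightarrow> (\<And>i. i \<in> I \<Longrightarrow> Ck_on k S (f i)) \<Longrightarrow> Ck_on k S (\<lambda>x. \<Sum>i\<in>I. f i x)"
  by (induction I rule: finite_induct) (auto intro: Ck_on_const Ck_on_add)

lemma linear_euclidean_expand:
  fixes v :: "'a::euclidean_space"
  assumes "linear L" shows "L v = (\<Sum>j\<in>Basis. (v \<bullet> j) *\<^sub>R L j)"
proof -
  have "L v = L (\<Sum>j\<in>Basis. (v \<bullet> j) *\<^sub>R j)" by (simp add: euclidean_representation)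
  also have "\<dots> = (\<Sum>j\<in>Basis. (v \<bullet> j) *\<^sub>R L j)"
    using assms by (simp add: linear_sum linear_scale)
  finally show ?thesis .
qed

text \<open>The chain rule differentiates \<open>g\<close> in the moving direction
  \<open>f' x v\<close>, while \<open>Ck_on\<close> only controls fixed directions. Expanding
  \<open>f' x v\<close> in the basis of the middle space turns it into finitely many fixed
  ones.\<close>

lemma Ck_on_compose:
  fixes f :: "'a::real_normed_vector \<Rightarrow> 'b::euclidean_space" and g :: "'b \<Rightarrow> 'c::real_normed_vector"
  shows "Ck_on k T g \<Longrightarrow> Ck_on k S f \<Longrightarrow> f ` S \<subseteq> T \<Longrightarrow> Ck_on k S (\<lambda>x. g (f x))"
proof (induction k arbitrary: g)
  case 0 then show ?case using continuous_on_compose2 by auto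
next
  case (Suc k)
  have f: "Ck_on k S f" using Suc.prems(2) by (rule Ck_on_Suc_imp)
  from Suc.prems(1,2) obtain f' g' where D: "\<forall>x\<in>S. (f has_derivative f' x) (at x within S)" "\<forall>v. Ck_on k S (\<lambda>x. f' x v)"
    "\<forall>x\<in>T. (g has_derivative g' x) (at x within T)" "\<forall>v. Ck_on k T (\<lambda>x. g' x v)" by auto
  have "((\<lambda>x. g (f x)) has_derivative (\<lambda>v. g' (f x) (f' x v))) (at x within S)" if "x \<in> S" for x
  proof -
    have "(g has_derivative g' (f x)) (at (f x) within f ` S)"
      using D(3) Suc.prems(3) that by (blast intro: has_derivative_subset)
    moreover have "(f has_derivative f' x) (at x within S)" using D(1) that by blast
    ultimately show ?thesis by (rule has_derivative_in_compose[rotated])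
  qed
  moreover have "Ck_on k S (\<lambda>x. g' (f x) (f' x v))" for v
  proof -
    have "Ck_on k S (\<lambda>x. \<Sum>j\<in>Basis. (f' x v \<bullet> j) *\<^sub>R g' (f x) j)"
      using D f Suc.prems(3)
      by (intro Ck_on_sum Ck_on_bilinear[OF bounded_bilinear_scaleR] Ck_on_bounded_linear_o[of "\<lambda>w. w \<bullet> _"]
          Suc.IH) (auto simp: bounded_linear_inner_left)
    moreover have "g' (f x) (f' x v) = (\<Sum>j\<in>Basis. (f' x v \<bullet> j) *\<^sub>R g' (f x) j)" if "x \<in> S" for x
    proof (rule linear_euclidean_expand)
      show "linear (g' (f x))" using D(3) Suc.prems(3) that by (blast intro: has_derivative_linear)
    qed
    ultimately show ?thesis by (rule Ck_on_eqI)
  qed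
  ultimately show ?case unfolding Ck_on.simps by (intro exI[of _ "\<lambda>x v. g' (f x) (f' x v)"]) auto
qed

lemma has_derivative_within_Int_open:
  assumes "open U" "x \<in> U"
  shows "(f has_derivative D) (at x within S \<inter> U) \<longleftrightarrow> (f has_derivative D) (at x within S)"
  using at_within_nhd[of x U "S \<inter> U" S] assms by auto

text \<open>The local derivatives are glued by taking \<open>frechet_derivative\<close> within
  \<open>S\<close> throughout. It agrees with each local witness because \<open>thick\<close> makes
  derivatives within \<open>S\<close> unique.\<close>

lemma Ck_on_local:
  fixes S :: "'a::euclidean_space set"
  assumes S: "thick S"
  shows "(\<And>x. x \<in> S \<Longrightarrow> \<exists>U. open U \<and> x \<in> U \<and> Ck_on k (S \<inter> U) f) \<Longrightarrow> Ck_on k S f"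
proof (induction k arbitrary: f)
  case 0
  show ?case unfolding Ck_on.simps continuous_on_eq_continuous_within
  proof
    fix x assume x: "x \<in> S"
    then obtain U where U: "open U" "x \<in> U" "continuous_on (S \<inter> U) f" using 0 by auto
    moreover have "at x within S \<inter> U = at x within S" using at_within_nhd[of x U "S \<inter> U" S] U by auto
    ultimately show "continuous (at x within S) f"
      using x by (metis IntI continuous_on_eq_continuous_within)
  qed
next
  case (Suc k)
  define f' where "f' x = frechet_derivative f (at x within S)" for x
  have *: "\<exists>U. open U \<and> x \<in> U \<and> (\<forall>y\<in>S\<inter>U. (f has_derivative f' y) (at y within S)) \<and> (\<forall>v. Ck_on k (S \<inter> U) (\<lambda>x. f' x v))"
    if x: "x \<in> S" for x
  proof -
    obtain U where U: "open U" "x \<in> U" "Ck_on (Suc k) (S \<inter> U) f" using Suc.prems x by metis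
    then obtain g where g: "\<forall>y\<in>S \<inter> U. (f has_derivative g y) (at y within S \<inter> U)" "\<forall>v. Ck_on k (S \<inter> U) (\<lambda>x. g x v)"
      by auto
    have *: "(f has_derivative f' y) (at y within S)" "g y = f' y" if "y \<in> S \<inter> U" for y
    proof -
      have 1: "(f has_derivative g y) (at y within S)" using has_derivative_within_Int_open[of U y f "g y" S] g U that by auto
      then show 2: "(f has_derivative f' y) (at y within S)" unfolding f'_def
        using differentiableI frechet_derivative_works by blast
      show "g y = f' y" using thick_derivative_unique[OF S _ 1 2] that by auto
    qed
    have "Ck_on k (S \<inter> U) (\<lambda>x. f' x v)" for v
      using g(2) Ck_on_cong[of "S \<inter> U" "\<lambda>x. g x v" "\<lambda>x. f' x v" k] * by auto
    then show ?thesis using U * by blast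
  qed
  show ?case unfolding Ck_on.simps
  proof (intro exI[of _ f'] conjI ballI allI)
    show "(f has_derivative f' x) (at x within S)" if "x \<in> S" for x using *[OF that] that by blast
    show "Ck_on k S (\<lambda>x. f' x v)" for v by (rule Suc.IH) (use * in blast)
  qed
qed

lemma smooth_on_cong: "(\<And>x. x \<in> S \<Longrightarrow> f x = g x) \<Longrightarrow> smooth_on S f \<longleftrightarrow> smooth_on S g"
  unfolding smooth_on_def using Ck_on_cong by blast

lemma smooth_on_eqI: "smooth_on S g \<Longrightarrow> (\<And>x. x \<in> S \<Longrightarrow> f x = g x) \<Longrightarrow> smooth_on S f"
  using smooth_on_cong[of S f g] by blast

lemma smooth_on_subset: "smooth_on S f \<Longrightarrow> T \<subseteq> S \<Longrightarrow> smooth_on T f"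
  unfolding smooth_on_def using Ck_on_subset by blast

lemma smooth_on_continuous: "smooth_on S f \<Longrightarrow> continuous_on S f"
  unfolding smooth_on_def using Ck_on.simps(1) by blast

lemma smooth_on_const: "smooth_on S (\<lambda>x. c)"
  unfolding smooth_on_def using Ck_on_const by blast

lemma smooth_on_id: "smooth_on S (\<lambda>x. x)"
  unfolding smooth_on_def using Ck_on_id by blast

lemma smooth_on_linear: "bounded_linear L \<Longrightarrow> smooth_on S f \<Longrightarrow> smooth_on S (\<lambda>x. L (f x))"
  unfolding smooth_on_def using Ck_on_bounded_linear_o by blast

lemma smooth_on_bilinear:
  "bounded_bilinear p \<Longrightarrow> smooth_on S f \<Longrightarrow> smooth_on S g \<Longrightarrow> smooth_on S (\<lambda>x. p (f x) (g x))"
  unfolding smooth_on_def using Ck_on_bilinear by blast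

lemma smooth_on_add: "smooth_on S f \<Longrightarrow> smooth_on S g \<Longrightarrow> smooth_on S (\<lambda>x. f x + g x)"
  unfolding smooth_on_def using Ck_on_add by blast

lemma smooth_on_sum: "finite I \<Longrightarrow> (\<And>i. i \<in> I \<Longrightarrow> smooth_on S (f i)) \<Longrightarrow> smooth_on S (\<lambda>x. \<Sum>i\<in>I. f i x)"
  unfolding smooth_on_def using Ck_on_sum[where f=f] by blast

lemma smooth_on_compose:
  fixes f :: "'a::real_normed_vector \<Rightarrow> 'b::euclidean_space"
  shows "smooth_on T g \<Longrightarrow> smooth_on S f \<Longrightarrow> f ` S \<subseteq> T \<Longrightarrow> smooth_on S (\<lambda>x. g (f x))"
  unfolding smooth_on_def using Ck_on_compose by blast

lemmas smooth_on_scaleR = smooth_on_bilinear[OF bounded_bilinear_scaleR]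
lemmas smooth_on_mult = smooth_on_bilinear[OF bounded_bilinear_mult]
lemmas smooth_on_inner = smooth_on_bilinear[OF bounded_bilinear_inner]

lemma smooth_on_minus: "smooth_on S f \<Longrightarrow> smooth_on S (\<lambda>x. - f x)"
  by (rule smooth_on_linear[OF bounded_linear_minus[OF bounded_linear_ident]])

lemma smooth_on_diff: "smooth_on S f \<Longrightarrow> smooth_on S g \<Longrightarrow> smooth_on S (\<lambda>x. f x - g x)"
  using smooth_on_add[OF _ smooth_on_minus, of S f g] by simp

lemma smooth_on_Pair: 
  assumes "smooth_on S f" "smooth_on S g" shows "smooth_on S (\<lambda>x. (f x, g x))"
proof -
  have "smooth_on S (\<lambda>x. (f x, 0) + (0, g x))"
    using assms by (intro smooth_on_add smooth_on_linear[of "\<lambda>x. (x, 0)"] smooth_on_linear[of "\<lambda>x. (0, x)"])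
      (auto intro!: bounded_linear_Pair bounded_linear_ident bounded_linear_zero)
  then show ?thesis by simp
qed

lemma smooth_on_nth: "smooth_on S f \<Longrightarrow> smooth_on S (\<lambda>x. f x $ i)"
  by (rule smooth_on_linear[OF bounded_linear_vec_nth])

lemma smooth_on_vec:
  fixes f :: "'a::real_normed_vector \<Rightarrow> real ^ 'n::finite"
  assumes "\<And>i. smooth_on S (\<lambda>x. f x $ i)" shows "smooth_on S f"
proof -
  have "smooth_on S (\<lambda>x. \<Sum>i\<in>UNIV. (f x $ i) *\<^sub>R axis i (1::real))"
    by (intro smooth_on_sum smooth_on_scaleR smooth_on_const assms) auto
  moreover have "(\<Sum>i\<in>UNIV. (f x $ i) *\<^sub>R axis i (1::real)) = f x" for x
    by (simp add: vec_eq_iff axis_def if_distrib cong: if_cong)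
  ultimately show ?thesis by simp
qed

lemma smooth_on_local:
  fixes S :: "'a::euclidean_space set"
  assumes "thick S" "\<And>x. x \<in> S \<Longrightarrow> \<exists>U. open U \<and> x \<in> U \<and> smooth_on (S \<inter> U) f"
  shows "smooth_on S f"
  using assms unfolding smooth_on_def by (meson Ck_on_local)

lemma smooth_on_has_derivative_within:
  fixes S :: "'a::euclidean_space set"
  assumes "smooth_on S f" "x \<in> S"
  shows "(f has_derivative frechet_derivative f (at x within S)) (at x within S)"
proof -
  have "Ck_on (Suc 0) S f" using assms smooth_on_def by blast
  then show ?thesis using assms(2) differentiableI frechet_derivative_works by (metis Ck_on.simps(2))
qed

lemma smooth_on_derivative_within:
  fixes S :: "'a::euclidean_space set"
  assumes "thick S" "smooth_on S f"
  shows "smooth_on S (\<lambda>x. frechet_derivative f (at x within S) v)"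
  unfolding smooth_on_def
proof
  fix k
  have "Ck_on (Suc k) S f" using assms smooth_on_def by blast
  then obtain f' where f': "\<forall>x\<in>S. (f has_derivative f' x) (at x within S)" "\<forall>v. Ck_on k S (\<lambda>x. f' x v)" by auto
  show "Ck_on k S (\<lambda>x. frechet_derivative f (at x within S) v)"
  proof (rule Ck_on_eqI[OF spec[OF f'(2)]])
    show "frechet_derivative f (at x within S) v = f' x v" if "x \<in> S" for x
      using thick_derivative_unique[OF assms(1) that smooth_on_has_derivative_within[OF assms(2) that] f'(1)[rule_format, OF that]]
      by simp
  qed
qed

lemma smooth_on_has_derivative:
  fixes S :: "'a::euclidean_space set"
  assumes "open S" "smooth_on S f" "x \<in> S"
  shows "(f has_derivative frechet_derivative f (at x)) (at x)"
  using smooth_on_has_derivative_within[OF assms(2,3)] unfolding at_within_open[OF assms(3,1)] .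

lemma smooth_on_derivative:
  fixes S :: "'a::euclidean_space set"
  assumes "open S" "smooth_on S f"
  shows "smooth_on S (\<lambda>x. frechet_derivative f (at x) v)"
  by (rule smooth_on_eqI[OF smooth_on_derivative_within[OF thick_open[OF assms(1)] assms(2), of v]])
    (simp only: at_within_open[OF _ assms(1)])

lemma smooth_on_derivI:
  assumes "\<And>x. x \<in> S \<Longrightarrow> (f has_derivative f' x) (at x within S)" "\<And>v. smooth_on S (\<lambda>x. f' x v)"
  shows "smooth_on S f"
  unfolding smooth_on_def
proof
  fix k
  have "Ck_on (Suc k) S f" unfolding Ck_on.simps
    by (rule exI[of _ f']) (use assms in \<open>auto simp: smooth_on_def\<close>)
  then show "Ck_on k S f" by (rule Ck_on_Suc_imp)
qed

text \<open>The derivative of \<open>inverse\<close> is again a product of values of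
  \<open>inverse\<close>, so each order of differentiability yields the next.\<close>

lemma smooth_on_inverse: "smooth_on {x::real. x \<noteq> 0} inverse"
  unfolding smooth_on_def
proof
  fix k show "Ck_on k {x::real. x \<noteq> 0} inverse"
  proof (induction k)
    case 0 show ?case by (auto intro!: continuous_intros)
  next
    case (Suc k)
    have "Ck_on k {x::real. x \<noteq> 0} (\<lambda>x. - (inverse x * v * inverse x))" for v
      by (rule Ck_on_bounded_linear_o[OF bounded_linear_minus[OF bounded_linear_ident]],
          rule Ck_on_bilinear[OF bounded_bilinear_mult Ck_on_bilinear[OF bounded_bilinear_mult Suc Ck_on_const] Suc])
    moreover have "(inverse has_derivative (\<lambda>v. - (inverse x * v * inverse x))) (at x within {x. x \<noteq> 0})"
      if "x \<noteq> 0" for x :: real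
      using that by (auto intro: has_derivative_inverse')
    ultimately show ?case unfolding Ck_on.simps by (intro exI[of _ "\<lambda>x v. - (inverse x * v * inverse x)"]) auto
  qed
qed


section \<open>A smooth step function\<close>

text \<open>For \<open>m = 0\<close> this is the classical smooth function whose derivatives all
  vanish at the origin. Its derivatives contain powers of \<open>1/x\<close>; the whole family is
  closed under differentiation up to linear combinations, so smoothness becomes an induction on the
  order.\<close>

definition flat :: "nat \<Rightarrow> real \<Rightarrow> real"
  where "flat m x = (if x \<le> 0 then 0 else (1/x)^m * exp (- (1/x)))"

lemma flat_tendsto_0: "(flat m \<longlongrightarrow> 0) (at 0)"
proof -
  have "((\<lambda>x::real. x ^ m / exp x) \<longlongrightarrow> 0) at_top" by (rule tendsto_power_div_exp_0)
  then have "((\<lambda>x::real. (inverse x) ^ m / exp (inverse x)) \<longlongrightarrow> 0) (at_right 0)"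
    by (rule filterlim_compose[OF _ filterlim_inverse_at_top_right])
  then have r: "(flat m \<longlongrightarrow> 0) (at_right 0)"
    by (rule Lim_transform_eventually)
       (auto simp: eventually_at_right_field flat_def exp_minus field_simps intro!: exI[of _ 1])
  have l: "(flat m \<longlongrightarrow> 0) (at_left 0)"
    by (rule Lim_transform_eventually[OF tendsto_const])
       (auto simp: eventually_at_left_field flat_def intro!: exI[of _ "-1"])
  show ?thesis using l r by (simp add: filterlim_split_at)
qed

lemma flat_has_derivative:
  "(flat m has_real_derivative (- real m * flat (Suc m) x + flat (Suc (Suc m)) x)) (at x)"
proof -
  consider "x < 0" | "x = 0" | "x > 0" by linarith
  then show ?thesis
  proof cases
    case 1
    have "((\<lambda>x. 0) has_real_derivative 0) (at x)" by simp
    then have "(flat m has_real_derivative 0) (at x)"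
      by (rule has_field_derivative_transform_within_open[of _ _ _ "{..<0}"]) (use 1 in \<open>auto simp: flat_def\<close>)
    then show ?thesis using 1 by (simp add: flat_def)
  next
    case 2
    \<comment> \<open>At 0 the difference quotient of \<open>flat m\<close> is
      \<open>flat (Suc m)\<close>.\<close>
    have "((\<lambda>h. flat (Suc m) h) \<longlongrightarrow> 0) (at 0)" by (rule flat_tendsto_0)
    then have "((\<lambda>h. (flat m (0 + h) - flat m 0) / h) \<longlongrightarrow> 0) (at 0)"
      by (rule Lim_transform_eventually) (auto simp: eventually_at_filter flat_def)
    then have "(flat m has_real_derivative 0) (at 0)" unfolding DERIV_def .
    then show ?thesis using 2 by (simp add: flat_def)
  next
    case 3
    have "((\<lambda>x. (1/x)^m * exp (- (1/x))) has_real_derivative (- real m * flat (Suc m) x + flat (Suc (Suc m)) x)) (at x)"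
      using 3 by (auto intro!: derivative_eq_intros simp: flat_def field_simps power2_eq_square)
         (cases m; simp add: field_simps power2_eq_square)
    then show ?thesis
      by (rule has_field_derivative_transform_within_open[of _ _ _ "{0<..}"]) (use 3 in \<open>auto simp: flat_def\<close>)
  qed
qed

lemma smooth_flat: "smooth_on UNIV (flat m)"
  unfolding smooth_on_def
proof
  fix k show "Ck_on k UNIV (flat m)"
  proof (induction k arbitrary: m)
    case 0 show ?case using DERIV_isCont[OF flat_has_derivative] by (auto simp: continuous_on_eq_continuous_at)
  next
    case (Suc k)
    have "Ck_on k UNIV (\<lambda>x. (- real m * flat (Suc m) x + flat (Suc (Suc m)) x) * v)" for v
      by (intro Ck_on_bilinear[OF bounded_bilinear_mult] Ck_on_add Ck_on_const Suc)
    moreover have "(flat m has_derivative (\<lambda>v. (- real m * flat (Suc m) x + flat (Suc (Suc m)) x) * v)) (at x)" for x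
      using flat_has_derivative[of m x] by (simp only: has_field_derivative_def)
    ultimately show ?case unfolding Ck_on.simps
      by (intro exI[of _ "\<lambda>x v. (- real m * flat (Suc m) x + flat (Suc (Suc m)) x) * v"]) auto
  qed
qed

definition smooth_step :: "real \<Rightarrow> real"
  where "smooth_step x = flat 0 x * inverse (flat 0 x + flat 0 (1 - x))"

lemma flat_0_sum_pos: "flat 0 x + flat 0 (1 - x) > 0"
proof -
  have "flat 0 x > 0 \<or> flat 0 (1 - x) > 0" "flat 0 x \<ge> 0" "flat 0 (1 - x) \<ge> 0" by (auto simp: flat_def)
  then show ?thesis by linarith
qed

lemma smooth_on_smooth_step: "smooth_on UNIV smooth_step"
proof -
  have 1: "smooth_on UNIV (\<lambda>x. flat 0 (1 - x))"
    by (rule smooth_on_compose[OF smooth_flat]) (auto intro: smooth_on_diff smooth_on_const smooth_on_id)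
  have "smooth_on UNIV (\<lambda>x. flat 0 x * inverse (flat 0 x + flat 0 (1 - x)))"
    by (intro smooth_on_mult smooth_flat smooth_on_compose[OF smooth_on_inverse] smooth_on_add 1)
       (use flat_0_sum_pos in \<open>auto simp: less_imp_neq[THEN not_sym]\<close>)
  then show ?thesis unfolding smooth_step_def[abs_def] .
qed

lemma smooth_step_le_0: "x \<le> 0 \<Longrightarrow> smooth_step x = 0"
  by (simp add: smooth_step_def flat_def)

lemma smooth_step_ge_1: "x \<ge> 1 \<Longrightarrow> smooth_step x = 1"
  using flat_0_sum_pos[of x] by (simp add: smooth_step_def flat_def)

lemma smooth_step_range: "0 \<le> smooth_step x" "smooth_step x \<le> 1"
proof -
  have "flat 0 x \<ge> 0" "flat 0 (1 - x) \<ge> 0" by (auto simp: flat_def)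
  then show "0 \<le> smooth_step x" "smooth_step x \<le> 1"
    using flat_0_sum_pos[of x] by (auto simp: smooth_step_def field_simps)
qed

section \<open>Smooth maps into a Lie group\<close>

text \<open>Smooth maps from Euclidean parameter sets, as in a diffeology. Functions, products and
  paths on the group are differentiated by composing with such maps.\<close>

definition plot :: "('g::topological_space, 'n::finite) chart set \<Rightarrow> 'a::euclidean_space set \<Rightarrow> ('a \<Rightarrow> 'g) \<Rightarrow> bool"
  where "plot A W f \<longleftrightarrow> continuous_on W f \<and>
    (\<forall>c\<in>A. smooth_on {x\<in>W. f x \<in> fst c} (\<lambda>x. snd c (f x)))"

lemma smooth_path_iff_plot: "smooth_path A \<gamma> \<longleftrightarrow> plot A {0..1} \<gamma>"
  unfolding smooth_path_def plot_def comp_def ..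

lemma plot_chart:
  assumes "plot A W f" "c \<in> A" "f ` W \<subseteq> fst c" shows "smooth_on W (\<lambda>x. snd c (f x))"
proof -
  have "{x\<in>W. f x \<in> fst c} = W" using assms(3) by auto
  then show ?thesis using assms(1,2) unfolding plot_def by metis
qed

lemma plot_compose:
  fixes f :: "'a::euclidean_space \<Rightarrow> 'g::topological_space"
  assumes "plot A W f" "smooth_on V h" "h ` V \<subseteq> W" shows "plot A V (\<lambda>x. f (h x))"
  unfolding plot_def
proof (intro conjI ballI)
  show "continuous_on V (\<lambda>x. f (h x))"
    using continuous_on_compose2[OF _ smooth_on_continuous[OF assms(2)] assms(3)] assms(1) plot_def by blast
  fix c assume "c \<in> A"
  then have "smooth_on {x\<in>W. f x \<in> fst c} (\<lambda>x. snd c (f x))" using assms(1) plot_def by blast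
  moreover have "smooth_on {x\<in>V. f (h x) \<in> fst c} h" by (rule smooth_on_subset[OF assms(2)]) auto
  ultimately show "smooth_on {x\<in>V. f (h x) \<in> fst c} (\<lambda>x. snd c (f (h x)))"
    by (rule smooth_on_compose) (use assms(3) in auto)
qed

lemma plot_subset: "plot A W f \<Longrightarrow> V \<subseteq> W \<Longrightarrow> plot A V f"
  using plot_compose[of A W f V "\<lambda>x. x"] smooth_on_id by auto

lemma plot_const: "plot A W (\<lambda>x. a)"
  unfolding plot_def by (auto intro: smooth_on_const continuous_on_const)

lemma plot_cong:
  fixes A :: "('g::topological_space, 'n::finite) chart set"
  assumes "\<And>x. x \<in> W \<Longrightarrow> f x = h x" shows "plot A W f \<longleftrightarrow> plot A W h"
proof -
  have "{x\<in>W. f x \<in> fst c} = {x\<in>W. h x \<in> fst c}" for c :: "('g, 'n) chart" using assms by auto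
  moreover have "smooth_on {x\<in>W. h x \<in> fst c} (\<lambda>x. snd c (f x)) = smooth_on {x\<in>W. h x \<in> fst c} (\<lambda>x. snd c (h x))" for c :: "('g, 'n) chart"
    by (rule smooth_on_cong) (use assms in auto)
  moreover have "continuous_on W f = continuous_on W h" using assms continuous_on_cong by blast
  ultimately show ?thesis unfolding plot_def by simp
qed

lemma continuous_on_open_preimage:
  assumes "continuous_on W f" "open B" obtains U where "open U" "W \<inter> U = {x\<in>W. f x \<in> B}"
proof -
  obtain U where "open U" "U \<inter> W = f -` B \<inter> W" using assms continuous_on_open_invariant by metis
  then show ?thesis using that[of U] by auto
qed

lemma plot_local:
  assumes W: "thick W" and "\<And>x. x \<in> W \<Longrightarrow> \<exists>U. open U \<and> x \<in> U \<and> plot A (W \<inter> U) f"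
    and A: "\<And>c. c \<in> A \<Longrightarrow> open (fst c)"
  shows "plot A W f"
proof -
  have cont: "continuous_on W f" unfolding continuous_on_eq_continuous_within
  proof
    fix x assume x: "x \<in> W"
    then obtain U where U: "open U" "x \<in> U" "plot A (W \<inter> U) f" using assms(2) by blast
    then have "continuous_on (W \<inter> U) f" by (simp add: plot_def)
    moreover have "at x within W \<inter> U = at x within W" using at_within_nhd[of x U "W \<inter> U" W] U by auto
    ultimately show "continuous (at x within W) f"
      using x U by (metis IntI continuous_on_eq_continuous_within)
  qed
  show ?thesis unfolding plot_def
  proof (intro conjI ballI cont)
    fix c assume c: "c \<in> A"
    obtain V where V: "open V" "W \<inter> V = {x\<in>W. f x \<in> fst c}"
      using continuous_on_open_preimage[OF cont A[OF c]] by blast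
    have "smooth_on (W \<inter> V) (\<lambda>x. snd c (f x))"
    proof (rule smooth_on_local)
      show "thick (W \<inter> V)" using W V by (intro thick_Int_open)
      fix x assume x: "x \<in> W \<inter> V"
      then obtain U where U: "open U" "x \<in> U" "plot A (W \<inter> U) f" using assms(2) by blast
      then have "smooth_on {x\<in>W \<inter> U. f x \<in> fst c} (\<lambda>x. snd c (f x))" using c plot_def by blast
      then have "smooth_on (W \<inter> V \<inter> U) (\<lambda>x. snd c (f x))" by (rule smooth_on_subset) (use V in auto)
      then show "\<exists>U. open U \<and> x \<in> U \<and> smooth_on (W \<inter> V \<inter> U) (\<lambda>x. snd c (f x))" using U by blast
    qed
    then show "smooth_on {x\<in>W. f x \<in> fst c} (\<lambda>x. snd c (f x))" using V by simp
  qed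
qed

section \<open>Smooth maps and smooth functions on a Lie group\<close>

locale lie =
  fixes A :: "('g::{topological_group_add, t2_space, second_countable_topology}, 'n::finite) chart set"
  assumes lie: "lie_group A"
begin

lemma chart_open: "c \<in> A \<Longrightarrow> open (fst c)"
  and chart_image_open: "c \<in> A \<Longrightarrow> open (snd c ` fst c)"
  and chart_homeo: "c \<in> A \<Longrightarrow> homeomorphism (fst c) (snd c ` fst c) (snd c) (chart_inv c)"
  and chart_cover: "\<exists>c\<in>A. p \<in> fst c"
proof -
  have A: "smooth_atlas A" using lie unfolding lie_group_def by blast
  show "c \<in> A \<Longrightarrow> open (fst c)" "c \<in> A \<Longrightarrow> open (snd c ` fst c)"
    "c \<in> A \<Longrightarrow> homeomorphism (fst c) (snd c ` fst c) (snd c) (chart_inv c)"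
    using A unfolding smooth_atlas_def by blast+
  have "(\<Union>c\<in>A. fst c) = UNIV" using A unfolding smooth_atlas_def by blast
  then show "\<exists>c\<in>A. p \<in> fst c" by blast
qed

lemma chart_inv_chart: "c \<in> A \<Longrightarrow> p \<in> fst c \<Longrightarrow> chart_inv c (snd c p) = p"
  and chart_chart_inv: "c \<in> A \<Longrightarrow> x \<in> snd c ` fst c \<Longrightarrow> snd c (chart_inv c x) = x"
  and chart_inv_in: "c \<in> A \<Longrightarrow> x \<in> snd c ` fst c \<Longrightarrow> chart_inv c x \<in> fst c"
  using chart_homeo unfolding homeomorphism_def by blast+

lemma plot_chart_inv: assumes "c \<in> A" shows "plot A (snd c ` fst c) (chart_inv c)"
  unfolding plot_def
proof (intro conjI ballI)
  show "continuous_on (snd c ` fst c) (chart_inv c)" using chart_homeo[OF assms] homeomorphism_def by blast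
  fix d assume "d \<in> A"
  then have "smooth_on (snd c ` (fst c \<inter> fst d)) (snd d \<circ> chart_inv c)"
    using lie assms unfolding lie_group_def smooth_atlas_def by blast
  moreover have "{x \<in> snd c ` fst c. chart_inv c x \<in> fst d} = snd c ` (fst c \<inter> fst d)"
    using chart_inv_chart[OF assms] by auto
  ultimately show "smooth_on {x \<in> snd c ` fst c. chart_inv c x \<in> fst d} (\<lambda>x. snd d (chart_inv c x))"
    by (simp add: comp_def)
qed

lemma plot_in_chart:
  assumes "plot A W f" "x \<in> W" "c \<in> A" "f x \<in> fst c"
  obtains U where "open U" "x \<in> U" "f ` (W \<inter> U) \<subseteq> fst c" "smooth_on (W \<inter> U) (\<lambda>x. snd c (f x))"
proof -
  obtain U where U: "open U" "W \<inter> U = {x\<in>W. f x \<in> fst c}"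
    using continuous_on_open_preimage[OF _ chart_open[OF assms(3)], of W f] assms(1) plot_def by blast
  moreover have "x \<in> U" using U assms by blast
  moreover have "smooth_on (W \<inter> U) (\<lambda>x. snd c (f x))" unfolding U(2) using assms(1,3) unfolding plot_def by blast
  moreover have "f ` (W \<inter> U) \<subseteq> fst c" using U by auto
  ultimately show ?thesis using that by blast
qed

lemma smooth_fun_plot:
  assumes "smooth_fun A F" "plot A W f" "thick W" shows "smooth_on W (\<lambda>x. F (f x))"
proof (rule smooth_on_local[OF assms(3)])
  fix x assume x: "x \<in> W"
  obtain c where c: "c \<in> A" "f x \<in> fst c" using chart_cover by blast
  obtain U where U: "open U" "x \<in> U" "f ` (W \<inter> U) \<subseteq> fst c" "smooth_on (W \<inter> U) (\<lambda>x. snd c (f x))"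
    using plot_in_chart[OF assms(2) x c] .
  have "smooth_on (snd c ` fst c) (F \<circ> chart_inv c)" using assms(1) c smooth_fun_def by blast
  then have "smooth_on (W \<inter> U) (\<lambda>x. (F \<circ> chart_inv c) (snd c (f x)))"
    by (rule smooth_on_compose[OF _ U(4)]) (use U in auto)
  then have "smooth_on (W \<inter> U) (\<lambda>x. F (f x))"
    by (rule smooth_on_eqI) (use U(3) chart_inv_chart[OF c(1)] in auto)
  then show "\<exists>U. open U \<and> x \<in> U \<and> smooth_on (W \<inter> U) (\<lambda>x. F (f x))" using U by blast
qed

lemma smooth_funI: "(\<And>c. c \<in> A \<Longrightarrow> smooth_on (snd c ` fst c) (\<lambda>x. F (chart_inv c x))) \<Longrightarrow> smooth_fun A F"
  unfolding smooth_fun_def comp_def by blast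

lemma smooth_fun_chart: "c \<in> A \<Longrightarrow> smooth_fun A F \<Longrightarrow> smooth_on (snd c ` fst c) (\<lambda>x. F (chart_inv c x))"
  unfolding smooth_fun_def comp_def by blast

text \<open>Charts for \<open>f\<close>, for \<open>h\<close> and for the sum can only be fixed near
  a point. The smoothness of the group law in charts is applied there and the results are
  glued.\<close>

lemma plot_add:
  assumes f: "plot A W f" and h: "plot A W h" and W: "thick W" shows "plot A W (\<lambda>x. f x + h x)"
proof -
  have cf: "continuous_on W f" and ch: "continuous_on W h" using f h by (auto simp: plot_def)
  have cont: "continuous_on W (\<lambda>x. f x + h x)" by (rule continuous_on_add[OF cf ch])
  show ?thesis unfolding plot_def
  proof (intro conjI ballI cont)
    fix c assume c: "c \<in> A"
    obtain V where V: "open V" "W \<inter> V = {x\<in>W. f x + h x \<in> fst c}"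
      using continuous_on_open_preimage[OF cont chart_open[OF c]] by blast
    have "smooth_on (W \<inter> V) (\<lambda>x. snd c (f x + h x))"
    proof (rule smooth_on_local)
      show "thick (W \<inter> V)" using W V by (intro thick_Int_open)
      fix x assume x: "x \<in> W \<inter> V"
      obtain a where a: "a \<in> A" "f x \<in> fst a" using chart_cover by blast
      obtain b where b: "b \<in> A" "h x \<in> fst b" using chart_cover by blast
      obtain U where U: "open U" "x \<in> U" "f ` (W \<inter> U) \<subseteq> fst a" "smooth_on (W \<inter> U) (\<lambda>x. snd a (f x))"
        using plot_in_chart[OF f _ a] x by blast
      obtain U' where U': "open U'" "x \<in> U'" "h ` (W \<inter> U') \<subseteq> fst b" "smooth_on (W \<inter> U') (\<lambda>x. snd b (h x))"
        using plot_in_chart[OF h _ b] x by blast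
      let ?U = "W \<inter> V \<inter> (U \<inter> U')"
      have inV: "f y + h y \<in> fst c" if "y \<in> ?U" for y using that V(2) by blast
      have "smooth_on {(x, y). x \<in> snd a ` fst a \<and> y \<in> snd b ` fst b \<and> chart_inv a x + chart_inv b y \<in> fst c}
         (\<lambda>(x, y). snd c (chart_inv a x + chart_inv b y))"
        using lie a b c unfolding lie_group_def by blast
      moreover have "smooth_on ?U (\<lambda>x. (snd a (f x), snd b (h x)))"
        by (intro smooth_on_Pair; rule smooth_on_subset[OF U(4)] smooth_on_subset[OF U'(4)]; blast)
      moreover have in_a: "f y \<in> fst a" "h y \<in> fst b" if "y \<in> ?U" for y using that U(3) U'(3) by auto
      then have "(\<lambda>x. (snd a (f x), snd b (h x))) ` ?U \<subseteq>
         {(x, y). x \<in> snd a ` fst a \<and> y \<in> snd b ` fst b \<and> chart_inv a x + chart_inv b y \<in> fst c}"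
        using inV by (intro image_subsetI) (simp add: chart_inv_chart[OF a(1)] chart_inv_chart[OF b(1)])
      ultimately have "smooth_on ?U (\<lambda>x. (\<lambda>(x, y). snd c (chart_inv a x + chart_inv b y)) (snd a (f x), snd b (h x)))"
        by (rule smooth_on_compose)
      then have "smooth_on ?U (\<lambda>x. snd c (f x + h x))"
        by (rule smooth_on_eqI) (simp add: in_a chart_inv_chart[OF a(1)] chart_inv_chart[OF b(1)])
      then show "\<exists>U. open U \<and> x \<in> U \<and> smooth_on (W \<inter> V \<inter> U) (\<lambda>x. snd c (f x + h x))"
        using U U' by (intro exI[of _ "U \<inter> U'"]) auto
    qed
    then show "smooth_on {x\<in>W. f x + h x \<in> fst c} (\<lambda>x. snd c (f x + h x))" using V by simp
  qed
qed

lemma plot_minus: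
  assumes f: "plot A W f" and W: "thick W" shows "plot A W (\<lambda>x. - f x)"
proof -
  have cf: "continuous_on W f" using f by (auto simp: plot_def)
  have cont: "continuous_on W (\<lambda>x. - f x)" using cf unfolding continuous_on_def by (auto intro: tendsto_minus)
  show ?thesis unfolding plot_def
  proof (intro conjI ballI cont)
    fix c assume c: "c \<in> A"
    obtain V where V: "open V" "W \<inter> V = {x\<in>W. - f x \<in> fst c}"
      using continuous_on_open_preimage[OF cont chart_open[OF c]] by blast
    have "smooth_on (W \<inter> V) (\<lambda>x. snd c (- f x))"
    proof (rule smooth_on_local)
      show "thick (W \<inter> V)" using W V by (intro thick_Int_open)
      fix x assume x: "x \<in> W \<inter> V"
      obtain a where a: "a \<in> A" "f x \<in> fst a" using chart_cover by blast
      obtain U where U: "open U" "x \<in> U" "f ` (W \<inter> U) \<subseteq> fst a" "smooth_on (W \<inter> U) (\<lambda>x. snd a (f x))"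
        using plot_in_chart[OF f _ a] x by blast
      let ?U = "W \<inter> V \<inter> U"
      have inV: "- f y \<in> fst c" if "y \<in> ?U" for y using that V(2) by blast
      have "smooth_on {x. x \<in> snd a ` fst a \<and> - chart_inv a x \<in> fst c} (\<lambda>x. snd c (- chart_inv a x))"
        using lie a c unfolding lie_group_def by blast
      moreover have "smooth_on ?U (\<lambda>x. snd a (f x))"
        by (rule smooth_on_subset[OF U(4)]) blast
      moreover have in_a: "f y \<in> fst a" if "y \<in> ?U" for y using that U(3) by auto
      then have "(\<lambda>x. snd a (f x)) ` ?U \<subseteq> {x. x \<in> snd a ` fst a \<and> - chart_inv a x \<in> fst c}"
        using inV by (intro image_subsetI) (simp add: chart_inv_chart[OF a(1)])
      ultimately have "smooth_on ?U (\<lambda>x. snd c (- chart_inv a (snd a (f x))))"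
        by (rule smooth_on_compose)
      then have "smooth_on ?U (\<lambda>x. snd c (- f x))"
        by (rule smooth_on_eqI) (simp add: in_a chart_inv_chart[OF a(1)])
      then show "\<exists>U. open U \<and> x \<in> U \<and> smooth_on (W \<inter> V \<inter> U) (\<lambda>x. snd c (- f x))"
        using U by blast
    qed
    then show "smooth_on {x\<in>W. - f x \<in> fst c} (\<lambda>x. snd c (- f x))" using V by simp
  qed
qed

lemma smooth_fun_translate: assumes "smooth_fun A F" shows "smooth_fun A (\<lambda>q. F (a + q))"
proof (rule smooth_funI)
  fix c assume c: "c \<in> A"
  have th: "thick (snd c ` fst c)" using chart_image_open[OF c] thick_open by blast
  show "smooth_on (snd c ` fst c) (\<lambda>x. F (a + chart_inv c x))"
    by (rule smooth_fun_plot[OF assms plot_add[OF plot_const plot_chart_inv[OF c] th] th])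
qed

lemma smooth_fun_translate_iff: "smooth_fun A (\<lambda>q. F (a + q)) \<longleftrightarrow> smooth_fun A F"
  using smooth_fun_translate[of F a] smooth_fun_translate[of "\<lambda>q. F (a + q)" "- a"]
  by (auto simp: add.assoc[symmetric])

lemma smooth_fun_const: "smooth_fun A (\<lambda>p. c)"
  by (rule smooth_funI) (rule smooth_on_const)

lemma smooth_fun_add: "smooth_fun A f \<Longrightarrow> smooth_fun A h \<Longrightarrow> smooth_fun A (\<lambda>p. f p + h p)"
  unfolding smooth_fun_def comp_def by (auto intro: smooth_on_add)

lemma smooth_fun_mult: "smooth_fun A f \<Longrightarrow> smooth_fun A h \<Longrightarrow> smooth_fun A (\<lambda>p. f p * h p)"
  unfolding smooth_fun_def comp_def by (auto intro: smooth_on_mult)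

lemma smooth_fun_sum: "finite I \<Longrightarrow> (\<And>i. i \<in> I \<Longrightarrow> smooth_fun A (f i)) \<Longrightarrow> smooth_fun A (\<lambda>p. \<Sum>i\<in>I. f i p)"
  by (induction I rule: finite_induct) (auto intro: smooth_fun_const smooth_fun_add)

text \<open>The image of \<open>K\<close> in the group is compact, hence closed by the Hausdorff
  property. A point outside the chart therefore has a neighbourhood that avoids it, and on this
  neighbourhood the extension is zero.\<close>

lemma smooth_fun_extend:
  assumes c: "c \<in> A" and K: "compact K" "K \<subseteq> snd c ` fst c"
    and u: "smooth_on (snd c ` fst c) u" "\<And>x. x \<notin> K \<Longrightarrow> u x = 0"
  shows "smooth_fun A (\<lambda>q. if q \<in> fst c then u (snd c q) else 0)"
proof (rule smooth_funI)
  fix d assume d: "d \<in> A"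
  let ?W = "snd d ` fst d" and ?f = "\<lambda>q. if q \<in> fst c then u (snd c q) else 0"
  have W: "open ?W" "thick ?W" using chart_image_open[OF d] thick_open by blast+
  have p: "plot A ?W (chart_inv d)" by (rule plot_chart_inv[OF d])
  then have cont: "continuous_on ?W (chart_inv d)" by (simp add: plot_def)
  have "continuous_on (snd c ` fst c) (chart_inv c)" using plot_chart_inv[OF c] by (simp add: plot_def)
  then have "compact (chart_inv c ` K)" using K compact_continuous_image continuous_on_subset by blast
  then have cl: "closed (chart_inv c ` K)" by (rule compact_imp_closed)
  show "smooth_on ?W (\<lambda>x. ?f (chart_inv d x))"
  proof (rule smooth_on_local[OF W(2)])
    fix x assume x: "x \<in> ?W"
    show "\<exists>U. open U \<and> x \<in> U \<and> smooth_on (?W \<inter> U) (\<lambda>x. ?f (chart_inv d x))"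
    proof (cases "chart_inv d x \<in> fst c")
      case True
      obtain U where U: "open U" "x \<in> U" "chart_inv d ` (?W \<inter> U) \<subseteq> fst c" "smooth_on (?W \<inter> U) (\<lambda>x. snd c (chart_inv d x))"
        using plot_in_chart[OF p x c True] .
      have "smooth_on (?W \<inter> U) (\<lambda>x. u (snd c (chart_inv d x)))"
        by (rule smooth_on_compose[OF u(1) U(4)]) (use U(3) in auto)
      then have "smooth_on (?W \<inter> U) (\<lambda>x. ?f (chart_inv d x))"
        by (rule smooth_on_eqI) (use U(3) in auto)
      then show ?thesis using U by blast
    next
      case False
      have out: "chart_inv d x \<in> - (chart_inv c ` K)"
      proof
        assume "chart_inv d x \<in> chart_inv c ` K"
        then obtain y where y: "y \<in> K" "chart_inv d x = chart_inv c y" by (rule imageE)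
        then show False using False chart_inv_in[OF c subsetD[OF K(2) y(1)]] by simp
      qed
      obtain U where U: "open U" "?W \<inter> U = {x\<in>?W. chart_inv d x \<in> - (chart_inv c ` K)}"
        by (rule continuous_on_open_preimage[OF cont open_Compl[OF cl]])
      with out have "x \<in> U" using x by blast
      have "?f (chart_inv d y) = 0" if "y \<in> ?W \<inter> U" for y
      proof (cases "chart_inv d y \<in> fst c")
        case True
        have "chart_inv d y \<notin> chart_inv c ` K" using that U by blast
        then have "snd c (chart_inv d y) \<notin> K" using chart_inv_chart[OF c True] by force
        then show ?thesis using u(2) by simp
      qed simp
      then have "smooth_on (?W \<inter> U) (\<lambda>x. ?f (chart_inv d x))"
        by (rule smooth_on_eqI[OF smooth_on_const[of _ 0]])
      then show ?thesis using U \<open>x \<in> U\<close> by blast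
    qed
  qed
qed

end

lemma smooth_bump:
  fixes a :: "'a::euclidean_space" assumes "r > 0"
  obtains b :: "'a \<Rightarrow> real" where "smooth_on UNIV b" "\<And>x. x \<in> cball a r \<Longrightarrow> b x = 1" "\<And>x. x \<notin> cball a (2 * r) \<Longrightarrow> b x = 0"
proof
  \<comment> \<open>The squared distance keeps the argument polynomial. The argument is at least 1
    up to distance \<open>r\<close> and at most -2 beyond distance \<open>2 * r\<close>.\<close>
  let ?b = "\<lambda>x. smooth_step (2 + (-1/r\<^sup>2) * ((x - a) \<bullet> (x - a)))"
  show "smooth_on UNIV ?b"
    by (rule smooth_on_compose[OF smooth_on_smooth_step])
      (intro smooth_on_add smooth_on_mult smooth_on_inner smooth_on_diff smooth_on_id smooth_on_const, simp)
  show "?b x = 1" if "x \<in> cball a r" for x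
  proof -
    have "norm (x - a) \<le> r" using that by (simp add: dist_norm norm_minus_commute)
    then have "(x - a) \<bullet> (x - a) \<le> r\<^sup>2" using power_mono[of "norm (x - a)" r 2] by (simp add: power2_norm_eq_inner)
    then have "((x - a) \<bullet> (x - a)) / r\<^sup>2 \<le> 1" using assms by simp
    then show ?thesis by (intro smooth_step_ge_1) simp
  qed
  show "?b x = 0" if "x \<notin> cball a (2 * r)" for x
  proof -
    have "norm (x - a) \<ge> 2 * r" using that by (simp add: dist_norm norm_minus_commute)
    then have "(x - a) \<bullet> (x - a) \<ge> (2 * r)\<^sup>2" using power_mono[of "2 * r" "norm (x - a)" 2] assms by (simp add: power2_norm_eq_inner)
    then have "((x - a) \<bullet> (x - a)) / r\<^sup>2 \<ge> 4" using assms by (simp add: field_simps)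
    then show ?thesis by (intro smooth_step_le_0) simp
  qed
qed

section \<open>Integration along rays\<close>

text \<open>The weight \<open>t ^ j\<close> is present because differentiating
  \<open>\<phi> (t x)\<close> in \<open>x\<close> produces a factor \<open>t\<close>. With it the
  family is closed under differentiation.\<close>

definition ray_integral :: "nat \<Rightarrow> ('a::euclidean_space \<Rightarrow> 'b::euclidean_space) \<Rightarrow> 'a \<Rightarrow> 'b"
  where "ray_integral j \<phi> x = integral {0..1} (\<lambda>t. t ^ j *\<^sub>R \<phi> (t *\<^sub>R x))"

lemma convex_ray: "convex S \<Longrightarrow> 0 \<in> S \<Longrightarrow> x \<in> S \<Longrightarrow> t \<in> {0..1} \<Longrightarrow> t *\<^sub>R x \<in> S"
  using convexD[of S x 0 t "1 - t"] by simp

lemma has_derivative_comp: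
  assumes "(f has_derivative f') (at x within s)" "(g has_derivative g') (at y)" "y = f x"
  shows "((\<lambda>x. g (f x)) has_derivative (\<lambda>v. g' (f' v))) (at x within s)"
  using has_derivative_compose[of f f' x s g g'] assms by simp

lemma ray_continuous:
  fixes \<phi> :: "'a::euclidean_space \<Rightarrow> 'b::euclidean_space"
  assumes "convex S" "0 \<in> S" "continuous_on S \<phi>" "x \<in> S"
  shows "continuous_on {0..1::real} (\<lambda>t. t ^ j *\<^sub>R \<phi> (t *\<^sub>R x))"
proof -
  have "continuous_on {0..1::real} (\<lambda>t. \<phi> (t *\<^sub>R x))"
    by (rule continuous_on_compose2[OF assms(3)])
      (use convex_ray[OF assms(1,2,4)] in \<open>auto intro!: continuous_intros\<close>)
  then show ?thesis by (intro continuous_intros)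
qed

lemma ray_integral_linear:
  assumes "convex S" "0 \<in> S" "x \<in> S" "finite I" "\<And>i. i \<in> I \<Longrightarrow> continuous_on S (\<phi> i)"
  shows "ray_integral j (\<lambda>y. \<Sum>i\<in>I. c i *\<^sub>R \<phi> i y) x = (\<Sum>i\<in>I. c i *\<^sub>R ray_integral j (\<phi> i) x)"
proof -
  have 1: "(\<lambda>t. t ^ j *\<^sub>R (\<Sum>i\<in>I. c i *\<^sub>R \<phi> i (t *\<^sub>R x))) = (\<lambda>t. \<Sum>i\<in>I. c i *\<^sub>R (t ^ j *\<^sub>R \<phi> i (t *\<^sub>R x)))"
    by (simp add: scaleR_sum_right algebra_simps)
  have 2: "(\<lambda>t. t ^ j *\<^sub>R \<phi> i (t *\<^sub>R x)) integrable_on {0..1}" if "i \<in> I" for i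
    using ray_continuous[OF assms(1,2) assms(5)[OF that] assms(3)] integrable_continuous_interval by blast
  have "integral {0..1} (\<lambda>t. \<Sum>i\<in>I. c i *\<^sub>R (t ^ j *\<^sub>R \<phi> i (t *\<^sub>R x)))
      = (\<Sum>i\<in>I. integral {0..1} (\<lambda>t. c i *\<^sub>R (t ^ j *\<^sub>R \<phi> i (t *\<^sub>R x))))"
    by (rule integral_sum[OF assms(4)]) (rule integrable_cmul[OF 2])
  then show ?thesis unfolding ray_integral_def 1 by (simp only: integral_cmul)
qed

lemma ray_integral_has_derivative:
  fixes \<phi> :: "'a::euclidean_space \<Rightarrow> 'b::euclidean_space"
  assumes S: "open S" "convex S" "0 \<in> S" and \<phi>: "smooth_on S \<phi>" and x: "x \<in> S"
  shows "(ray_integral j \<phi> has_derivative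
           (\<lambda>v. ray_integral (Suc j) (\<lambda>y. frechet_derivative \<phi> (at y) v) x)) (at x)"
proof -
  let ?D = "\<lambda>y. frechet_derivative \<phi> (at y)"
  have D: "(\<phi> has_derivative ?D y) (at y)" if "y \<in> S" for y using smooth_on_has_derivative[OF S(1) \<phi> that] .
  \<comment> \<open>\<open>leibniz_rule\<close> asks for a derivative that is continuous as a map
    into the bounded linear functions. In finite dimension this can be checked on basis
    vectors.\<close>
  define B where "B y = Blinfun (?D y)" for y
  have B: "blinfun_apply (B y) = ?D y" if "y \<in> S" for y
    unfolding B_def using D[OF that] has_derivative_bounded_linear bounded_linear_Blinfun_apply by blast
  have contB: "continuous_on S B"
  proof (rule continuous_on_blinfun_componentwise)
    fix i :: 'a assume "i \<in> Basis"
    have "continuous_on S (\<lambda>y. ?D y i)" using smooth_on_continuous[OF smooth_on_derivative[OF S(1) \<phi>]] .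
    then show "continuous_on S (\<lambda>y. B y i)" by (rule continuous_on_eq) (simp add: B)
  qed
  define fx where "fx y t = (t ^ j * t) *\<^sub>R B (t *\<^sub>R y)" for y and t :: real
  have fx: "((\<lambda>y. t ^ j *\<^sub>R \<phi> (t *\<^sub>R y)) has_derivative blinfun_apply (fx y t)) (at y within S)"
    if y: "y \<in> S" and t: "t \<in> cbox 0 1" for y t
  proof -
    have ty: "t *\<^sub>R y \<in> S" using convex_ray[OF S(2,3) y] t by simp
    have "((\<lambda>y. t *\<^sub>R y) has_derivative (\<lambda>v. t *\<^sub>R v)) (at y within S)"
      by (auto intro!: derivative_eq_intros)
    then have "((\<lambda>y. \<phi> (t *\<^sub>R y)) has_derivative (\<lambda>v. ?D (t *\<^sub>R y) (t *\<^sub>R v))) (at y within S)"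
      by (rule has_derivative_comp[OF _ D[OF ty]]) simp
    then have "((\<lambda>y. t ^ j *\<^sub>R \<phi> (t *\<^sub>R y)) has_derivative (\<lambda>v. t ^ j *\<^sub>R ?D (t *\<^sub>R y) (t *\<^sub>R v))) (at y within S)"
      by (rule has_derivative_scaleR_right)
    moreover have "(\<lambda>v. t ^ j *\<^sub>R ?D (t *\<^sub>R y) (t *\<^sub>R v)) = blinfun_apply (fx y t)"
      using linear_scale[OF has_derivative_linear[OF D[OF ty]]]
      by (auto simp: fx_def B[OF ty] blinfun.scaleR_left)
    ultimately show ?thesis by simp
  qed
  have contfx: "continuous_on (S \<times> cbox 0 1) (\<lambda>(y, t). fx y t)"
  proof -
    have "continuous_on (S \<times> cbox 0 1) (\<lambda>z. B (snd z *\<^sub>R fst z))"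
      by (rule continuous_on_compose2[OF contB])
        (use convex_ray[OF S(2,3)] in \<open>auto intro!: continuous_intros\<close>)
    then have "continuous_on (S \<times> cbox 0 1) (\<lambda>z. (snd z ^ j * snd z) *\<^sub>R B (snd z *\<^sub>R fst z))"
      by (intro continuous_intros)
    then show ?thesis by (simp add: fx_def case_prod_beta)
  qed
  have int: "(\<lambda>t. t ^ j *\<^sub>R \<phi> (t *\<^sub>R y)) integrable_on cbox 0 1" if "y \<in> S" for y
    using integrable_continuous_interval[OF ray_continuous[OF S(2,3) smooth_on_continuous[OF \<phi>] that]] by simp
  have 1: "((\<lambda>y. integral (cbox 0 1) (\<lambda>t. t ^ j *\<^sub>R \<phi> (t *\<^sub>R y))) has_derivative
      blinfun_apply (integral (cbox 0 1) (fx x))) (at x within S)"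
    by (rule leibniz_rule[OF fx int contfx x S(2)])
  have 2: "blinfun_apply (integral (cbox 0 1) (fx x)) v = ray_integral (Suc j) (\<lambda>y. ?D y v) x" for v
  proof -
    have "continuous_on (cbox 0 1) (\<lambda>t. (\<lambda>(y, t). fx y t) (x, t))"
      by (rule continuous_on_compose2[OF contfx]) (use x in \<open>auto intro!: continuous_intros\<close>)
    then have "continuous_on {0..1} (fx x)" by simp
    then have "fx x integrable_on cbox 0 1" unfolding cbox_interval by (rule integrable_continuous_interval)
    then have "blinfun_apply (integral (cbox 0 1) (fx x)) v = integral (cbox 0 1) ((\<lambda>L. blinfun_apply L v) \<circ> fx x)"
      by (rule integral_linear[symmetric]) (rule blinfun.bounded_linear_left)
    also have "\<dots> = integral (cbox 0 1) (\<lambda>t. t ^ Suc j *\<^sub>R ?D (t *\<^sub>R x) v)"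
    proof (rule integral_cong)
      fix t :: real assume "t \<in> cbox 0 1"
      then have "t *\<^sub>R x \<in> S" using convex_ray[OF S(2,3) x] by simp
      then show "((\<lambda>L. blinfun_apply L v) \<circ> fx x) t = t ^ Suc j *\<^sub>R ?D (t *\<^sub>R x) v"
        by (simp add: fx_def B blinfun.scaleR_left mult.commute)
    qed
    finally show ?thesis by (simp add: ray_integral_def)
  qed
  have 3: "blinfun_apply (integral (cbox 0 1) (fx x)) = (\<lambda>v. ray_integral (Suc j) (\<lambda>y. ?D y v) x)"
    by (rule ext) (rule 2)
  show ?thesis using 1 unfolding at_within_open[OF x S(1)] 3
    by (simp add: ray_integral_def[abs_def])
qed

lemma smooth_on_ray_integral:
  assumes S: "open S" "convex S" "0 \<in> S" and \<phi>: "smooth_on S \<phi>"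
  shows "smooth_on S (ray_integral j \<phi>)"
  unfolding smooth_on_def
proof
  fix k show "Ck_on k S (ray_integral j \<phi>)" using \<phi>
  proof (induction k arbitrary: j \<phi>)
    case 0
    show ?case unfolding Ck_on.simps
    proof (rule has_derivative_continuous_on)
      fix x assume "x \<in> S"
      show "(ray_integral j \<phi> has_derivative
           (\<lambda>v. ray_integral (Suc j) (\<lambda>y. frechet_derivative \<phi> (at y) v) x)) (at x within S)"
        by (rule has_derivative_at_withinI[OF ray_integral_has_derivative[OF S 0 \<open>x \<in> S\<close>]])
    qed
  next
    case (Suc k)
    show ?case unfolding Ck_on.simps
    proof (intro exI[of _ "\<lambda>x v. ray_integral (Suc j) (\<lambda>y. frechet_derivative \<phi> (at y) v) x"] conjI ballI allI)
      fix x assume "x \<in> S"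
      show "(ray_integral j \<phi> has_derivative
           (\<lambda>v. ray_integral (Suc j) (\<lambda>y. frechet_derivative \<phi> (at y) v) x)) (at x within S)"
        by (rule has_derivative_at_withinI[OF ray_integral_has_derivative[OF S Suc.prems \<open>x \<in> S\<close>]])
    next
      fix v
      show "Ck_on k S (\<lambda>x. ray_integral (Suc j) (\<lambda>y. frechet_derivative \<phi> (at y) v) x)"
        using Suc.IH[OF smooth_on_derivative[OF S(1) Suc.prems]] by simp
    qed
  qed
qed

lemma ray_path_derivative:
  fixes \<phi> :: "'a::euclidean_space \<Rightarrow> 'b::euclidean_space"
  assumes S: "open S" "convex S" "0 \<in> S" and \<phi>: "smooth_on S \<phi>" and x: "x \<in> S" and t: "t \<in> {0..1::real}"
  shows "((\<lambda>t. \<phi> (t *\<^sub>R x)) has_vector_derivative frechet_derivative \<phi> (at (t *\<^sub>R x)) x) (at t within {0..1})"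
proof -
  have tx: "t *\<^sub>R x \<in> S" using convex_ray[OF S(2,3) x t] .
  have D: "(\<phi> has_derivative frechet_derivative \<phi> (at (t *\<^sub>R x))) (at (t *\<^sub>R x))"
    by (rule smooth_on_has_derivative[OF S(1) \<phi> tx])
  have "((\<lambda>t. t *\<^sub>R x) has_derivative (\<lambda>s. s *\<^sub>R x)) (at t within {0..1})"
    by (auto intro!: derivative_eq_intros)
  then have "((\<lambda>t. \<phi> (t *\<^sub>R x)) has_derivative (\<lambda>s. frechet_derivative \<phi> (at (t *\<^sub>R x)) (s *\<^sub>R x))) (at t within {0..1})"
    by (rule has_derivative_comp[OF _ D]) simp
  then show ?thesis unfolding has_vector_derivative_def
    by (simp add: linear_scale[OF has_derivative_linear[OF D]])
qed

text \<open>The fundamental theorem of calculus for \<open>\<phi> (t x)\<close> and for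
  \<open>t \<phi> (t x)\<close> as functions of \<open>t\<close>.\<close>

lemma ray_integral_ftc:
  fixes \<phi> :: "'a::euclidean_space \<Rightarrow> 'b::euclidean_space"
  assumes S: "open S" "convex S" "0 \<in> S" and \<phi>: "smooth_on S \<phi>" and x: "x \<in> S"
  shows "ray_integral 0 (\<lambda>y. frechet_derivative \<phi> (at y) x) x = \<phi> x - \<phi> 0"
    and "ray_integral 0 \<phi> x + ray_integral 1 (\<lambda>y. frechet_derivative \<phi> (at y) x) x = \<phi> x"
proof -
  note d = ray_path_derivative[OF S \<phi> x]
  have "((\<lambda>t. frechet_derivative \<phi> (at (t *\<^sub>R x)) x) has_integral \<phi> (1 *\<^sub>R x) - \<phi> (0 *\<^sub>R x)) {0..1}"
    by (rule fundamental_theorem_of_calculus[OF _ d]) auto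
  then show "ray_integral 0 (\<lambda>y. frechet_derivative \<phi> (at y) x) x = \<phi> x - \<phi> 0"
    by (simp add: ray_integral_def integral_unique)
  have "((\<lambda>t. t *\<^sub>R \<phi> (t *\<^sub>R x)) has_vector_derivative
      t *\<^sub>R frechet_derivative \<phi> (at (t *\<^sub>R x)) x + 1 *\<^sub>R \<phi> (t *\<^sub>R x)) (at t within {0..1})" if "t \<in> {0..1}" for t :: real
    by (rule has_vector_derivative_scaleR[OF _ d[OF that]]) (auto intro!: derivative_eq_intros)
  then have "((\<lambda>t. t *\<^sub>R frechet_derivative \<phi> (at (t *\<^sub>R x)) x + 1 *\<^sub>R \<phi> (t *\<^sub>R x)) has_integral
      1 *\<^sub>R \<phi> (1 *\<^sub>R x) - 0 *\<^sub>R \<phi> (0 *\<^sub>R x)) {0..1}"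
    by (intro fundamental_theorem_of_calculus) auto
  then have "integral {0..1} (\<lambda>t. t *\<^sub>R frechet_derivative \<phi> (at (t *\<^sub>R x)) x + \<phi> (t *\<^sub>R x)) = \<phi> x"
    by (simp add: integral_unique)
  moreover have "(\<lambda>t. t *\<^sub>R frechet_derivative \<phi> (at (t *\<^sub>R x)) x) integrable_on {0..1}"
    using ray_continuous[OF S(2,3) smooth_on_continuous[OF smooth_on_derivative[OF S(1) \<phi>]] x, of 1 x]
    by (intro integrable_continuous_interval) simp
  moreover have "(\<lambda>t. \<phi> (t *\<^sub>R x)) integrable_on {0..1}"
    using ray_continuous[OF S(2,3) smooth_on_continuous[OF \<phi>] x, of 0]
    by (intro integrable_continuous_interval) simp
  ultimately show "ray_integral 0 \<phi> x + ray_integral 1 (\<lambda>y. frechet_derivative \<phi> (at y) x) x = \<phi> x"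
    by (simp add: ray_integral_def integral_add add.commute)
qed

lemma ray_integral_at_0: "ray_integral 0 \<phi> 0 = \<phi> 0"
  by (simp add: ray_integral_def)

lemma vec_expand: "(x::real^'n::finite) = (\<Sum>i\<in>UNIV. (x $ i) *\<^sub>R axis i 1)"
  by (simp add: vec_eq_iff axis_def if_distrib cong: if_cong)

lemma linear_vec_expand:
  fixes x :: "real^'n::finite"
  assumes "linear L" shows "L x = (\<Sum>i\<in>UNIV. (x $ i) *\<^sub>R L (axis i 1))"
proof -
  have "L x = L (\<Sum>i\<in>UNIV. (x $ i) *\<^sub>R axis i 1)" using vec_expand[of x] by simp
  also have "\<dots> = (\<Sum>i\<in>UNIV. (x $ i) *\<^sub>R L (axis i 1))" using assms by (simp add: linear_sum linear_scale)
  finally show ?thesis .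
qed

text \<open>Hadamard's lemma. Its smooth coefficients later show that a derivation at a point sees
  nothing but the first partial derivatives.\<close>

lemma hadamard:
  fixes \<phi> :: "real^'n::finite \<Rightarrow> 'b::euclidean_space"
  assumes S: "open S" "convex S" "0 \<in> S" and \<phi>: "smooth_on S \<phi>" and x: "x \<in> S"
  shows "\<phi> x = \<phi> 0 + (\<Sum>i\<in>UNIV. (x $ i) *\<^sub>R ray_integral 0 (\<lambda>y. frechet_derivative \<phi> (at y) (axis i 1)) x)"
proof -
  have "ray_integral 0 (\<lambda>y. frechet_derivative \<phi> (at y) x) x
      = ray_integral 0 (\<lambda>y. \<Sum>i\<in>UNIV. (x $ i) *\<^sub>R frechet_derivative \<phi> (at y) (axis i 1)) x"
    unfolding ray_integral_def
  proof (rule integral_cong)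
    fix t :: real assume "t \<in> {0..1}"
    then have "t *\<^sub>R x \<in> S" using convex_ray[OF S(2,3) x] by blast
    from linear_vec_expand[OF has_derivative_linear[OF smooth_on_has_derivative[OF S(1) \<phi> this]], of x]
    show "t ^ 0 *\<^sub>R frechet_derivative \<phi> (at (t *\<^sub>R x)) x =
      t ^ 0 *\<^sub>R (\<Sum>i\<in>UNIV. (x $ i) *\<^sub>R frechet_derivative \<phi> (at (t *\<^sub>R x)) (axis i 1))" by simp
  qed
  also have "\<dots> = (\<Sum>i\<in>UNIV. (x $ i) *\<^sub>R ray_integral 0 (\<lambda>y. frechet_derivative \<phi> (at y) (axis i 1)) x)"
    by (rule ray_integral_linear[OF S(2,3) x]) (auto intro: smooth_on_continuous[OF smooth_on_derivative[OF S(1) \<phi>]])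
  finally show ?thesis using ray_integral_ftc(1)[OF S \<phi> x] by (simp add: algebra_simps)
qed

text \<open>\<open>F\<close> integrates the form along the ray from the origin. By closedness its
  derivative in direction \<open>v\<close> is the integral over \<open>t\<close> of the derivative
  of \<open>t \<omega> (t x) v\<close>, which is \<open>\<omega> x v\<close>.\<close>

lemma poincare:
  fixes \<omega> :: "real^'n::finite \<Rightarrow> real^'n \<Rightarrow> 'b::euclidean_space"
  assumes S: "open S" "convex S" "0 \<in> S" and smooth: "\<And>u. smooth_on S (\<lambda>x. \<omega> x u)"
    and lin: "\<And>x. x \<in> S \<Longrightarrow> linear (\<omega> x)"
    and closed: "\<And>x u v. x \<in> S \<Longrightarrow>
      frechet_derivative (\<lambda>x. \<omega> x u) (at x) v = frechet_derivative (\<lambda>x. \<omega> x v) (at x) u"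
  obtains F where "smooth_on S F" "\<And>x. x \<in> S \<Longrightarrow> (F has_derivative \<omega> x) (at x)" "F 0 = 0"
proof -
  define F where "F x = (\<Sum>i\<in>UNIV. (x $ i) *\<^sub>R ray_integral 0 (\<lambda>y. \<omega> y (axis i 1)) x)" for x
  have der: "(F has_derivative \<omega> x) (at x)" if x: "x \<in> S" for x
  proof -
    have xt: "t *\<^sub>R x \<in> S" if "t \<in> {0..1}" for t using convex_ray[OF S(2,3) x that] .
    have "(F has_derivative (\<lambda>v. \<Sum>i\<in>UNIV. (x $ i) *\<^sub>R ray_integral (Suc 0) (\<lambda>y. frechet_derivative (\<lambda>y. \<omega> y (axis i 1)) (at y) v) x
        + (v $ i) *\<^sub>R ray_integral 0 (\<lambda>y. \<omega> y (axis i 1)) x)) (at x)"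
      unfolding F_def
      by (intro has_derivative_sum has_derivative_scaleR ray_integral_has_derivative[OF S smooth x]
          bounded_linear_imp_has_derivative bounded_linear_vec_nth)
    moreover have "(\<Sum>i\<in>UNIV. (x $ i) *\<^sub>R ray_integral (Suc 0) (\<lambda>y. frechet_derivative (\<lambda>y. \<omega> y (axis i 1)) (at y) v) x
        + (v $ i) *\<^sub>R ray_integral 0 (\<lambda>y. \<omega> y (axis i 1)) x) = \<omega> x v" for v
    proof -
      have "(\<Sum>i\<in>UNIV. (v $ i) *\<^sub>R ray_integral 0 (\<lambda>y. \<omega> y (axis i 1)) x) = ray_integral 0 (\<lambda>y. \<Sum>i\<in>UNIV. (v $ i) *\<^sub>R \<omega> y (axis i 1)) x"
        by (rule ray_integral_linear[OF S(2,3) x, symmetric]) (auto intro: smooth_on_continuous[OF smooth])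
      also have "\<dots> = ray_integral 0 (\<lambda>y. \<omega> y v) x" unfolding ray_integral_def
        by (rule integral_cong) (simp only: linear_vec_expand[OF lin[OF xt], of _ v])
      finally have 1: "(\<Sum>i\<in>UNIV. (v $ i) *\<^sub>R ray_integral 0 (\<lambda>y. \<omega> y (axis i 1)) x) = ray_integral 0 (\<lambda>y. \<omega> y v) x" .
      have "(\<Sum>i\<in>UNIV. (x $ i) *\<^sub>R ray_integral (Suc 0) (\<lambda>y. frechet_derivative (\<lambda>y. \<omega> y (axis i 1)) (at y) v) x)
        = ray_integral (Suc 0) (\<lambda>y. \<Sum>i\<in>UNIV. (x $ i) *\<^sub>R frechet_derivative (\<lambda>y. \<omega> y (axis i 1)) (at y) v) x"
        by (rule ray_integral_linear[OF S(2,3) x, symmetric])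
          (auto intro: smooth_on_continuous[OF smooth_on_derivative[OF S(1) smooth]])
      also have "\<dots> = ray_integral (Suc 0) (\<lambda>y. frechet_derivative (\<lambda>y. \<omega> y v) (at y) x) x"
        unfolding ray_integral_def
      proof (rule integral_cong)
        fix t :: real assume t: "t \<in> {0..1}"
        have "frechet_derivative (\<lambda>y. \<omega> y v) (at (t *\<^sub>R x)) x = (\<Sum>i\<in>UNIV. (x $ i) *\<^sub>R frechet_derivative (\<lambda>y. \<omega> y v) (at (t *\<^sub>R x)) (axis i 1))"
          by (rule linear_vec_expand[OF has_derivative_linear[OF smooth_on_has_derivative[OF S(1) smooth xt[OF t]]]])
        then show "t ^ Suc 0 *\<^sub>R (\<Sum>i\<in>UNIV. (x $ i) *\<^sub>R frechet_derivative (\<lambda>y. \<omega> y (axis i 1)) (at (t *\<^sub>R x)) v) =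
           t ^ Suc 0 *\<^sub>R frechet_derivative (\<lambda>y. \<omega> y v) (at (t *\<^sub>R x)) x"
          by (simp only: closed[OF xt[OF t], of "axis _ 1" v])
      qed
      finally show ?thesis using 1 ray_integral_ftc(2)[OF S smooth x, of v] by (simp add: sum.distrib add.commute)
    qed
    ultimately show ?thesis by simp
  qed
  have "smooth_on S F"
    by (rule smooth_on_derivI[where f' = \<omega>]) (use der smooth in \<open>auto intro: has_derivative_at_withinI\<close>)
  then show ?thesis using der that F_def by simp
qed


section \<open>Tangent vectors in a chart\<close>

context lie
begin

text \<open>Tangent vectors act on global smooth functions only. A function given in coordinates
  near a point is cut off by a bump function before a tangent vector can be applied to it. The
  vanishing outside \<open>V\<close> serves the locality of derivations.\<close>

lemma extend_germ:
  assumes c: "c \<in> A" "p \<in> fst c" and V: "open V" "snd c p \<in> V" "V \<subseteq> snd c ` fst c" and u: "smooth_on V u"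
  obtains h N where "smooth_fun A h" "open N" "p \<in> N" "N \<subseteq> fst c" "\<And>q. q \<in> N \<Longrightarrow> snd c q \<in> V \<and> h q = u (snd c q)"
    "\<And>q. \<not> (q \<in> fst c \<and> snd c q \<in> V) \<Longrightarrow> h q = 0"
proof -
  let ?a = "snd c p"
  obtain r0 where r0: "r0 > 0" "cball ?a r0 \<subseteq> V" using V open_contains_cball by blast
  define r where "r = r0 / 2"
  have r: "r > 0" "cball ?a (2 * r) \<subseteq> V" using r0 by (auto simp: r_def)
  obtain b where b: "smooth_on UNIV b" "\<And>x. x \<in> cball ?a r \<Longrightarrow> b x = 1" "\<And>x. x \<notin> cball ?a (2 * r) \<Longrightarrow> b x = (0::real)"
    using smooth_bump[OF r(1)] by blast
  define u' where "u' x = (if x \<in> V then b x * u x else 0)" for x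
  have u'0: "u' x = 0" if "x \<notin> cball ?a (2 * r)" for x using b(3)[OF that] by (simp add: u'_def)
  have "smooth_on (snd c ` fst c) u'"
  proof (rule smooth_on_local)
    show "thick (snd c ` fst c)" using chart_image_open[OF c(1)] thick_open by blast
    fix x
    show "\<exists>U. open U \<and> x \<in> U \<and> smooth_on (snd c ` fst c \<inter> U) u'"
    proof (cases "x \<in> V")
      case True
      have "smooth_on V (\<lambda>x. b x * u x)" by (rule smooth_on_mult[OF smooth_on_subset[OF b(1)] u]) simp
      then have "smooth_on (snd c ` fst c \<inter> V) (\<lambda>x. b x * u x)" by (rule smooth_on_subset) simp
      then have "smooth_on (snd c ` fst c \<inter> V) u'" by (rule smooth_on_eqI) (simp add: u'_def)
      then show ?thesis using True V by blast
    next
      case False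
      have "smooth_on (snd c ` fst c \<inter> - cball ?a (2 * r)) u'"
        by (rule smooth_on_eqI[OF smooth_on_const[of _ 0]]) (simp add: u'0)
      then show ?thesis using False r(2) by (intro exI[of _ "- cball ?a (2 * r)"]) auto
    qed
  qed
  then have sm: "smooth_fun A (\<lambda>q. if q \<in> fst c then u' (snd c q) else 0)"
    using r V u'0 by (intro smooth_fun_extend[OF c(1) compact_cball[of ?a "2 * r"]]) auto
  have "continuous_on (fst c) (snd c)" using chart_homeo[OF c(1)] homeomorphism_def by blast
  then obtain U where U: "open U" "fst c \<inter> U = {q\<in>fst c. snd c q \<in> ball ?a r}"
    by (rule continuous_on_open_preimage[OF _ open_ball])
  have "(if q \<in> fst c then u' (snd c q) else 0) = u (snd c q)" "snd c q \<in> V" if "q \<in> fst c \<inter> U" for q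
  proof -
    have "snd c q \<in> ball ?a r" "q \<in> fst c" using that U by auto
    then show "snd c q \<in> V" using r by (auto simp: subset_iff)
    with \<open>q \<in> fst c\<close> \<open>snd c q \<in> ball ?a r\<close> show "(if q \<in> fst c then u' (snd c q) else 0) = u (snd c q)"
      using b(2)[of "snd c q"] by (simp add: u'_def)
  qed
  moreover have "open (fst c \<inter> U)" using U chart_open[OF c(1)] by blast
  moreover have "p \<in> fst c \<inter> U" using U c r by simp
  ultimately show ?thesis using that[OF sm, of "fst c \<inter> U"] by (auto simp: u'_def)
qed

lemma
  assumes "v \<in> tangent_space A p"
  shows tangent_add: "smooth_fun A f \<Longrightarrow> smooth_fun A h \<Longrightarrow> v (\<lambda>x. f x + h x) = v f + v h"
    and tangent_mult: "smooth_fun A f \<Longrightarrow> smooth_fun A h \<Longrightarrow> v (\<lambda>x. f x * h x) = f p * v h + h p * v f"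
    and tangent_scale: "smooth_fun A f \<Longrightarrow> v (\<lambda>x. c * f x) = c * v f"
    and tangent_nonsmooth: "\<not> smooth_fun A f \<Longrightarrow> v f = 0"
  using assms unfolding tangent_space_def by auto

lemma tangent_const: assumes v: "v \<in> tangent_space A p" shows "v (\<lambda>x. c) = 0"
proof -
  have "v (\<lambda>x. 1 * 1) = 1 * v (\<lambda>x. 1) + 1 * v (\<lambda>x. 1)"
    by (rule tangent_mult[OF v]) (rule smooth_fun_const)+
  then have "v (\<lambda>x. 1) = 0" by simp
  moreover have "v (\<lambda>x. c * 1) = c * v (\<lambda>x. 1)" by (rule tangent_scale[OF v smooth_fun_const])
  ultimately show ?thesis by simp
qed

lemma tangent_sum:
  assumes v: "v \<in> tangent_space A p"
  shows "finite I \<Longrightarrow> (\<And>i. i \<in> I \<Longrightarrow> smooth_fun A (f i)) \<Longrightarrow> v (\<lambda>x. \<Sum>i\<in>I. f i x) = (\<Sum>i\<in>I. v (f i))"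
proof (induction I rule: finite_induct)
  case empty then show ?case using tangent_const[OF v, of 0] by simp
next
  case (insert i I)
  have "v (\<lambda>x. f i x + (\<Sum>i\<in>I. f i x)) = v (f i) + v (\<lambda>x. \<Sum>i\<in>I. f i x)"
    using insert by (intro tangent_add[OF v] smooth_fun_sum) auto
  then show ?case using insert by simp
qed

text \<open>A bump function \<open>b\<close> supported in \<open>U\<close> satisfies
  \<open>b * (f - h) = 0\<close>. At \<open>p\<close>, where \<open>b\<close> is 1 and
  \<open>f - h\<close> is 0, the product rule reduces this to \<open>v (f - h) = 0\<close>.\<close>

lemma tangent_local:
  assumes v: "v \<in> tangent_space A p" and f: "smooth_fun A f" and h: "smooth_fun A h"
    and U: "open U" "p \<in> U" and eq: "\<And>q. q \<in> U \<Longrightarrow> f q = h q"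
  shows "v f = v h"
proof -
  obtain c where c: "c \<in> A" "p \<in> fst c" using chart_cover by blast
  have "continuous_on (snd c ` fst c) (chart_inv c)" using chart_homeo[OF c(1)] homeomorphism_def by blast
  then obtain W where W: "open W" "snd c ` fst c \<inter> W = {x\<in>snd c ` fst c. chart_inv c x \<in> U}"
    by (rule continuous_on_open_preimage[OF _ U(1)])
  let ?V = "snd c ` fst c \<inter> W"
  have V: "open ?V" "snd c p \<in> ?V" "?V \<subseteq> snd c ` fst c"
  proof -
    show "open ?V" using W(1) chart_image_open[OF c(1)] by blast
    show "snd c p \<in> ?V" unfolding W(2) using chart_inv_chart[OF c] U c(2) by simp
  qed blast
  obtain b N where b: "smooth_fun A b" "p \<in> N" "\<And>q. q \<in> N \<Longrightarrow> snd c q \<in> ?V \<and> b q = 1"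
    "\<And>q. \<not> (q \<in> fst c \<and> snd c q \<in> ?V) \<Longrightarrow> b q = 0"
    by (rule extend_germ[OF c V smooth_on_const[of _ "1::real"]]) blast
  have z: "b q * (f q + (-1) * h q) = 0" for q
  proof (cases "q \<in> fst c \<and> snd c q \<in> ?V")
    case True
    then have "chart_inv c (snd c q) \<in> U" using W(2) by blast
    then have "q \<in> U" using True chart_inv_chart[OF c(1)] by simp
    then show ?thesis using eq by simp
  next
    case False
    then show ?thesis using b(4) by simp
  qed
  have mh: "smooth_fun A (\<lambda>q. (-1) * h q)" by (rule smooth_fun_mult[OF smooth_fun_const h])
  have d: "smooth_fun A (\<lambda>q. f q + (-1) * h q)" by (rule smooth_fun_add[OF f mh])
  have "v (\<lambda>q. b q * (f q + (-1) * h q)) = b p * v (\<lambda>q. f q + (-1) * h q) + (f p + (-1) * h p) * v b"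
    by (rule tangent_mult[OF v b(1) d])
  moreover have "v (\<lambda>q. b q * (f q + (-1) * h q)) = 0" unfolding z by (rule tangent_const[OF v])
  moreover have "b p = 1" using b(2,3) by blast
  moreover have "f p + (-1) * h p = 0" using eq[OF U(2)] by simp
  ultimately have "v (\<lambda>q. f q + (-1) * h q) = 0" by simp
  then show ?thesis using tangent_add[OF v f mh] tangent_scale[OF v h, of "-1"] by simp
qed

definition chart_vector :: "('g, 'n) chart \<Rightarrow> 'g \<Rightarrow> real^'n \<Rightarrow> 'g tvec"
  where "chart_vector c p w = (\<lambda>f. if smooth_fun A f
    then frechet_derivative (\<lambda>x. f (chart_inv c x)) (at (snd c p)) w else 0)"

lemma coord_vector_eq: "coord_vector A c p i = chart_vector c p (axis i 1)"
  unfolding coord_vector_def chart_vector_def comp_def ..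

lemma smooth_fun_chart_derivative:
  assumes "c \<in> A" "p \<in> fst c" "smooth_fun A f"
  shows "((\<lambda>x. f (chart_inv c x)) has_derivative (\<lambda>w. chart_vector c p w f)) (at (snd c p))"
  unfolding chart_vector_def using assms(3)
    smooth_on_has_derivative[OF chart_image_open[OF assms(1)] smooth_fun_chart[OF assms(1,3)] imageI[OF assms(2)]]
  by simp

lemma chart_vector_linear: 
  assumes "c \<in> A" "p \<in> fst c" shows "linear (chart_vector c p)"
proof -
  have *: "linear (\<lambda>w. chart_vector c p w f)" for f
  proof (cases "smooth_fun A f")
    case True
    then show ?thesis using has_derivative_linear[OF smooth_fun_chart_derivative[OF assms]] by blast
  next
    case False
    then show ?thesis unfolding chart_vector_def by (simp add: linear_iff)
  qed
  show ?thesis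
  proof (rule linearI)
    fix x y show "chart_vector c p (x + y) = chart_vector c p x + chart_vector c p y"
      using linear_add[OF *] by (simp add: fun_eq_iff plus_fun_def)
  next
    fix r x show "chart_vector c p (r *\<^sub>R x) = r *\<^sub>R chart_vector c p x"
      using linear_scale[OF *] by (simp add: fun_eq_iff scaleR_fun_def)
  qed
qed

lemma chart_vector_tangent:
  assumes c: "c \<in> A" "p \<in> fst c" shows "chart_vector c p w \<in> tangent_space A p"
proof -
  note D = smooth_fun_chart_derivative[OF c]
  have eq: "chart_vector c p w f = L w" if "smooth_fun A f" "((\<lambda>x. f (chart_inv c x)) has_derivative L) (at (snd c p))" for f L
    using has_derivative_unique[OF D[OF that(1)] that(2)] by metis
  show ?thesis unfolding tangent_space_def
  proof (intro CollectI conjI allI impI)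
    fix f h assume f: "smooth_fun A f" and h: "smooth_fun A h"
    show "chart_vector c p w (\<lambda>x. f x + h x) = chart_vector c p w f + chart_vector c p w h"
      by (rule eq[OF smooth_fun_add[OF f h] has_derivative_add[OF D[OF f] D[OF h]]])
    have "chart_vector c p w (\<lambda>x. f x * h x)
        = f (chart_inv c (snd c p)) * chart_vector c p w h + chart_vector c p w f * h (chart_inv c (snd c p))"
      by (rule eq[OF smooth_fun_mult[OF f h] has_derivative_mult[OF D[OF f] D[OF h]]])
    then show "chart_vector c p w (\<lambda>x. f x * h x) = f p * chart_vector c p w h + h p * chart_vector c p w f"
      using chart_inv_chart[OF c] by simp
  next
    fix r f assume f: "smooth_fun A f"
    show "chart_vector c p w (\<lambda>x. r * f x) = r * chart_vector c p w f"
      by (rule eq[OF smooth_fun_mult[OF smooth_fun_const f] has_derivative_mult_right[OF D[OF f]]])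
  next
    fix f assume "\<not> smooth_fun A f"
    then show "chart_vector c p w f = 0" by (simp add: chart_vector_def)
  qed
qed

text \<open>The coordinates of \<open>v\<close> are its values on the coordinate functions
  \<open>Y i\<close>. By Hadamard's lemma \<open>f\<close> equals \<open>f p\<close> plus the sum of
  the products \<open>Y i * G i\<close> near \<open>p\<close>. As \<open>Y i\<close> vanishes at
  \<open>p\<close>, the product rule leaves \<open>v (Y i)\<close> times the partial derivative
  \<open>G i p\<close>.\<close>

lemma tangent_eq_chart_vector:
  assumes c: "c \<in> A" "p \<in> fst c" and v: "v \<in> tangent_space A p"
  obtains w where "v = chart_vector c p w"
proof -
  let ?a = "snd c p"
  obtain r where r: "r > 0" "ball ?a r \<subseteq> snd c ` fst c"
    using chart_image_open[OF c(1)] c(2) by (meson imageI openE)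
  have V: "open (ball ?a r)" "?a \<in> ball ?a r" using r by auto
  have S: "open (ball (0::real^'n) r)" "convex (ball (0::real^'n) r)" "0 \<in> ball (0::real^'n) r" using r by auto
  have "\<exists>h N. smooth_fun A h \<and> open N \<and> p \<in> N \<and> N \<subseteq> fst c \<and> (\<forall>q\<in>N. snd c q \<in> ball ?a r \<and> h q = (snd c q - ?a) $ i)" for i
    by (rule extend_germ[OF c V r(2), of "\<lambda>x. (x - ?a) $ i"])
      (auto intro!: smooth_on_nth smooth_on_diff smooth_on_id smooth_on_const)
  then obtain Y NY where Y: "\<And>i. smooth_fun A (Y i)" "\<And>i. open (NY i)" "\<And>i. p \<in> NY i" "\<And>i. NY i \<subseteq> fst c"
     "\<And>i q. q \<in> NY i \<Longrightarrow> snd c q \<in> ball ?a r \<and> Y i q = (snd c q - ?a) $ i" by metis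
  have "v f = chart_vector c p (\<chi> i. v (Y i)) f" for f
  proof (cases "smooth_fun A f")
    case False
    then show ?thesis using tangent_nonsmooth[OF v] by (simp add: chart_vector_def)
  next
    case True
    define \<phi> where "\<phi> x = f (chart_inv c (?a + x))" for x
    have \<phi>: "smooth_on (ball 0 r) \<phi>" unfolding \<phi>_def
      by (rule smooth_on_compose[OF smooth_fun_chart[OF c(1) True]])
        (use r in \<open>auto intro!: smooth_on_add smooth_on_id smooth_on_const simp: subset_iff dist_norm\<close>)
    define g where "g i = ray_integral 0 (\<lambda>y. frechet_derivative \<phi> (at y) (axis i 1))" for i
    have g: "smooth_on (ball 0 r) (g i)" for i
      unfolding g_def by (rule smooth_on_ray_integral[OF S smooth_on_derivative[OF S(1) \<phi>]])
    have had: "\<phi> x = \<phi> 0 + (\<Sum>i\<in>UNIV. (x $ i) *\<^sub>R g i x)" if "x \<in> ball 0 r" for x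
      unfolding g_def by (rule hadamard[OF S \<phi> that])
    have ga: "smooth_on (ball ?a r) (\<lambda>x. g i (x - ?a))" for i
      by (rule smooth_on_compose[OF g])
        (auto intro!: smooth_on_diff smooth_on_id smooth_on_const simp: dist_norm norm_minus_commute)
    have "\<exists>h N. smooth_fun A h \<and> open N \<and> p \<in> N \<and> N \<subseteq> fst c \<and> (\<forall>q\<in>N. snd c q \<in> ball ?a r \<and> h q = g i (snd c q - ?a))" for i
      by (rule extend_germ[OF c V r(2) ga[of i]]) blast
    then obtain G NG where G: "\<And>i. smooth_fun A (G i)" "\<And>i. open (NG i)" "\<And>i. p \<in> NG i" "\<And>i. NG i \<subseteq> fst c"
       "\<And>i q. q \<in> NG i \<Longrightarrow> snd c q \<in> ball ?a r \<and> G i q = g i (snd c q - ?a)" by metis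
    let ?h = "\<lambda>q. f p + (\<Sum>i\<in>UNIV. Y i q * G i q)"
    have sm: "smooth_fun A (\<lambda>q. \<Sum>i\<in>UNIV. Y i q * G i q)" 
      by (rule smooth_fun_sum) (auto intro: smooth_fun_mult Y(1) G(1))
    have "v f = v ?h"
    proof (rule tangent_local[OF v True])
      show "smooth_fun A ?h" by (rule smooth_fun_add[OF smooth_fun_const sm])
      show "open (\<Inter>i. NY i \<inter> NG i)" using Y(2) G(2) by (intro open_INT) auto
      show "p \<in> (\<Inter>i. NY i \<inter> NG i)" using Y(3) G(3) by blast
      fix q assume q: "q \<in> (\<Inter>i. NY i \<inter> NG i)"
      then have qc: "q \<in> fst c" "snd c q \<in> ball ?a r" using Y(4,5) by blast+
      have qi: "Y i q = (snd c q - ?a) $ i" "G i q = g i (snd c q - ?a)" for i using q Y(5) G(5) by blast+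
      have "snd c q - ?a \<in> ball 0 r" using qc(2) by (simp add: dist_norm norm_minus_commute)
      from had[OF this] show "f q = ?h q" using chart_inv_chart[OF c(1)] c(2) qc(1) by (simp add: \<phi>_def qi)
    qed
    also have "\<dots> = (\<Sum>i\<in>UNIV. v (\<lambda>q. Y i q * G i q))"
      using tangent_add[OF v smooth_fun_const sm, of "f p"] tangent_const[OF v]
        tangent_sum[OF v finite_class.finite_UNIV, of "\<lambda>i q. Y i q * G i q"] smooth_fun_mult[OF Y(1) G(1)] by simp
    also have "\<dots> = (\<Sum>i\<in>UNIV. v (Y i) * chart_vector c p (axis i 1) f)"
    proof (rule sum.cong)
      fix i
      have "Y i p = 0" using Y(3)[of i] Y(5)[of p i] by simp
      moreover have "G i p = g i 0" using G(3)[of i] G(5)[of p i] by simp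
      moreover have "g i 0 = chart_vector c p (axis i 1) f"
      proof -
        have "((\<lambda>x. f (chart_inv c x)) has_derivative (\<lambda>w. chart_vector c p w f)) (at (?a + 0))"
          using smooth_fun_chart_derivative[OF c True] by simp
        moreover have "((\<lambda>x. ?a + x) has_derivative (\<lambda>w. w)) (at 0)" by (auto intro!: derivative_eq_intros)
        ultimately have "(\<phi> has_derivative (\<lambda>w. chart_vector c p w f)) (at 0)"
          unfolding \<phi>_def[abs_def] by (rule has_derivative_compose[rotated])
        then have "frechet_derivative \<phi> (at 0) = (\<lambda>w. chart_vector c p w f)" by (rule frechet_derivative_at[symmetric])
        then show ?thesis by (simp add: g_def ray_integral_at_0)
      qed
      ultimately show "v (\<lambda>q. Y i q * G i q) = v (Y i) * chart_vector c p (axis i 1) f"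
        using tangent_mult[OF v Y(1) G(1), of i i] by simp
    qed simp
    also have "\<dots> = chart_vector c p (\<chi> i. v (Y i)) f"
      using linear_vec_expand[OF has_derivative_linear[OF smooth_fun_chart_derivative[OF c True]], of "\<chi> i. v (Y i)"]
      by simp
    finally show ?thesis .
  qed
  then show ?thesis using that[of "\<chi> i. v (Y i)"] by blast
qed

lemma has_derivative_chart_germ:
  assumes c: "c \<in> A" "p \<in> fst c" and N: "open N" "p \<in> N" "N \<subseteq> fst c"
    and eq: "\<And>q. q \<in> N \<Longrightarrow> h q = u (snd c q)" and u: "(u has_derivative u') (at (snd c p))"
  shows "((\<lambda>x. h (chart_inv c x)) has_derivative u') (at (snd c p))"
proof -
  have "continuous_on (snd c ` fst c) (chart_inv c)" using chart_homeo[OF c(1)] homeomorphism_def by blast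
  then obtain W where W: "open W" "snd c ` fst c \<inter> W = {x\<in>snd c ` fst c. chart_inv c x \<in> N}"
    by (rule continuous_on_open_preimage[OF _ N(1)])
  show ?thesis
  proof (rule has_derivative_transform_within_open[OF u])
    show "open (snd c ` fst c \<inter> W)" using W chart_image_open[OF c(1)] by blast
    show "snd c p \<in> snd c ` fst c \<inter> W" unfolding W(2) using chart_inv_chart[OF c] N c by simp
    fix x assume "x \<in> snd c ` fst c \<inter> W"
    then have "x \<in> snd c ` fst c" "chart_inv c x \<in> N" unfolding W(2) by auto
    then show "u x = h (chart_inv c x)" using eq[of "chart_inv c x"] chart_chart_inv[OF c(1)] by simp
  qed
qed

lemma chart_vector_inj:
  assumes c: "c \<in> A" "p \<in> fst c" and eq: "chart_vector c p w = chart_vector c p w'"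
  shows "w = w'"
proof -
  have "w $ i = w' $ i" for i
  proof -
    have sm: "smooth_on (snd c ` fst c) (\<lambda>x. x $ i)" by (rule smooth_on_nth[OF smooth_on_id])
    obtain h N where h: "smooth_fun A h" "open N" "p \<in> N" "N \<subseteq> fst c" "\<And>q. q \<in> N \<Longrightarrow> snd c q \<in> snd c ` fst c \<and> h q = snd c q $ i"
      "\<And>q. \<not> (q \<in> fst c \<and> snd c q \<in> snd c ` fst c) \<Longrightarrow> h q = 0"
      by (rule extend_germ[OF c chart_image_open[OF c(1)] imageI[OF c(2)] order_refl sm]) blast
    have "((\<lambda>x. h (chart_inv c x)) has_derivative (\<lambda>w. w $ i)) (at (snd c p))"
      by (rule has_derivative_chart_germ[OF c h(2-4)]) (use h(5) in \<open>auto intro: bounded_linear_imp_has_derivative bounded_linear_vec_nth\<close>)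
    then have "chart_vector c p w h = w $ i" for w
      using has_derivative_unique[OF smooth_fun_chart_derivative[OF c h(1)]] by metis
    then show ?thesis using eq by metis
  qed
  then show ?thesis by (simp add: vec_eq_iff)
qed

end

section \<open>The Lie algebra\<close>

text \<open>\<open>\<Theta>\<close> is only given as smooth for each fixed argument. Expanding
  \<open>l x\<close> in coordinates reduces the claim to products of a scalar function with a map of
  that kind.\<close>

lemma has_derivative_apply:
  fixes \<Theta> :: "'a::euclidean_space \<Rightarrow> real^'n::finite \<Rightarrow> 'b::euclidean_space"
  assumes S: "open S" "x \<in> S" and \<Theta>: "\<And>w. smooth_on S (\<lambda>x. \<Theta> x w)" "\<And>x. x \<in> S \<Longrightarrow> linear (\<Theta> x)"
    and l: "(l has_derivative l') (at x)"
  shows "((\<lambda>x. \<Theta> x (l x)) has_derivative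
    (\<lambda>u. frechet_derivative (\<lambda>y. \<Theta> y (l x)) (at x) u + \<Theta> x (l' u))) (at x)"
proof -
  let ?D = "\<lambda>i. frechet_derivative (\<lambda>y. \<Theta> y (axis i 1)) (at x)"
  have D: "((\<lambda>y. \<Theta> y w) has_derivative frechet_derivative (\<lambda>y. \<Theta> y w) (at x)) (at x)" for w
    by (rule smooth_on_has_derivative[OF S(1) \<Theta>(1) S(2)])
  have 1: "((\<lambda>y. \<Sum>i\<in>UNIV. (l y $ i) *\<^sub>R \<Theta> y (axis i 1)) has_derivative
      (\<lambda>u. \<Sum>i\<in>UNIV. (l x $ i) *\<^sub>R ?D i u + (l' u $ i) *\<^sub>R \<Theta> x (axis i 1))) (at x)"
    by (intro has_derivative_sum has_derivative_scaleR D bounded_linear.has_derivative[OF bounded_linear_vec_nth l])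
  have 2: "((\<lambda>y. \<Theta> y (l x)) has_derivative (\<lambda>u. \<Sum>i\<in>UNIV. (l x $ i) *\<^sub>R ?D i u)) (at x)"
  proof (rule has_derivative_transform_within_open[OF _ S])
    show "((\<lambda>y. \<Sum>i\<in>UNIV. (l x $ i) *\<^sub>R \<Theta> y (axis i 1)) has_derivative (\<lambda>u. \<Sum>i\<in>UNIV. (l x $ i) *\<^sub>R ?D i u)) (at x)"
      by (intro has_derivative_sum has_derivative_scaleR_right D)
  qed (rule linear_vec_expand[OF \<Theta>(2), symmetric])
  have 3: "frechet_derivative (\<lambda>y. \<Theta> y (l x)) (at x) = (\<lambda>u. \<Sum>i\<in>UNIV. (l x $ i) *\<^sub>R ?D i u)"
    by (rule frechet_derivative_at[OF 2, symmetric])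
  have "(\<lambda>u. \<Sum>i\<in>UNIV. (l x $ i) *\<^sub>R ?D i u + (l' u $ i) *\<^sub>R \<Theta> x (axis i 1))
      = (\<lambda>u. frechet_derivative (\<lambda>y. \<Theta> y (l x)) (at x) u + \<Theta> x (l' u))"
    unfolding 3 by (rule ext) (simp only: sum.distrib linear_vec_expand[OF \<Theta>(2)[OF S(2)], of "l' _"])
  with 1 have "((\<lambda>y. \<Sum>i\<in>UNIV. (l y $ i) *\<^sub>R \<Theta> y (axis i 1)) has_derivative
      (\<lambda>u. frechet_derivative (\<lambda>y. \<Theta> y (l x)) (at x) u + \<Theta> x (l' u))) (at x)" by simp
  then show ?thesis
    by (rule has_derivative_transform_within_open[OF _ S]) (rule linear_vec_expand[OF \<Theta>(2), symmetric])
qed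

context lie
begin

definition left_field :: "'g tvec \<Rightarrow> 'g \<Rightarrow> 'g tvec"
  where "left_field v = (\<lambda>p. dL p v)"

lemma dL_0: "dL 0 (v :: 'g tvec) = v"
  by (simp add: dL_def)

lemma dL_tangent: assumes v: "v \<in> tangent_space A p" shows "dL a v \<in> tangent_space A (a + p)"
  unfolding tangent_space_def dL_def
  using tangent_add[OF v] tangent_mult[OF v] tangent_scale[OF v] tangent_nonsmooth[OF v]
  by (auto simp: smooth_fun_translate smooth_fun_translate_iff)

text \<open>For smoothness, the value of the field on \<open>f\<close> is written in charts as a
  partial derivative, at the identity, of the jointly smooth function sending two points to the
  value of \<open>f\<close> at their product.\<close>

lemma left_field_in_lie_algebra:
  assumes v: "v \<in> tangent_space A 0" shows "left_field v \<in> lie_algebra A"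
  unfolding lie_algebra_def smooth_vector_field_def
proof (intro CollectI conjI allI impI)
  show "left_field v p \<in> tangent_space A p" for p using dL_tangent[OF v, of p] by (simp add: left_field_def)
  show "left_field v (a + p) = dL a (left_field v p)" for a p
    by (simp add: left_field_def dL_def add.assoc)
  fix f assume f: "smooth_fun A f"
  obtain c where c: "c \<in> A" "0 \<in> fst c" using chart_cover by blast
  obtain w where w: "v = chart_vector c 0 w" by (rule tangent_eq_chart_vector[OF c v])
  show "smooth_fun A (\<lambda>p. left_field v p f)"
  proof (rule smooth_funI)
    fix d assume d: "d \<in> A"
    let ?W = "(snd d ` fst d) \<times> (snd c ` fst c)"
    let ?\<phi> = "\<lambda>z. f (chart_inv d (fst z) + chart_inv c (snd z))"
    have W: "open ?W" using chart_image_open[OF c(1)] chart_image_open[OF d] by (rule open_Times[rotated])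
    have p1: "plot A ?W (\<lambda>z. chart_inv d (fst z))"
      by (rule plot_compose[OF plot_chart_inv[OF d]]) (auto intro: smooth_on_linear[OF bounded_linear_fst smooth_on_id])
    have p2: "plot A ?W (\<lambda>z. chart_inv c (snd z))"
      by (rule plot_compose[OF plot_chart_inv[OF c(1)]]) (auto intro: smooth_on_linear[OF bounded_linear_snd smooth_on_id])
    have \<phi>: "smooth_on ?W ?\<phi>"
      by (rule smooth_fun_plot[OF f plot_add[OF p1 p2 thick_open[OF W]] thick_open[OF W]])
    have eq: "left_field v (chart_inv d x) f = frechet_derivative ?\<phi> (at (x, snd c 0)) (0, w)" if x: "x \<in> snd d ` fst d" for x
    proof -
      have 1: "(?\<phi> has_derivative frechet_derivative ?\<phi> (at (x, snd c 0))) (at (x, snd c 0))"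
        by (rule smooth_on_has_derivative[OF W \<phi>]) (use x c in auto)
      have 2: "((\<lambda>y. (x, y)) has_derivative (\<lambda>v. (0, v))) (at (snd c 0))" by (auto intro!: derivative_eq_intros)
      have "((\<lambda>y. ?\<phi> (x, y)) has_derivative (\<lambda>v. frechet_derivative ?\<phi> (at (x, snd c 0)) (0, v))) (at (snd c 0))"
        by (rule has_derivative_comp[OF 2 1]) simp
      then have "((\<lambda>y. f (chart_inv d x + chart_inv c y)) has_derivative (\<lambda>v. frechet_derivative ?\<phi> (at (x, snd c 0)) (0, v))) (at (snd c 0))"
        by simp
      from fun_cong[OF frechet_derivative_at[OF this], of w] show ?thesis
        by (simp add: left_field_def dL_def w chart_vector_def smooth_fun_translate[OF f])
    qed
    have "smooth_on (snd d ` fst d) (\<lambda>x. frechet_derivative ?\<phi> (at (x, snd c 0)) (0, w))"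
      by (rule smooth_on_compose[OF smooth_on_derivative[OF W \<phi>]])
        (use c in \<open>auto intro!: smooth_on_Pair smooth_on_id smooth_on_const\<close>)
    then show "smooth_on (snd d ` fst d) (\<lambda>x. left_field v (chart_inv d x) f)"
      by (rule smooth_on_eqI) (rule eq)
  qed
qed

lemma lie_algebra_eq_left_field:
  assumes "X \<in> lie_algebra A" shows "X = left_field (X 0)" "X 0 \<in> tangent_space A 0"
proof -
  have "X (p + 0) = dL p (X 0)" for p using assms unfolding lie_algebra_def by blast
  then have "X p = dL p (X 0)" for p unfolding add_0_right .
  then show "X = left_field (X 0)" unfolding left_field_def by (rule ext)
  show "X 0 \<in> tangent_space A 0" using assms unfolding lie_algebra_def smooth_vector_field_def by blast
qed

lemma lie_algebra_smooth: "X \<in> lie_algebra A \<Longrightarrow> smooth_fun A f \<Longrightarrow> smooth_fun A (\<lambda>p. X p f)"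
  and lie_algebra_tangent: "X \<in> lie_algebra A \<Longrightarrow> X p \<in> tangent_space A p"
  unfolding lie_algebra_def smooth_vector_field_def by blast+

lemma lie_algebra_nonsmooth: "X \<in> lie_algebra A \<Longrightarrow> \<not> smooth_fun A f \<Longrightarrow> X p f = 0"
  using lie_algebra_tangent tangent_nonsmooth by blast

lemma lie_bracket_antisym: "lie_bracket X Y = - lie_bracket Y X"
  by (auto simp: lie_bracket_def fun_eq_iff fun_Compl_def)

text \<open>Vector fields are functionals on all functions, so additivity also has to hold on the
  non-smooth ones. There \<open>X\<close> and \<open>X'\<close> give zero, and \<open>Y\<close>
  annihilates constants.\<close>

lemma lie_bracket_add_left:
  assumes X: "X \<in> lie_algebra A" and X': "X' \<in> lie_algebra A" and Y: "Y \<in> lie_algebra A"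
  shows "lie_bracket (X + X') Y = lie_bracket X Y + lie_bracket X' Y"
proof -
  have "Y p (\<lambda>q. X q f + X' q f) = Y p (\<lambda>q. X q f) + Y p (\<lambda>q. X' q f)" for p f
  proof (cases "smooth_fun A f")
    case True
    then show ?thesis using lie_algebra_smooth X X' tangent_add[OF lie_algebra_tangent[OF Y]] by blast
  next
    case False
    then show ?thesis using lie_algebra_nonsmooth[OF X] lie_algebra_nonsmooth[OF X'] tangent_const[OF lie_algebra_tangent[OF Y], of p 0]
      by simp
  qed
  then show ?thesis by (simp add: lie_bracket_def fun_eq_iff)
qed

lemma lie_bracket_scale_left:
  assumes X: "X \<in> lie_algebra A" and Y: "Y \<in> lie_algebra A"
  shows "lie_bracket (r *\<^sub>R X) Y = r *\<^sub>R lie_bracket X Y"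
proof -
  have "Y p (\<lambda>q. r * X q f) = r * Y p (\<lambda>q. X q f)" for p f
  proof (cases "smooth_fun A f")
    case True
    then show ?thesis using lie_algebra_smooth[OF X] tangent_scale[OF lie_algebra_tangent[OF Y]] by blast
  next
    case False
    then show ?thesis using lie_algebra_nonsmooth[OF X] tangent_const[OF lie_algebra_tangent[OF Y], of p 0] by simp
  qed
  then show ?thesis by (simp add: lie_bracket_def scaleR_fun_def fun_eq_iff right_diff_distrib)
qed

lemma left_field_linear:
  assumes c: "c \<in> A" "0 \<in> fst c" shows "linear (\<lambda>w. left_field (chart_vector c 0 w))"
proof (rule linearI)
  note l = chart_vector_linear[OF c]
  show "left_field (chart_vector c 0 (x + y)) = left_field (chart_vector c 0 x) + left_field (chart_vector c 0 y)" for x y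
    unfolding linear_add[OF l] by (auto simp: left_field_def dL_def fun_eq_iff)
  show "left_field (chart_vector c 0 (r *\<^sub>R x)) = r *\<^sub>R left_field (chart_vector c 0 x)" for r x
    unfolding linear_scale[OF l] by (auto simp: left_field_def dL_def fun_eq_iff scaleR_fun_def)
qed

lemma left_field_inj:
  assumes c: "c \<in> A" "0 \<in> fst c" shows "inj (\<lambda>w. left_field (chart_vector c 0 w))"
proof (rule injI)
  fix x y assume "left_field (chart_vector c 0 x) = left_field (chart_vector c 0 y)"
  then have "left_field (chart_vector c 0 x) 0 = left_field (chart_vector c 0 y) 0" by simp
  then show "x = y" unfolding left_field_def dL_0 by (rule chart_vector_inj[OF c])
qed

end

text \<open>The columns of \<open>T\<close>, read in the chart \<open>c0\<close>, are a basis of the Lie algebra in which those with index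
  in \<open>J\<close> span the second layer. \<open>C\<close> is the Lie bracket in this basis.\<close>

locale carnot_frame = lie A
  for A :: "('g::{topological_group_add, t2_space, second_countable_topology}, 'n::finite) chart set" +
  fixes c0 :: "('g, 'n) chart" and T :: "real^'n \<Rightarrow> real^'n" and J :: "'n set"
    and C :: "real^'n \<Rightarrow> real^'n \<Rightarrow> real^'n"
  assumes c0: "c0 \<in> A" "0 \<in> fst c0" and T: "linear T" "bij T"
    and C_bilinear: "bilinear C"
    and bracket: "lie_bracket (left_field (chart_vector c0 0 (T a))) (left_field (chart_vector c0 0 (T b)))
      = left_field (chart_vector c0 0 (T (C a b)))"
    and C_range: "i \<notin> J \<Longrightarrow> C a b $ i = 0"
    and C_center: "(\<And>i. i \<notin> J \<Longrightarrow> a $ i = 0) \<Longrightarrow> C a b = 0"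
begin

definition frame :: "real^'n \<Rightarrow> 'g \<Rightarrow> 'g tvec"
  where "frame a = left_field (chart_vector c0 0 (T a))"

lemma frame_linear: "linear frame"
  using linear_compose[OF T(1) left_field_linear[OF c0]] by (simp add: frame_def[abs_def] comp_def)

lemma frame_in: "frame a \<in> lie_algebra A"
  unfolding frame_def by (rule left_field_in_lie_algebra[OF chart_vector_tangent[OF c0]])

lemma frame_inj: "frame a = frame b \<Longrightarrow> a = b"
proof -
  assume "frame a = frame b"
  then have "frame a 0 = frame b 0" by simp
  then have "T a = T b" unfolding frame_def left_field_def dL_0 by (rule chart_vector_inj[OF c0])
  then show ?thesis using T(2) bij_is_inj injD by metis
qed

lemma bracket_frame: "lie_bracket (frame a) (frame b) = frame (C a b)"
  unfolding frame_def by (rule bracket)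

lemma C_antisym: "C a b = - C b a"
proof (rule frame_inj)
  show "frame (C a b) = frame (- C b a)"
    using lie_bracket_antisym[of "frame a" "frame b"] by (simp only: bracket_frame linear_neg[OF frame_linear])
qed

lemma C_self: "C a a = 0"
  using C_antisym[of a a] by (simp add: vec_eq_iff)

lemma C_bounded: "bounded_bilinear C"
  using C_bilinear bilinear_conv_bounded_bilinear by blast

sublocale C: bounded_bilinear C by (rule C_bounded)

text \<open>Brackets have no components outside \<open>J\<close>, and vectors with this property are
  central.\<close>

lemma C_C: "C (C a b) x = 0" "C x (C a b) = 0"
proof -
  show "C (C a b) x = 0" using C_center C_range by blast
  then show "C x (C a b) = 0" using C_antisym[of x "C a b"] by simp
qed

text \<open>The map \<open>k\<close> is the inverse of the chart \<open>c0\<close>, centred at the identity and composed with \<open>T\<close>. In this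
  coordinate \<open>n x y\<close> is the product \<open>x y\<close> and \<open>m x y\<close> is \<open>x\<^sup>-\<^sup>1 y\<close>. Below, \<open>L x\<close> expresses the
  left-invariant frame at \<open>x\<close>, and its inverse \<open>\<Theta> x\<close> is the Maurer-Cartan form.\<close>

definition Tinv where "Tinv = inv T"

lemma Tinv: "linear Tinv" "Tinv (T x) = x" "T (Tinv x) = x"
proof -
  show "Tinv (T x) = x" "T (Tinv x) = x" for x using T(2) unfolding Tinv_def
    by (simp_all add: bij_is_inj bij_is_surj surj_f_inv_f)
  then show "linear Tinv" using T(1) unfolding linear_iff by metis
qed

definition U0 :: "(real^'n) set" where "U0 = {x. T x + snd c0 0 \<in> snd c0 ` fst c0}"

definition k :: "real^'n \<Rightarrow> 'g" where "k x = chart_inv c0 (T x + snd c0 0)"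

definition kinv :: "'g \<Rightarrow> real^'n" where "kinv p = Tinv (snd c0 p - snd c0 0)"

lemma T_affine_smooth: "smooth_on S (\<lambda>x. T x + snd c0 0)"
  by (intro smooth_on_add smooth_on_linear[OF _ smooth_on_id] smooth_on_const) (simp add: T linear_conv_bounded_linear[symmetric])

lemma U0: "open U0" "0 \<in> U0"
proof -
  have "continuous_on UNIV (\<lambda>x. T x + snd c0 0)" by (rule smooth_on_continuous[OF T_affine_smooth])
  from continuous_on_open_preimage[OF this chart_image_open[OF c0(1)]] show "open U0" 
    unfolding U0_def by auto
  show "0 \<in> U0" unfolding U0_def using c0 linear_0[OF T(1)] by simp
qed

lemma plot_k: "plot A U0 k"
  unfolding k_def by (rule plot_compose[OF plot_chart_inv[OF c0(1)] T_affine_smooth]) (auto simp: U0_def)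

lemma k_0: "k 0 = 0" using chart_inv_chart[OF c0] linear_0[OF T(1)] by (simp add: k_def)

lemma k_in: "x \<in> U0 \<Longrightarrow> k x \<in> fst c0" and kinv_k: "x \<in> U0 \<Longrightarrow> kinv (k x) = x"
  using chart_inv_in[OF c0(1)] chart_chart_inv[OF c0(1)] by (auto simp: U0_def k_def kinv_def Tinv)

lemma k_kinv: "p \<in> fst c0 \<Longrightarrow> k (kinv p) = p" and kinv_in: "p \<in> fst c0 \<Longrightarrow> kinv p \<in> U0"
  using chart_inv_chart[OF c0(1)] by (auto simp: U0_def k_def kinv_def Tinv)

lemma smooth_kinv_plot:
  assumes "plot A W f" "f ` W \<subseteq> fst c0" shows "smooth_on W (\<lambda>x. kinv (f x))"
  unfolding kinv_def
  by (intro smooth_on_linear[of Tinv] smooth_on_diff plot_chart[OF assms(1) c0(1) assms(2)] smooth_on_const)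
    (simp add: Tinv linear_conv_bounded_linear[symmetric])

lemma frame_derivative:
  assumes f: "smooth_fun A f"
  shows "((\<lambda>y. f (p + k y)) has_derivative (\<lambda>a. frame a p f)) (at 0)"
proof -
  have 1: "((\<lambda>x. f (p + chart_inv c0 x)) has_derivative (\<lambda>w. chart_vector c0 0 w (\<lambda>q. f (p + q)))) (at (snd c0 0))"
    by (rule smooth_fun_chart_derivative[OF c0 smooth_fun_translate[OF f]])
  have 2: "((\<lambda>x. T x + snd c0 0) has_derivative T) (at 0)"
    using linear_imp_has_derivative[OF T(1)] by (auto intro!: derivative_eq_intros)
  show ?thesis unfolding k_def frame_def left_field_def dL_def
    by (rule has_derivative_comp[OF 2 1]) (simp add: linear_0[OF T(1)])
qed

definition Dn where "Dn = {z \<in> U0 \<times> U0. k (fst z) + k (snd z) \<in> fst c0}"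
definition Dm where "Dm = {z \<in> U0 \<times> U0. - k (fst z) + k (snd z) \<in> fst c0}"

definition n :: "real^'n \<Rightarrow> real^'n \<Rightarrow> real^'n" where "n x y = kinv (k x + k y)"
definition m :: "real^'n \<Rightarrow> real^'n \<Rightarrow> real^'n" where "m x y = kinv (- k x + k y)"

text \<open>Partial derivatives in the second variable. They are taken from the total derivative, so
  that their joint smoothness in both variables is immediate.\<close>

definition dn where "dn x y v = frechet_derivative (\<lambda>z. n (fst z) (snd z)) (at (x, y)) (0, v)"
definition dm where "dm x y v = frechet_derivative (\<lambda>z. m (fst z) (snd z)) (at (x, y)) (0, v)"

lemma plot_k_fst: "plot A (U0 \<times> U0) (\<lambda>z. k (fst z))" and plot_k_snd: "plot A (U0 \<times> U0) (\<lambda>z. k (snd z))"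
  by (rule plot_compose[OF plot_k], auto intro: smooth_on_linear[OF bounded_linear_fst smooth_on_id]
    smooth_on_linear[OF bounded_linear_snd smooth_on_id])+

lemma thick_U0: "thick (U0 \<times> U0)"
  by (rule thick_open[OF open_Times[OF U0(1) U0(1)]])

lemma Dn_Dm: "open Dn" "smooth_on Dn (\<lambda>z. n (fst z) (snd z))" "open Dm" "smooth_on Dm (\<lambda>z. m (fst z) (snd z))"
proof -
  have p: "plot A (U0 \<times> U0) (\<lambda>z. k (fst z) + k (snd z))" by (rule plot_add[OF plot_k_fst plot_k_snd thick_U0])
  have q: "plot A (U0 \<times> U0) (\<lambda>z. - k (fst z) + k (snd z))"
    by (rule plot_add[OF plot_minus[OF plot_k_fst thick_U0] plot_k_snd thick_U0])
  have o: "open {z \<in> U0 \<times> U0. f z \<in> fst c0}" if "plot A (U0 \<times> U0) f" for f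
  proof -
    have "continuous_on (U0 \<times> U0) f" using that by (simp add: plot_def)
    then obtain V where "open V" "(U0 \<times> U0) \<inter> V = {z \<in> U0 \<times> U0. f z \<in> fst c0}"
      by (rule continuous_on_open_preimage[OF _ chart_open[OF c0(1)]])
    then show ?thesis using open_Int[OF open_Times[OF U0(1) U0(1)], of V] by simp
  qed
  show "open Dn" unfolding Dn_def by (rule o[OF p])
  show "open Dm" unfolding Dm_def by (rule o[OF q])
  have "plot A Dn (\<lambda>z. k (fst z) + k (snd z))" by (rule plot_subset[OF p]) (auto simp: Dn_def)
  then show "smooth_on Dn (\<lambda>z. n (fst z) (snd z))" unfolding n_def by (rule smooth_kinv_plot) (auto simp: Dn_def)
  have "plot A Dm (\<lambda>z. - k (fst z) + k (snd z))" by (rule plot_subset[OF q]) (auto simp: Dm_def)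
  then show "smooth_on Dm (\<lambda>z. m (fst z) (snd z))" unfolding m_def by (rule smooth_kinv_plot) (auto simp: Dm_def)
qed

lemma partial_derivative:
  fixes f :: "real^'n \<Rightarrow> real^'n \<Rightarrow> real^'n"
  assumes "open S" "smooth_on S (\<lambda>z. f (fst z) (snd z))" "(x, y) \<in> S"
  shows "((\<lambda>y. f x y) has_derivative (\<lambda>v. frechet_derivative (\<lambda>z. f (fst z) (snd z)) (at (x, y)) (0, v))) (at y)"
proof -
  have 1: "((\<lambda>z. f (fst z) (snd z)) has_derivative frechet_derivative (\<lambda>z. f (fst z) (snd z)) (at (x, y))) (at (x, y))"
    by (rule smooth_on_has_derivative[OF assms])
  have 2: "((\<lambda>y. (x, y)) has_derivative (\<lambda>v. (0, v))) (at y)" by (auto intro!: derivative_eq_intros)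
  have "((\<lambda>y. (\<lambda>z. f (fst z) (snd z)) (x, y)) has_derivative
      (\<lambda>v. frechet_derivative (\<lambda>z. f (fst z) (snd z)) (at (x, y)) (0, v))) (at y)"
    by (rule has_derivative_comp[OF 2 1]) simp
  then show ?thesis by simp
qed

lemma dn: "(x, y) \<in> Dn \<Longrightarrow> (n x has_derivative dn x y) (at y)"
  and dm: "(x, y) \<in> Dm \<Longrightarrow> (m x has_derivative dm x y) (at y)"
  using partial_derivative[OF Dn_Dm(1,2)] partial_derivative[OF Dn_Dm(3,4)] unfolding dn_def[abs_def] dm_def[abs_def] by blast+

lemma n_in: "(x, y) \<in> Dn \<Longrightarrow> n x y \<in> U0" and k_n: "(x, y) \<in> Dn \<Longrightarrow> k (n x y) = k x + k y"
  by (auto simp: Dn_def n_def kinv_in k_kinv)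

lemma Dn_x0: "x \<in> U0 \<Longrightarrow> (x, 0) \<in> Dn" and Dm_xx: "x \<in> U0 \<Longrightarrow> (x, x) \<in> Dm"
  and n_x0: "x \<in> U0 \<Longrightarrow> n x 0 = x"
  using U0(2) c0(2) by (auto simp: Dn_def Dm_def k_0 k_in n_def kinv_k)

definition L where "L x a = dn x 0 a"
definition \<Theta> where "\<Theta> x u = dm x x u"

lemma L_linear: "x \<in> U0 \<Longrightarrow> linear (L x)" and \<Theta>_linear: "x \<in> U0 \<Longrightarrow> linear (\<Theta> x)"
  unfolding L_def[abs_def] \<Theta>_def[abs_def] using dn[OF Dn_x0] dm[OF Dm_xx] has_derivative_linear by blast+

lemma L_smooth: "smooth_on U0 (\<lambda>x. L x a)" and \<Theta>_smooth: "smooth_on U0 (\<lambda>x. \<Theta> x u)"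
proof -
  show "smooth_on U0 (\<lambda>x. L x a)" unfolding L_def dn_def
    by (rule smooth_on_compose[OF smooth_on_derivative[OF Dn_Dm(1,2)]])
      (auto intro!: smooth_on_Pair smooth_on_id smooth_on_const simp: Dn_x0)
  show "smooth_on U0 (\<lambda>x. \<Theta> x u)" unfolding \<Theta>_def dm_def
    by (rule smooth_on_compose[OF smooth_on_derivative[OF Dn_Dm(3,4)]])
      (auto intro!: smooth_on_Pair smooth_on_id smooth_on_const simp: Dm_xx)
qed

lemma section_open: assumes "open D" shows "open {y. (x, y) \<in> D}"
proof -
  have "open ((\<lambda>y. (x, y)) -` D)" by (rule open_vimage[OF assms]) (intro continuous_intros)
  then show ?thesis by (simp add: vimage_def)
qed

lemma minus_add_cancel_left: "- (a + b) + (a + c) = - b + (c :: 'a::group_add)"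
proof -
  have "- (a + b) + (a + c) = - b + (- a + (a + c))" by (simp only: minus_add add.assoc)
  then show ?thesis by simp
qed

text \<open>Differentiate \<open>(k x + k y)\<^sup>-\<^sup>1 (k x + k z) = (k y)\<^sup>-\<^sup>1 (k z)\<close> in \<open>z\<close>.\<close>

lemma \<Theta>_left_invariant:
  assumes xy: "(x, y) \<in> Dn" shows "\<Theta> (n x y) (dn x y v) = \<Theta> y v"
proof -
  have y: "y \<in> U0" using xy by (auto simp: Dn_def)
  have "(m (n x y) has_derivative \<Theta> (n x y)) (at (n x y))"
    unfolding \<Theta>_def[abs_def] by (rule dm[OF Dm_xx[OF n_in[OF xy]]])
  then have 1: "((\<lambda>z. m (n x y) (n x z)) has_derivative (\<lambda>v. \<Theta> (n x y) (dn x y v))) (at y)"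
    by (rule has_derivative_comp[OF dn[OF xy]]) simp
  have 2: "(m y has_derivative \<Theta> y) (at y)" unfolding \<Theta>_def[abs_def] by (rule dm[OF Dm_xx[OF y]])
  have "((\<lambda>z. m (n x y) (n x z)) has_derivative \<Theta> y) (at y)"
  proof (rule has_derivative_transform_within_open[OF 2])
    show "open {z. (x, z) \<in> Dn}" by (rule section_open[OF Dn_Dm(1)])
    show "y \<in> {z. (x, z) \<in> Dn}" using xy by simp
    fix z assume "z \<in> {z. (x, z) \<in> Dn}"
    then show "m y z = m (n x y) (n x z)" using k_n[OF xy] k_n[of x z]
      by (simp only: m_def mem_Collect_eq minus_add_cancel_left)
  qed
  then show ?thesis using has_derivative_unique[OF 1] by metis
qed

lemma \<Theta>_0: "\<Theta> 0 u = u"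
proof -
  have 1: "(m 0 has_derivative \<Theta> 0) (at 0)" unfolding \<Theta>_def[abs_def] by (rule dm[OF Dm_xx[OF U0(2)]])
  have "(m 0 has_derivative (\<lambda>u. u)) (at 0)"
    by (rule has_derivative_transform_within_open[OF has_derivative_ident U0]) (simp add: m_def k_0 kinv_k)
  then show ?thesis using has_derivative_unique[OF 1] by metis
qed

lemma \<Theta>_L: "x \<in> U0 \<Longrightarrow> \<Theta> x (L x a) = a"
  using \<Theta>_left_invariant[OF Dn_x0, of x a] by (simp add: n_x0 L_def \<Theta>_0)

lemma L_\<Theta>: assumes "x \<in> U0" shows "L x (\<Theta> x u) = u"
proof -
  have "L x \<circ> \<Theta> x = id"
    using linear_inverse_left[OF L_linear[OF assms] \<Theta>_linear[OF assms]] \<Theta>_L[OF assms] by (auto simp: fun_eq_iff)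
  then show ?thesis by (simp add: fun_eq_iff)
qed

text \<open>By left invariance the frame at \<open>k x\<close> is the derivative at
  \<open>y = 0\<close> along \<open>k x + k y\<close>, and this product has the coordinate
  \<open>n x y\<close>.\<close>

lemma frame_k:
  assumes f: "smooth_fun A f" and x: "x \<in> U0"
  shows "frame a (k x) f = frechet_derivative (\<lambda>x. f (k x)) (at x) (L x a)"
proof -
  have fk: "smooth_on U0 (\<lambda>x. f (k x))" by (rule smooth_fun_plot[OF f plot_k thick_open[OF U0(1)]])
  have "((\<lambda>x. f (k x)) has_derivative frechet_derivative (\<lambda>x. f (k x)) (at x)) (at x)"
    by (rule smooth_on_has_derivative[OF U0(1) fk x])
  then have 1: "((\<lambda>y. f (k (n x y))) has_derivative (\<lambda>a. frechet_derivative (\<lambda>x. f (k x)) (at x) (L x a))) (at 0)"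
    unfolding L_def by (rule has_derivative_comp[OF dn[OF Dn_x0[OF x]]]) (simp add: n_x0[OF x])
  have "((\<lambda>y. f (k x + k y)) has_derivative (\<lambda>a. frechet_derivative (\<lambda>x. f (k x)) (at x) (L x a))) (at 0)"
  proof (rule has_derivative_transform_within_open[OF 1])
    show "open {y. (x, y) \<in> Dn}" by (rule section_open[OF Dn_Dm(1)])
    show "0 \<in> {y. (x, y) \<in> Dn}" using Dn_x0[OF x] by simp
  qed (simp add: k_n)
  then show ?thesis using has_derivative_unique[OF frame_derivative[OF f]] by metis
qed

text \<open>The bracket relation of the frame is evaluated on extended coordinate functions. Near
  \<open>x\<close> the field \<open>frame b\<close> takes such a function to a component of
  \<open>L y b\<close>, so a second field differentiates that component.\<close>

lemma L_structure:
  assumes x: "x \<in> U0"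
  shows "frechet_derivative (\<lambda>x. L x b) (at x) (L x a) - frechet_derivative (\<lambda>x. L x a) (at x) (L x b) = L x (C a b)"
proof -
  have "(frechet_derivative (\<lambda>x. L x b) (at x) (L x a) - frechet_derivative (\<lambda>x. L x a) (at x) (L x b)) $ i = L x (C a b) $ i" for i
  proof -
    have u: "smooth_on (snd c0 ` fst c0) (\<lambda>y. Tinv (y - snd c0 0) $ i)"
      by (intro smooth_on_nth smooth_on_linear[of Tinv] smooth_on_diff smooth_on_id smooth_on_const)
        (simp add: Tinv linear_conv_bounded_linear[symmetric])
    obtain h N where h: "smooth_fun A h" "open N" "k x \<in> N" "N \<subseteq> fst c0" "\<And>q. q \<in> N \<Longrightarrow> h q = kinv q $ i"
      by (rule extend_germ[OF c0(1) k_in[OF x] chart_image_open[OF c0(1)] imageI[OF k_in[OF x]] order_refl u])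
        (auto simp: kinv_def)
    have "continuous_on U0 k" using plot_k by (simp add: plot_def)
    then obtain V where V: "open V" "U0 \<inter> V = {x\<in>U0. k x \<in> N}" by (rule continuous_on_open_preimage[OF _ h(2)])
    have UV: "open (U0 \<inter> V)" "x \<in> U0 \<inter> V" using V(1) U0(1) apply blast using V(2) x h(3) by blast
    have in_N: "y \<in> U0" "k y \<in> N" if "y \<in> U0 \<inter> V" for y using that V(2) by blast+
    have Dh: "frechet_derivative (\<lambda>x. h (k x)) (at y) = (\<lambda>v. v $ i)" if "y \<in> U0 \<inter> V" for y
    proof (rule frechet_derivative_at[symmetric], rule has_derivative_transform_within_open[OF _ UV(1) that])
      show "((\<lambda>v. v $ i) has_derivative (\<lambda>v. v $ i)) (at y)"
        by (rule bounded_linear_imp_has_derivative[OF bounded_linear_vec_nth])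
    qed (simp add: h(5) in_N kinv_k)
    have fr: "frame b (k y) h = L y b $ i" if "y \<in> U0 \<inter> V" for y b
      using frame_k[OF h(1) in_N(1)[OF that]] Dh[OF that] by simp
    have fr2: "frame a (k x) (\<lambda>q. frame b q h) = frechet_derivative (\<lambda>x. L x b) (at x) (L x a) $ i" for a b
    proof -
      have "((\<lambda>x. L x b $ i) has_derivative (\<lambda>v. frechet_derivative (\<lambda>x. L x b) (at x) v $ i)) (at x)"
        by (rule bounded_linear.has_derivative[OF bounded_linear_vec_nth smooth_on_has_derivative[OF U0(1) L_smooth x]])
      then have "((\<lambda>x. frame b (k x) h) has_derivative (\<lambda>v. frechet_derivative (\<lambda>x. L x b) (at x) v $ i)) (at x)"
        by (rule has_derivative_transform_within_open[OF _ UV]) (simp add: fr)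
      from frechet_derivative_at[OF this] show ?thesis
        using frame_k[OF lie_algebra_smooth[OF frame_in h(1)] x, of a b] by metis
    qed
    have "lie_bracket (frame a) (frame b) (k x) h = frame (C a b) (k x) h" by (simp add: bracket_frame)
    then show ?thesis by (simp add: lie_bracket_def fr2 fr[OF UV(2)])
  qed
  then show ?thesis by (simp add: vec_eq_iff)
qed

text \<open>The Maurer-Cartan equation. It results from differentiating
  \<open>\<Theta> x (L x b) = b\<close> and inserting \<open>L_structure\<close>.\<close>

lemma \<Theta>_structure:
  assumes x: "x \<in> U0"
  shows "frechet_derivative (\<lambda>x. \<Theta> x w) (at x) u - frechet_derivative (\<lambda>x. \<Theta> x u) (at x) w = - C (\<Theta> x u) (\<Theta> x w)"
proof -
  have D: "frechet_derivative (\<lambda>y. \<Theta> y (L x b)) (at x) u = - \<Theta> x (frechet_derivative (\<lambda>x. L x b) (at x) u)" for b u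
  proof -
    have 1: "((\<lambda>x. \<Theta> x (L x b)) has_derivative (\<lambda>u. frechet_derivative (\<lambda>y. \<Theta> y (L x b)) (at x) u
        + \<Theta> x (frechet_derivative (\<lambda>x. L x b) (at x) u))) (at x)"
      by (rule has_derivative_apply[OF U0(1) x \<Theta>_smooth \<Theta>_linear smooth_on_has_derivative[OF U0(1) L_smooth x]])
    have "((\<lambda>x. \<Theta> x (L x b)) has_derivative (\<lambda>u. 0)) (at x)"
      by (rule has_derivative_transform_within_open[OF has_derivative_const U0(1) x]) (simp add: \<Theta>_L)
    from fun_cong[OF has_derivative_unique[OF 1 this], of u] show ?thesis by (simp add: eq_neg_iff_add_eq_0)
  qed
  have "frechet_derivative (\<lambda>y. \<Theta> y (L x b)) (at x) (L x a) - frechet_derivative (\<lambda>y. \<Theta> y (L x a)) (at x) (L x b) = - C a b" for a b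
  proof -
    have "frechet_derivative (\<lambda>y. \<Theta> y (L x b)) (at x) (L x a) - frechet_derivative (\<lambda>y. \<Theta> y (L x a)) (at x) (L x b)
      = - \<Theta> x (frechet_derivative (\<lambda>x. L x b) (at x) (L x a) - frechet_derivative (\<lambda>x. L x a) (at x) (L x b))"
      by (simp add: D linear_diff[OF \<Theta>_linear[OF x]])
    then show ?thesis by (simp only: L_structure[OF x] \<Theta>_L[OF x])
  qed
  from this[of "\<Theta> x w" "\<Theta> x u"] show ?thesis by (simp only: L_\<Theta>[OF x])
qed

end

section \<open>The local exponential map\<close>

context carnot_frame
begin

text \<open>The Baker-Campbell-Hausdorff product, whose series ends after the first bracket in step
  two.\<close>

definition mul :: "real^'n \<Rightarrow> real^'n \<Rightarrow> real^'n"
  where "mul x y = x + y + (1/2) *\<^sub>R C x y"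

text \<open>The projection that kills the second layer. The bracket factors through it and takes its
  values in its kernel.\<close>

definition P :: "real^'n \<Rightarrow> real^'n" where "P x = (\<chi> i. if i \<in> J then 0 else x $ i)"

lemma P_linear: "bounded_linear P"
  unfolding linear_conv_bounded_linear[symmetric] by (auto simp: P_def vec_eq_iff intro!: linearI)

sublocale P: bounded_linear P by (rule P_linear)

lemma C_P: "C (P x) y = C x y" "C x (P y) = C x y" and P_C: "P (C x y) = 0" and P_P: "P (P x) = P x"
proof -
  have *: "C (P x) y = C x y" for x y
  proof -
    have "C (x - P x) y = 0" by (rule C_center) (simp add: P_def)
    then show ?thesis by (simp add: C.diff_left)
  qed
  show "C (P x) y = C x y" by (rule *)
  show "C x (P y) = C x y" using *[of y x] C_antisym by metis
  show "P (C x y) = 0" by (simp add: P_def vec_eq_iff C_range)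
  show "P (P x) = P x" by (simp add: P_def vec_eq_iff)
qed

lemma mul_0: "mul 0 x = x" "mul x 0 = x" by (simp_all add: mul_def C.zero_left C.zero_right)

lemma mul_assoc: "mul (mul x y) z = mul x (mul y z)"
  by (simp add: mul_def C.add_left C.add_right C.scaleR_left C.scaleR_right C_C algebra_simps)

lemma mul_minus: "mul x (- x) = 0" "mul (- x) x = 0"
  by (simp_all add: mul_def C.minus_left C.minus_right C_self)

text \<open>By the Maurer-Cartan equation \<open>P \<Theta>\<close> is closed, so \<open>P \<Theta> = dF1\<close> by the Poincare lemma. Then
  \<open>(1 - P) \<Theta> + C F1 \<Theta> / 2\<close> is closed as well, which yields the components in the second layer.\<close>

lemma local_log:
  obtains \<rho> F where "\<rho> > 0" "ball 0 \<rho> \<subseteq> U0" "smooth_on (ball 0 \<rho>) F" "F 0 = 0"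
    "\<And>x. x \<in> ball 0 \<rho> \<Longrightarrow> (F has_derivative (\<lambda>u. \<Theta> x u + (1/2) *\<^sub>R C (F x) (\<Theta> x u))) (at x)"
proof -
  obtain \<rho> where \<rho>: "\<rho> > 0" "ball 0 \<rho> \<subseteq> U0" using U0 openE by blast
  let ?S = "ball (0::real^'n) \<rho>"
  have S: "open ?S" "convex ?S" "0 \<in> ?S" using \<rho> by auto
  have U: "x \<in> U0" if "x \<in> ?S" for x using that \<rho> by blast
  let ?D = "\<lambda>u x. frechet_derivative (\<lambda>x. \<Theta> x u) (at x)"
  have \<Theta>s: "smooth_on ?S (\<lambda>x. \<Theta> x u)" for u by (rule smooth_on_subset[OF \<Theta>_smooth \<rho>(2)])
  have D: "((\<lambda>x. \<Theta> x u) has_derivative ?D u x) (at x)" if "x \<in> ?S" for x u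
    by (rule smooth_on_has_derivative[OF S(1) \<Theta>s that])
  note lin = \<Theta>_linear[OF U]
  have closed1: "frechet_derivative (\<lambda>x. P (\<Theta> x u)) (at x) v = frechet_derivative (\<lambda>x. P (\<Theta> x v)) (at x) u"
    if x: "x \<in> ?S" for x u v
  proof -
    have fd: "frechet_derivative (\<lambda>x. P (\<Theta> x u)) (at x) = (\<lambda>v. P (?D u x v))" for u
      by (rule frechet_derivative_at[OF bounded_linear.has_derivative[OF P_linear D[OF x]], symmetric])
    have "P (?D u x v - ?D v x u) = 0" unfolding \<Theta>_structure[OF U[OF x], of u v] by (simp add: P.neg P_C)
    then show ?thesis by (simp add: fd P.diff)
  qed
  have s1: "smooth_on ?S (\<lambda>x. P (\<Theta> x u))" for u by (rule smooth_on_linear[OF P_linear \<Theta>s])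
  have l1: "linear (\<lambda>u. P (\<Theta> x u))" if "x \<in> ?S" for x
    using linear_compose[OF lin[OF that] P.linear_axioms] by (simp add: comp_def)
  obtain F1 where F1: "smooth_on ?S F1" "\<And>x. x \<in> ?S \<Longrightarrow> (F1 has_derivative (\<lambda>u. P (\<Theta> x u))) (at x)" "F1 0 = 0"
    by (rule poincare[OF S s1 l1 closed1]; (assumption | (rule that; assumption)))
  let ?w = "\<lambda>x u. (\<Theta> x u - P (\<Theta> x u)) + (1/2) *\<^sub>R C (F1 x) (\<Theta> x u)"
  have s2: "smooth_on ?S (\<lambda>x. ?w x u)" for u
    by (rule smooth_on_add[OF smooth_on_diff[OF \<Theta>s s1] smooth_on_scaleR[OF smooth_on_const smooth_on_bilinear[OF C_bounded F1(1) \<Theta>s]]])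
  have l2: "linear (?w x)" if "x \<in> ?S" for x
    by (rule linearI) (simp_all add: linear_add[OF lin[OF that]] linear_scale[OF lin[OF that]] P.add P.scaleR
        C.add_right C.scaleR_right algebra_simps)
  have closed2: "frechet_derivative (\<lambda>x. ?w x u) (at x) v = frechet_derivative (\<lambda>x. ?w x v) (at x) u"
    if x: "x \<in> ?S" for x u v
  proof -
    have fd: "frechet_derivative (\<lambda>x. ?w x u) (at x)
      = (\<lambda>v. (?D u x v - P (?D u x v)) + (1/2) *\<^sub>R (C (F1 x) (?D u x v) + C (P (\<Theta> x v)) (\<Theta> x u)))" for u
      by (rule frechet_derivative_at[symmetric])
        (intro has_derivative_add has_derivative_diff has_derivative_scaleR_right
          bounded_bilinear.FDERIV[OF C_bounded] bounded_linear.has_derivative[OF P_linear] D[OF x] F1(2)[OF x])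
    have st: "?D u x v - ?D v x u = - C (\<Theta> x v) (\<Theta> x u)" by (rule \<Theta>_structure[OF U[OF x]])
    have "frechet_derivative (\<lambda>x. ?w x u) (at x) v - frechet_derivative (\<lambda>x. ?w x v) (at x) u
      = (?D u x v - ?D v x u) - P (?D u x v - ?D v x u) + (1/2) *\<^sub>R C (F1 x) (?D u x v - ?D v x u)
        + (1/2) *\<^sub>R (C (\<Theta> x v) (\<Theta> x u) - C (\<Theta> x u) (\<Theta> x v))"
      unfolding fd by (simp add: C_P P.diff C.diff_right algebra_simps)
    also have "\<dots> = - C (\<Theta> x v) (\<Theta> x u) + (1/2) *\<^sub>R (C (\<Theta> x v) (\<Theta> x u) + C (\<Theta> x v) (\<Theta> x u))"
      unfolding st using C_antisym[of "\<Theta> x u" "\<Theta> x v"] by (simp add: P.neg P_C C.minus_right C_C)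
    also have "\<dots> = 0" by (simp add: scaleR_2[symmetric])
    finally show ?thesis by simp
  qed
  obtain F2 where F2: "smooth_on ?S F2" "\<And>x. x \<in> ?S \<Longrightarrow> (F2 has_derivative ?w x) (at x)" "F2 0 = 0"
    by (rule poincare[OF S s2 l2 closed2]; (assumption | (rule that; assumption)))
  \<comment> \<open>The first layer of \<open>F\<close> comes from \<open>F1\<close> and the second
    from \<open>F2\<close>. As the bracket only sees the first layer, \<open>F1\<close> may be
    replaced by \<open>F\<close> inside it.\<close>
  define F where "F x = P (F1 x) + (F2 x - P (F2 x))" for x
  have CF: "C (F x) y = C (F1 x) y" for x y
  proof -
    have "C (F x) y = C (P (F x)) y" by (simp add: C_P)
    also have "P (F x) = P (F1 x)" by (simp add: F_def P.add P.diff P_P)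
    finally show ?thesis by (simp add: C_P)
  qed
  have "smooth_on ?S F" unfolding F_def
    by (intro smooth_on_add smooth_on_diff smooth_on_linear[OF P_linear] F1(1) F2(1))
  moreover have "F 0 = 0" by (simp add: F_def F1 F2 P.zero)
  moreover have "(F has_derivative (\<lambda>u. \<Theta> x u + (1/2) *\<^sub>R C (F x) (\<Theta> x u))) (at x)" if x: "x \<in> ?S" for x
  proof -
    have "(F has_derivative (\<lambda>u. P (P (\<Theta> x u)) + (?w x u - P (?w x u)))) (at x)"
      unfolding F_def by (intro has_derivative_add has_derivative_diff bounded_linear.has_derivative[OF P_linear] F1(2)[OF x] F2(2)[OF x])
    moreover have "P (P (\<Theta> x u)) + (?w x u - P (?w x u)) = \<Theta> x u + (1/2) *\<^sub>R C (F x) (\<Theta> x u)" for u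
      by (simp add: CF P.add P.diff P.scaleR P_P P_C)
    ultimately show ?thesis by simp
  qed
  ultimately show ?thesis using that \<rho> by blast
qed

text \<open>As a function of \<open>y\<close>, the defect \<open>E\<close> of the homomorphism law
  solves the linear equation \<open>E' = C E \<Theta> / 2\<close> with \<open>E 0 = 0\<close>. Since
  \<open>P\<close> kills brackets, \<open>P E\<close> is constant and hence zero. Then the right
  side vanishes as well, and \<open>E\<close> is constant.\<close>

lemma local_log_hom:
  assumes \<rho>: "\<rho> > 0" "ball 0 \<rho> \<subseteq> U0" and F0: "F 0 = 0"
    and DF: "\<And>x. x \<in> ball 0 \<rho> \<Longrightarrow> (F has_derivative (\<lambda>u. \<Theta> x u + (1/2) *\<^sub>R C (F x) (\<Theta> x u))) (at x)"
  obtains e where "e > 0" "\<And>x y. x \<in> ball 0 e \<Longrightarrow> y \<in> ball 0 e \<Longrightarrow> (x, y) \<in> Dn \<and> n x y \<in> ball 0 \<rho> \<and> F (n x y) = mul (F x) (F y)"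
proof -
  have "continuous_on Dn (\<lambda>z. n (fst z) (snd z))" by (rule smooth_on_continuous[OF Dn_Dm(2)])
  then obtain V where V: "open V" "Dn \<inter> V = {z\<in>Dn. n (fst z) (snd z) \<in> ball 0 \<rho>}"
    by (rule continuous_on_open_preimage[OF _ open_ball])
  have "(0, 0) \<in> Dn \<inter> V" unfolding V(2) using Dn_x0[OF U0(2)] n_x0[OF U0(2)] \<rho> by simp
  moreover have "open (Dn \<inter> V)" using V(1) Dn_Dm(1) by blast
  ultimately obtain A' B' where AB: "open A'" "open B'" "(0::real^'n) \<in> A'" "(0::real^'n) \<in> B'" "A' \<times> B' \<subseteq> Dn \<inter> V"
    by (metis open_prod_def SigmaE2)
  have "open (A' \<inter> B' \<inter> ball 0 \<rho>)" "0 \<in> A' \<inter> B' \<inter> ball 0 \<rho>" using AB \<rho> by auto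
  then obtain e where e: "e > 0" "ball 0 e \<subseteq> A' \<inter> B' \<inter> ball 0 \<rho>" using openE by blast
  have in_D: "(x, y) \<in> Dn" "n x y \<in> ball 0 \<rho>" "x \<in> ball 0 \<rho>" if "x \<in> ball 0 e" "y \<in> ball 0 e" for x y
  proof -
    have "(x, y) \<in> Dn \<inter> V" using that e AB(5) by blast
    then show "(x, y) \<in> Dn" "n x y \<in> ball 0 \<rho>" unfolding V(2) by auto
    show "x \<in> ball 0 \<rho>" using that e by blast
  qed
  have zero: "F (n x y) = mul (F x) (F y)" if x: "x \<in> ball 0 e" and y: "y \<in> ball 0 e" for x y
  proof -
    define E where "E y = F (n x y) - mul (F x) (F y)" for y
    have E0: "E 0 = 0" using x \<rho> in_D(3)[OF x x] by (auto simp: E_def n_x0 mul_0 F0)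
    have DE: "(E has_derivative (\<lambda>v. (1/2) *\<^sub>R C (E y) (\<Theta> y v))) (at y within ball 0 e)" if y: "y \<in> ball 0 e" for y
    proof -
      note D = in_D[OF x y] in_D(3)[OF y y]
      have 1: "((\<lambda>y. F (n x y)) has_derivative (\<lambda>v. \<Theta> (n x y) (dn x y v) + (1/2) *\<^sub>R C (F (n x y)) (\<Theta> (n x y) (dn x y v)))) (at y)"
        by (rule has_derivative_comp[OF dn[OF D(1)] DF[OF D(2)]]) simp
      let ?F' = "\<lambda>v. \<Theta> y v + (1/2) *\<^sub>R C (F y) (\<Theta> y v)"
      have "((\<lambda>y. mul (F x) (F y)) has_derivative (\<lambda>v. (0 + ?F' v) + (1/2) *\<^sub>R C (F x) (?F' v))) (at y)"
        unfolding mul_def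
        by (intro has_derivative_add has_derivative_const has_derivative_scaleR_right DF[OF D(4)]
           bounded_linear.has_derivative[OF C.bounded_linear_right])
      from has_derivative_diff[OF 1 this]
      have "(E has_derivative (\<lambda>v. \<Theta> (n x y) (dn x y v) + (1/2) *\<^sub>R C (F (n x y)) (\<Theta> (n x y) (dn x y v))
          - ((0 + ?F' v) + (1/2) *\<^sub>R C (F x) (?F' v)))) (at y)"
        by (simp add: E_def[abs_def])
      moreover have "\<Theta> (n x y) (dn x y v) + (1/2) *\<^sub>R C (F (n x y)) (\<Theta> (n x y) (dn x y v))
          - ((0 + ?F' v) + (1/2) *\<^sub>R C (F x) (?F' v)) = (1/2) *\<^sub>R C (E y) (\<Theta> y v)" for v
        unfolding \<Theta>_left_invariant[OF D(1)]
        by (simp add: E_def mul_def C.diff_left C.add_left C.add_right C.scaleR_left C.scaleR_right C_C algebra_simps)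
      ultimately show ?thesis by (simp add: has_derivative_at_withinI)
    qed
    have "P (E y) = P (E 0)" if y: "y \<in> ball 0 e" for y
    proof (rule has_derivative_zero_unique[OF convex_ball _ y])
      show "0 \<in> ball 0 e" using e by simp
      show "((\<lambda>y. P (E y)) has_derivative (\<lambda>h. 0)) (at z within ball 0 e)" if "z \<in> ball 0 e" for z
        using bounded_linear.has_derivative[OF P_linear DE[OF that]] by (simp add: P.scaleR P_C)
    qed
    then have PE: "C (E y) z = 0" if "y \<in> ball 0 e" for y z
      using that C_P(1)[of "E y" z] E0 by (simp add: P.zero C.zero_left)
    have "E y = E 0"
    proof (rule has_derivative_zero_unique[OF convex_ball _ y])
      show "0 \<in> ball 0 e" using e by simp
      show "(E has_derivative (\<lambda>h. 0)) (at z within ball 0 e)" if "z \<in> ball 0 e" for z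
        using DE[OF that] by (simp add: PE[OF that])
    qed
    then show ?thesis using E0 by (simp add: E_def)
  qed
  show ?thesis using that[OF e(1)] in_D zero by blast
qed

text \<open>The inverse \<open>g\<close> of the local logarithm satisfies \<open>Dg(y) v = L (g y) (v - C y v / 2)\<close>,
  which yields its smoothness by bootstrapping.\<close>

lemma local_exp:
  obtains \<sigma> lg V W e where "open V" "0 \<in> V" "open W" "0 \<in> W" "plot A V \<sigma>" "\<sigma> 0 = 0"
    "\<And>y. y \<in> V \<Longrightarrow> \<sigma> y \<in> W \<and> lg (\<sigma> y) = y" "\<And>p. p \<in> W \<Longrightarrow> lg p \<in> V \<and> \<sigma> (lg p) = p"
    "\<And>(Z::(real^'n) set) f. plot A Z f \<Longrightarrow> f ` Z \<subseteq> W \<Longrightarrow> smooth_on Z (\<lambda>x. lg (f x))"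
    "e > 0" "\<And>x y. x \<in> ball 0 e \<Longrightarrow> y \<in> ball 0 e \<Longrightarrow> x \<in> V \<and> y \<in> V \<and> mul x y \<in> V \<and> \<sigma> (mul x y) = \<sigma> x + \<sigma> y"
    "\<And>f. smooth_fun A f \<Longrightarrow> ((\<lambda>x. f (\<sigma> x)) has_derivative (\<lambda>a. frame a 0 f)) (at 0)"
    "continuous_on W lg"
proof -
  obtain \<rho> F where \<rho>: "\<rho> > 0" "ball 0 \<rho> \<subseteq> U0" and Fs: "smooth_on (ball 0 \<rho>) F" and F0: "F 0 = 0"
    and DF: "\<And>x. x \<in> ball 0 \<rho> \<Longrightarrow> (F has_derivative (\<lambda>u. \<Theta> x u + (1/2) *\<^sub>R C (F x) (\<Theta> x u))) (at x)"
    by (rule local_log; (rule that; assumption))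
  let ?S = "ball (0::real^'n) \<rho>"
  let ?F' = "\<lambda>x u. \<Theta> x u + (1/2) *\<^sub>R C (F x) (\<Theta> x u)"
  define B where "B x = Blinfun (?F' x)" for x
  have B: "blinfun_apply (B x) = ?F' x" if "x \<in> ?S" for x
    unfolding B_def by (rule bounded_linear_Blinfun_apply[OF has_derivative_bounded_linear[OF DF[OF that]]])
  have Bc: "continuous_on ?S B"
  proof (rule continuous_on_blinfun_componentwise)
    fix i :: "real^'n"
    have "smooth_on ?S (\<lambda>x. ?F' x i)"
      by (intro smooth_on_add smooth_on_scaleR smooth_on_const smooth_on_bilinear[OF C_bounded] Fs smooth_on_subset[OF \<Theta>_smooth \<rho>(2)])
    then show "continuous_on ?S (\<lambda>x. B x i)"
      by (rule continuous_on_eq[OF smooth_on_continuous]) (simp add: B)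
  qed
  have S0: "0 \<in> ?S" using \<rho> by simp
  have "blinfun_apply (B 0) = (\<lambda>u. u)" using B[OF S0] by (simp add: F0 \<Theta>_0 fun_eq_iff C.zero_left)
  then have inv: "id_blinfun o\<^sub>L B 0 = id_blinfun" by (intro blinfun_eqI) simp
  have derB: "(F has_derivative blinfun_apply (B x)) (at x)" if "x \<in> ?S" for x
    unfolding B[OF that] by (rule DF[OF that])
  obtain U' V g g' where ift: "open U'" "U' \<subseteq> ?S" "0 \<in> U'" "open V" "F 0 \<in> V" "homeomorphism U' V F g"
    "\<And>y. y \<in> V \<Longrightarrow> (g has_derivative (g' y)) (at y)"
    "\<And>y. y \<in> V \<Longrightarrow> g' y = inv (blinfun_apply (B (g y)))"
    "\<And>y. y \<in> V \<Longrightarrow> bij (blinfun_apply (B (g y)))"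
    by (rule inverse_function_theorem[OF open_ball derB Bc S0 inv]; (assumption | (rule that; assumption)))
  have gF: "g (F x) = x" "F x \<in> V" if "x \<in> U'" for x using ift(6) that unfolding homeomorphism_def by blast+
  have Fg: "F (g y) = y" "g y \<in> U'" if "y \<in> V" for y using ift(6) that unfolding homeomorphism_def by blast+
  have gS: "g y \<in> ?S" "g y \<in> U0" if "y \<in> V" for y using Fg(2)[OF that] ift(2) \<rho>(2) by blast+
  have g': "g' y v = L (g y) (v - (1/2) *\<^sub>R C y v)" if y: "y \<in> V" for y v
  proof -
    have "?F' (g y) (L (g y) (v - (1/2) *\<^sub>R C y v)) = v"
      by (simp add: \<Theta>_L[OF gS(2)[OF y]] Fg(1)[OF y] C.diff_right C.scaleR_right C_C)
    then have "blinfun_apply (B (g y)) (L (g y) (v - (1/2) *\<^sub>R C y v)) = v" by (simp add: B[OF gS(1)[OF y]])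
    then show ?thesis unfolding ift(8)[OF y] using ift(9)[OF y] by (metis bij_inv_eq_iff)
  qed
  have gs: "smooth_on V g" unfolding smooth_on_def
  proof
    fix j show "Ck_on j V g"
    proof (induction j)
      case 0
      show ?case using ift(6) by (simp add: homeomorphism_def)
    next
      case (Suc j)
      have 1: "Ck_on j V (\<lambda>y. L (g y) w)" for w
        by (rule Ck_on_compose[OF L_smooth[unfolded smooth_on_def, rule_format] Suc]) (use gS(2) in blast)
      have 2: "Ck_on j V (\<lambda>y. v - (1/2) *\<^sub>R C y v)" for v
      proof -
        have "smooth_on V (\<lambda>y. v - (1/2) *\<^sub>R C y v)"
          by (intro smooth_on_diff smooth_on_scaleR smooth_on_const smooth_on_bilinear[OF C_bounded] smooth_on_id)
        then show ?thesis by (simp add: smooth_on_def)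
      qed
      have 3: "Ck_on j V (\<lambda>y. g' y v)" for v
      proof (rule Ck_on_eqI)
        show "Ck_on j V (\<lambda>y. \<Sum>i\<in>UNIV. ((v - (1/2) *\<^sub>R C y v) $ i) *\<^sub>R L (g y) (axis i 1))"
          by (rule Ck_on_sum[OF finite_class.finite_UNIV], rule Ck_on_bilinear[OF bounded_bilinear_scaleR _ 1],
            rule Ck_on_bounded_linear_o[OF bounded_linear_vec_nth 2])
        show "g' y v = (\<Sum>i\<in>UNIV. ((v - (1/2) *\<^sub>R C y v) $ i) *\<^sub>R L (g y) (axis i 1))" if "y \<in> V" for y
          unfolding g'[OF that] by (rule linear_vec_expand[OF L_linear[OF gS(2)[OF that]]])
      qed
      show ?case unfolding Ck_on.simps
        by (rule exI[of _ g']) (use 3 ift(7) in \<open>auto intro: has_derivative_at_withinI\<close>)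
    qed
  qed
  obtain e1 where e1: "e1 > 0" and hom: "\<And>x y. x \<in> ball 0 e1 \<Longrightarrow> y \<in> ball 0 e1 \<Longrightarrow> (x, y) \<in> Dn \<and> n x y \<in> ball 0 \<rho> \<and> F (n x y) = mul (F x) (F y)"
    using local_log_hom[OF \<rho> F0 DF] by blast
  define \<sigma> where "\<sigma> y = k (g y)" for y
  define lg where "lg p = F (kinv p)" for p
  define W where "W = {p \<in> fst c0. kinv p \<in> U'}"
  have kinv_cont: "continuous_on (fst c0) kinv"
  proof -
    have "continuous_on (fst c0) (snd c0)" using chart_homeo[OF c0(1)] homeomorphism_def by blast
    moreover have "continuous_on UNIV Tinv" using Tinv(1) linear_continuous_on linear_conv_bounded_linear by blast
    ultimately show ?thesis unfolding kinv_def
      by (intro continuous_on_compose2[of UNIV Tinv "fst c0" "\<lambda>p. snd c0 p - snd c0 0"] continuous_on_diff continuous_on_const) auto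
  qed
  have W: "open W"
  proof -
    obtain X where X: "open X" "fst c0 \<inter> X = {p \<in> fst c0. kinv p \<in> U'}"
      by (rule continuous_on_open_preimage[OF kinv_cont ift(1)])
    then show ?thesis unfolding W_def X(2)[symmetric] using chart_open[OF c0(1)] by blast
  qed
  have U'0: "x \<in> U0" if "x \<in> U'" for x using that ift(2) \<rho>(2) by blast
  have k0: "kinv 0 = 0" using kinv_k[OF U0(2)] by (simp add: k_0)
  have W0: "0 \<in> W" using c0 ift(3) by (simp add: W_def k0)
  have ps: "plot A V \<sigma>" unfolding \<sigma>_def by (rule plot_compose[OF plot_k gs]) (use gS in blast)
  have g0: "g 0 = 0" using gF[OF ift(3)] F0 by simp
  have s0: "\<sigma> 0 = 0" by (simp add: \<sigma>_def g0 k_0)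
  have sW: "\<sigma> y \<in> W \<and> lg (\<sigma> y) = y" if "y \<in> V" for y
    using gS(2)[OF that] Fg[OF that] by (simp add: \<sigma>_def lg_def W_def k_in kinv_k)
  have lW: "lg p \<in> V \<and> \<sigma> (lg p) = p" if "p \<in> W" for p
    using that gF[of "kinv p"] by (simp add: \<sigma>_def lg_def W_def k_kinv)
  have lgs: "smooth_on Z (\<lambda>x. lg (f x))" if f: "plot A Z f" "f ` Z \<subseteq> W" for Z :: "(real^'n) set" and f
  proof -
    have c: "f ` Z \<subseteq> fst c0" "(\<lambda>x. kinv (f x)) ` Z \<subseteq> ?S" using f(2) ift(2) unfolding W_def by blast+
    show ?thesis unfolding lg_def by (rule smooth_on_compose[OF Fs smooth_kinv_plot[OF f(1) c(1)] c(2)])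
  qed
  have V0: "0 \<in> V" using ift(5) F0 by simp
  have "\<exists>e>0. \<forall>x\<in>ball 0 e. \<forall>y\<in>ball 0 e. x \<in> V \<and> y \<in> V \<and> mul x y \<in> V \<and> \<sigma> (mul x y) = \<sigma> x + \<sigma> y"
  proof -
    have th: "thick (V \<times> V)" by (rule thick_open[OF open_Times[OF ift(4) ift(4)]])
    have "plot A (V \<times> V) (\<lambda>z. \<sigma> (fst z) + \<sigma> (snd z))"
      by (rule plot_add[OF plot_compose[OF ps] plot_compose[OF ps] th])
        (auto intro: smooth_on_linear[OF bounded_linear_fst smooth_on_id] smooth_on_linear[OF bounded_linear_snd smooth_on_id])
    then have "continuous_on (V \<times> V) (\<lambda>z. \<sigma> (fst z) + \<sigma> (snd z))" by (simp add: plot_def)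
    then obtain X where X: "open X" "V \<times> V \<inter> X = {z \<in> V \<times> V. \<sigma> (fst z) + \<sigma> (snd z) \<in> W}"
      by (rule continuous_on_open_preimage[OF _ W])
    have "continuous_on V g" by (rule smooth_on_continuous[OF gs])
    then obtain Y where Y: "open Y" "V \<inter> Y = {y \<in> V. g y \<in> ball 0 e1}" by (rule continuous_on_open_preimage[OF _ open_ball])
    have "open (V \<times> V \<inter> X)" using X(1) ift(4) open_Times by blast
    moreover have "(0, 0) \<in> V \<times> V \<inter> X" unfolding X(2) using V0 s0 W0 by simp
    ultimately obtain A' B' where AB: "open A'" "open B'" "(0::real^'n) \<in> A'" "(0::real^'n) \<in> B'" "A' \<times> B' \<subseteq> V \<times> V \<inter> X"
      by (metis open_prod_def SigmaE2)
    have "0 \<in> V \<inter> Y" unfolding Y(2) using V0 g0 e1 by simp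
    then have "open (A' \<inter> B' \<inter> (V \<inter> Y))" "0 \<in> A' \<inter> B' \<inter> (V \<inter> Y)" using AB Y(1) ift(4) by blast+
    then obtain e where e: "e > 0" "ball 0 e \<subseteq> A' \<inter> B' \<inter> (V \<inter> Y)" using openE by blast
    have "x \<in> V \<and> y \<in> V \<and> mul x y \<in> V \<and> \<sigma> (mul x y) = \<sigma> x + \<sigma> y" if x: "x \<in> ball 0 e" and y: "y \<in> ball 0 e" for x y
    proof -
      have "(x, y) \<in> V \<times> V \<inter> X" using x y e AB(5) by blast
      then have w: "\<sigma> x + \<sigma> y \<in> W" "x \<in> V" "y \<in> V" unfolding X(2) by auto
      have "x \<in> V \<inter> Y" "y \<in> V \<inter> Y" using x y e by blast+
      then have "g x \<in> ball 0 e1" "g y \<in> ball 0 e1" unfolding Y(2) by auto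
      from hom[OF this] have h: "F (n (g x) (g y)) = mul (F (g x)) (F (g y))" by blast
      have "lg (\<sigma> x + \<sigma> y) = mul x y" using h by (simp add: lg_def \<sigma>_def n_def Fg w)
      then show ?thesis using lW[OF w(1)] w by simp
    qed
    then show ?thesis using e(1) by blast
  qed
  then obtain e where e: "e > 0" "\<And>x y. x \<in> ball 0 e \<Longrightarrow> y \<in> ball 0 e \<Longrightarrow> x \<in> V \<and> y \<in> V \<and> mul x y \<in> V \<and> \<sigma> (mul x y) = \<sigma> x + \<sigma> y"
    by blast
  have df: "((\<lambda>x. f (\<sigma> x)) has_derivative (\<lambda>a. frame a 0 f)) (at 0)" if f: "smooth_fun A f" for f
  proof -
    have "L 0 a = a" for a using L_\<Theta>[OF U0(2), of a] by (simp add: \<Theta>_0)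
    then have "g' 0 = (\<lambda>v. v)" using g'[OF V0] by (simp add: g0 fun_eq_iff C.zero_left)
    then have 1: "(g has_derivative (\<lambda>v. v)) (at 0)" using ift(7)[OF V0] by simp
    have 2: "((\<lambda>y. f (k y)) has_derivative (\<lambda>a. frame a 0 f)) (at 0)" using frame_derivative[OF f, of 0] by simp
    show ?thesis unfolding \<sigma>_def by (rule has_derivative_comp[OF 1 2]) (simp add: g0)
  qed
  have "continuous_on W lg" unfolding lg_def
  proof (rule continuous_on_compose2[OF smooth_on_continuous[OF Fs]])
    show "continuous_on W kinv" by (rule continuous_on_subset[OF kinv_cont]) (auto simp: W_def)
    show "kinv ` W \<subseteq> ?S" using ift(2) by (auto simp: W_def)
  qed
  with that[OF ift(4) V0 W W0 ps s0 sW lW lgs e df] show ?thesis by blast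
qed

end

section \<open>The global exponential map\<close>

fun nsum :: "nat \<Rightarrow> 'a::monoid_add \<Rightarrow> 'a" where
  "nsum 0 a = 0"
| "nsum (Suc j) a = a + nsum j a"

lemma idem_zero: "a = a + a \<Longrightarrow> a = (0 :: 'a::group_add)"
proof -
  assume "a = a + a"
  then have "a + a = a + 0" by simp
  then show ?thesis by (simp only: add_left_cancel)
qed

lemma nsum_add: "nsum (i + j) a = nsum i a + nsum j a"
  by (induction i) (simp_all add: add.assoc)

lemma nsum_mult: "nsum (i * j) a = nsum i (nsum j a)"
  by (induction i) (simp_all add: nsum_add)

lemma nsum_commute: "b + a = a + b \<Longrightarrow> b + nsum j a = nsum j a + b"
proof (induction j)
  case (Suc j)
  have "b + (a + nsum j a) = a + (b + nsum j a)" using Suc.prems by (simp only: add.assoc[symmetric])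
  then show ?case using Suc by (simp add: add.assoc)
qed simp

lemma nsum_sum_commute:
  fixes a b c :: "'a::monoid_add"
  assumes "c + a = a + c" "c + b = b + c" shows "c + (a + b) = (a + b) + c"
proof -
  have "c + (a + b) = (c + a) + b" by (simp only: add.assoc)
  also have "\<dots> = a + (c + b)" unfolding assms(1) by (simp only: add.assoc)
  also have "\<dots> = (a + b) + c" unfolding assms(2) by (simp only: add.assoc)
  finally show ?thesis .
qed

lemma nsum_commutator:
  fixes a b c :: "'a::monoid_add"
  assumes ab: "a + b = b + a + (c + c)" and c: "c + a = a + c" "c + b = b + c"
  shows "nsum j a + b = b + nsum j a + nsum (2 * j) c"
proof (induction j)
  case (Suc j)
  have cj: "(c + c) + nsum j a = nsum j a + (c + c)"
    by (rule nsum_commute, rule nsum_sum_commute[OF c(1)[symmetric] c(1)[symmetric], symmetric])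
  have "nsum (Suc j) a + b = a + (nsum j a + b)" by (simp add: add.assoc)
  also have "\<dots> = (a + b) + nsum j a + nsum (2 * j) c" unfolding Suc by (simp add: add.assoc)
  also have "\<dots> = b + a + ((c + c) + nsum j a) + nsum (2 * j) c" unfolding ab by (simp add: add.assoc)
  also have "\<dots> = b + (a + nsum j a) + (c + (c + nsum (2 * j) c))" unfolding cj by (simp add: add.assoc)
  finally show ?case by simp
qed simp

text \<open>Rearranging \<open>j\<close> copies of \<open>a + b\<close> into
  \<open>nsum j a + nsum j b\<close> takes \<open>j * (j - 1) / 2\<close> exchanges, each at the
  price of the central commutator \<open>c + c\<close>. Writing the commutator as
  \<open>c + c\<close> matches the factor 1/2 in \<open>mul\<close>.\<close>

lemma nsum_sum:
  fixes a b c :: "'a::monoid_add"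
  assumes ab: "a + b = b + a + (c + c)" and c: "c + a = a + c" "c + b = b + c"
  shows "nsum j a + nsum j b = nsum j (a + b) + nsum (j * (j - 1)) c"
proof (induction j)
  case (Suc j)
  have cb: "nsum (2 * j) c + nsum j b = nsum j b + nsum (2 * j) c"
    by (rule nsum_commute, rule nsum_commute[symmetric]) (rule c(2)[symmetric])
  have "nsum (Suc j) a + nsum (Suc j) b = a + (nsum j a + b) + nsum j b" by (simp add: add.assoc)
  also have "\<dots> = a + b + nsum j a + (nsum (2 * j) c + nsum j b)"
    unfolding nsum_commutator[OF assms] by (simp add: add.assoc)
  also have "\<dots> = a + b + (nsum j a + nsum j b) + nsum (2 * j) c" unfolding cb by (simp add: add.assoc)
  also have "\<dots> = nsum (Suc j) (a + b) + nsum (j * (j - 1) + 2 * j) c" unfolding Suc by (simp add: nsum_add add.assoc)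
  also have "j * (j - 1) + 2 * j = Suc j * (Suc j - 1)" by (cases j) simp_all
  finally show ?case .
qed simp

lemma nsum_add_commuting:
  fixes a c :: "'a::monoid_add"
  assumes "c + a = a + c" shows "nsum j (a + c) = nsum j a + nsum j c"
proof (induction j)
  case (Suc j)
  have "c + nsum j a = nsum j a + c" by (rule nsum_commute[OF assms])
  then have "c + (nsum j a + z) = nsum j a + (c + z)" for z by (simp only: add.assoc[symmetric])
  then have "a + c + (nsum j a + nsum j c) = a + nsum j a + (c + nsum j c)" by (simp only: add.assoc)
  then show ?case using Suc by simp
qed simp

context carnot_frame
begin

lemma mul_line: "mul (s *\<^sub>R x) (t *\<^sub>R x) = (s + t) *\<^sub>R x"
  by (simp add: mul_def C.scaleR_left C.scaleR_right C_self scaleR_add_left)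

lemma mul_smooth: "smooth_on S f \<Longrightarrow> smooth_on S h \<Longrightarrow> smooth_on S (\<lambda>x. mul (f x) (h x))"
  unfolding mul_def by (intro smooth_on_add smooth_on_scaleR smooth_on_const smooth_on_bilinear[OF C_bounded])

text \<open>Near \<open>0\<close> the curve \<open>t \<mapsto> \<sigma> (t x)\<close> is a one-parameter subgroup, so \<open>\<Phi> x\<close> can be defined as the
  \<open>j\<close>-fold sum of \<open>\<sigma> (x / j)\<close> for any large \<open>j\<close>. That \<open>\<Phi>\<close> is a homomorphism then follows from the
  commutator of \<open>\<sigma> (x / j)\<close> and \<open>\<sigma> (y / j)\<close> being central.\<close>

lemma hom_extension:
  fixes \<sigma> :: "real^'n \<Rightarrow> 'g"
  assumes e: "e > 0" and hom: "\<And>x y. norm x < e \<Longrightarrow> norm y < e \<Longrightarrow> \<sigma> (mul x y) = \<sigma> x + \<sigma> y"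
  obtains \<Phi> where "\<And>x. norm x < e \<Longrightarrow> \<Phi> x = \<sigma> x" "\<And>x y. \<Phi> (mul x y) = \<Phi> x + \<Phi> y"
proof -
  have "\<sigma> 0 = \<sigma> 0 + \<sigma> 0" using hom[of 0 0] e by (simp add: mul_0)
  then have s0: "\<sigma> 0 = 0" by (rule idem_zero)
  have mult: "\<sigma> (real j *\<^sub>R u) = nsum j (\<sigma> u)" if "norm (real j *\<^sub>R u) < e" for j u
    using that
  proof (induction j)
    case (Suc j)
    have 1: "norm (real j *\<^sub>R u) \<le> norm (real (Suc j) *\<^sub>R u)" and 2: "norm u \<le> norm (real (Suc j) *\<^sub>R u)"
      by (simp_all add: mult_right_mono) (simp add: algebra_simps)
    have "real (Suc j) *\<^sub>R u = mul u (real j *\<^sub>R u)" using mul_line[of 1 u "real j"] by simp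
    then have "\<sigma> (real (Suc j) *\<^sub>R u) = \<sigma> u + \<sigma> (real j *\<^sub>R u)" using hom[of u "real j *\<^sub>R u"] 1 2 Suc.prems by simp
    then show ?case using Suc 1 by simp
  qed (simp add: s0)
  have div: "\<sigma> x = nsum j (\<sigma> ((1 / real j) *\<^sub>R x))" if "norm x < e" "j > 0" for x j
    using mult[of j "(1 / real j) *\<^sub>R x"] that by simp
  define N where "N x = Suc (nat \<lceil>norm x / e\<rceil>)" for x :: "real^'n"
  have N: "norm ((1 / real (N x)) *\<^sub>R x) < e" for x
  proof -
    have "norm x / e < real (N x)" unfolding N_def using real_nat_ceiling_ge[of "norm x / e"] by linarith
    then have "norm x < real (N x) * e" using e by (simp add: field_simps)
    then show ?thesis using N_def[of x] by (simp add: field_simps)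
  qed
  define \<Phi> where "\<Phi> x = nsum (N x) (\<sigma> ((1 / real (N x)) *\<^sub>R x))" for x
  have eq: "\<Phi> x = nsum j (\<sigma> ((1 / real j) *\<^sub>R x))" if j: "j > 0" "norm ((1 / real j) *\<^sub>R x) < e" for x j
  proof -
    have "\<Phi> x = nsum (N x) (nsum j (\<sigma> ((1 / real j) *\<^sub>R (1 / real (N x)) *\<^sub>R x)))"
      unfolding \<Phi>_def using div[OF N j(1), of x] by simp
    also have "\<dots> = nsum j (nsum (N x) (\<sigma> ((1 / real (N x)) *\<^sub>R (1 / real j) *\<^sub>R x)))"
      by (simp add: nsum_mult[symmetric] mult.commute)
    also have "\<dots> = nsum j (\<sigma> ((1 / real j) *\<^sub>R x))" using div[OF j(2), of "N x"] by (simp add: N_def)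
    finally show ?thesis .
  qed
  have "\<Phi> x = \<sigma> x" if "norm x < e" for x using eq[of 1 x] that by simp
  moreover have "\<Phi> (mul x y) = \<Phi> x + \<Phi> y" for x y
  proof -
    \<comment> \<open>The integer \<open>j\<close> is chosen with \<open>R < e * j\<close>, so that
      every vector to which \<open>hom\<close> is applied below has norm at most
      \<open>R / j\<close> and thus less than \<open>e\<close>.\<close>
    define R where "R = norm x + norm y + norm (C x y)"
    define l where "l = nat \<lceil>R / e\<rceil>"
    define j where "j = Suc l"
    have "R / e < real j" unfolding j_def l_def using real_nat_ceiling_ge[of "R / e"] by linarith
    then have R: "R < e * real j" using e by (simp add: field_simps)
    have j: "real j > 0" "real j \<ge> 1" by (simp_all add: j_def)
    define X where "X = (1 / real j) *\<^sub>R x"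
    define Y where "Y = (1 / real j) *\<^sub>R y"
    define u where "u = (1 / 2) *\<^sub>R C X Y"
    have nX: "norm X * real j = norm x" "norm Y * real j = norm y" using j by (simp_all add: X_def Y_def)
    have nu: "norm u * 2 * real j * real j = norm (C x y)"
      using j by (simp add: u_def X_def Y_def C.scaleR_left C.scaleR_right)
    have nj: "norm (real j *\<^sub>R u) * real j * 2 = norm (C x y)" using nu by (simp add: mult_ac)
    have uj: "norm u * real j * 2 \<le> norm u * 2 * real j * real j"
      using mult_left_mono[OF j(2), of "norm u * 2 * real j"] j by (simp add: mult_ac)
    have uu: "norm u * real j \<le> norm (C x y)" "norm u * 2 * real j \<le> norm (C x y)" proof -
      have "norm u * real j \<ge> 0" by simp
      then show "norm u * real j \<le> norm (C x y)" "norm u * 2 * real j \<le> norm (C x y)" using uj nu by linarith+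
    qed
    have small: "norm z < e" if "norm z * real j \<le> R" for z :: "real^'n"
    proof -
      have "norm z * real j < e * real j" using that R by linarith
      then show ?thesis using j by simp
    qed
    have sX: "norm X < e" and sY: "norm Y < e" by (rule small, simp add: nX R_def)+
    have cu: "C z u = 0" "C u z = 0" for z by (simp_all add: u_def C.scaleR_right C.scaleR_left C_C)
    have XY: "mul X Y = X + Y + u" by (simp add: mul_def u_def)
    have YX: "mul Y X = X + Y - u" using C_antisym[of Y X] by (simp add: mul_def u_def)
    have s1: "norm (X + Y + u) < e" and s2: "norm (X + Y - u) < e"
    proof -
      have "norm (X + Y + u) \<le> norm X + norm Y + norm u" "norm (X + Y - u) \<le> norm X + norm Y + norm u"
        using norm_triangle_ineq[of "X + Y" u] norm_triangle_ineq4[of "X + Y" u] norm_triangle_ineq[of X Y] by linarith+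
      then have "norm (X + Y + u) * real j \<le> (norm X + norm Y + norm u) * real j"
        "norm (X + Y - u) * real j \<le> (norm X + norm Y + norm u) * real j" using j by (simp_all add: mult_right_mono)
      moreover have "(norm X + norm Y + norm u) * real j \<le> R" using uu by (simp add: distrib_right nX R_def)
      ultimately show "norm (X + Y + u) < e" "norm (X + Y - u) < e" using small by force+
    qed
    have su: "norm u < e" by (rule small) (use uu in \<open>simp add: R_def add_increasing\<close>)
    have suu: "norm (u + u) < e" by (rule small) (use uu in \<open>simp add: R_def add_increasing scaleR_2[symmetric] mult.commute\<close>)
    have sj: "norm (real j *\<^sub>R u) < e"
    proof (rule small)
      show "norm (real j *\<^sub>R u) * real j \<le> R"
        using nj norm_ge_zero[of x] norm_ge_zero[of y] norm_ge_zero[of "C x y"] unfolding R_def by linarith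
    qed
    have sl: "norm (real l *\<^sub>R u) < e"
    proof -
      have "norm (real l *\<^sub>R u) \<le> norm (real j *\<^sub>R u)" by (simp add: j_def mult_right_mono)
      then show ?thesis using sj by linarith
    qed
    let ?a = "\<sigma> X" and ?b = "\<sigma> Y" and ?c = "\<sigma> u"
    have ab: "\<sigma> (X + Y + u) = ?a + ?b" using hom[OF sX sY] by (simp add: XY)
    have ba: "\<sigma> (X + Y - u) = ?b + ?a" using hom[OF sY sX] by (simp add: YX)
    have cc: "\<sigma> (u + u) = ?c + ?c" using hom[OF su su] by (simp add: mul_def C_self)
    have cuu: "C z (u + u) = 0" for z unfolding C.add_right cu by (rule add_0_right)
    \<comment> \<open>\<open>u + u\<close> is the commutator of \<open>X\<close> and
      \<open>Y\<close>, so \<open>?c\<close> is half of it, as in \<open>nsum_sum\<close>.\<close>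
    have "mul (X + Y - u) (u + u) = X + Y + u"
      unfolding mul_def cuu by (simp only: add.assoc[symmetric] diff_add_cancel scaleR_zero_right add_0_right)
    then have abc: "?a + ?b = ?b + ?a + (?c + ?c)" using hom[OF s2 suu] ab ba cc by simp
    have cz: "?c + \<sigma> z = \<sigma> z + ?c" if "norm z < e" for z
    proof -
      have "mul u z = mul z u" by (simp add: mul_def cu)
      then show ?thesis using hom[OF su that] hom[OF that su] by simp
    qed
    have lc: "\<sigma> (real l *\<^sub>R u) = nsum l ?c" by (rule mult[OF sl])
    \<comment> \<open>Division by \<open>j\<close> is not a homomorphism: the bracket term of
      \<open>mul X Y\<close> is \<open>u\<close>, while here it is \<open>j\<close> times
      \<open>u\<close>. The surplus of \<open>l = j - 1\<close> copies is central, and its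
      \<open>j\<close>-fold sum is the correction term in \<open>nsum_sum\<close>.\<close>
    have "(1 / real j) *\<^sub>R mul x y = X + Y + real j *\<^sub>R u"
      using j by (simp add: mul_def X_def Y_def u_def C.scaleR_left C.scaleR_right scaleR_add_right)
    also have "\<dots> = mul (X + Y + u) (real l *\<^sub>R u)" by (simp add: mul_def cu C.scaleR_right j_def algebra_simps)
    finally have xy: "(1 / real j) *\<^sub>R mul x y = mul (X + Y + u) (real l *\<^sub>R u)" .
    have "norm (X + Y + real j *\<^sub>R u) * real j \<le> (norm X + norm Y + norm (real j *\<^sub>R u)) * real j"
      using norm_triangle_ineq[of "X + Y" "real j *\<^sub>R u"] norm_triangle_ineq[of X Y] j by (intro mult_right_mono) auto
    also have "\<dots> \<le> R" using nj norm_ge_zero[of "C x y"] unfolding R_def distrib_right nX by linarith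
    finally have "norm ((1 / real j) *\<^sub>R mul x y) < e"
      using small \<open>(1 / real j) *\<^sub>R mul x y = X + Y + real j *\<^sub>R u\<close> by metis
    then have "\<Phi> (mul x y) = nsum j (\<sigma> (mul (X + Y + u) (real l *\<^sub>R u)))" using eq[of j "mul x y"] j xy by simp
    also have "\<dots> = nsum j (?a + ?b + nsum l ?c)" using hom[OF s1 sl] ab lc by simp
    also have "\<dots> = nsum j (?a + ?b) + nsum j (nsum l ?c)"
    proof (rule nsum_add_commuting)
      have "?c + (?a + ?b) = (?a + ?b) + ?c" by (rule nsum_sum_commute[OF cz[OF sX] cz[OF sY]])
      then show "nsum l ?c + (?a + ?b) = ?a + ?b + nsum l ?c" by (rule nsum_commute[OF sym, symmetric])
    qed
    also have "nsum j (nsum l ?c) = nsum (j * (j - 1)) ?c" by (simp only: nsum_mult j_def diff_Suc_1)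
    also have "nsum j (?a + ?b) + nsum (j * (j - 1)) ?c = nsum j ?a + nsum j ?b"
      by (rule nsum_sum[OF abc cz[OF sX] cz[OF sY], symmetric])
    also have "\<dots> = \<Phi> x + \<Phi> y" using eq[of j x] eq[of j y] sX sY j by (simp add: X_def Y_def)
    finally show ?thesis .
  qed
  ultimately show ?thesis using that by blast
qed

end

section \<open>Bijectivity of the exponential map\<close>

locale carnot = carnot_frame A c0 T J C
  for A :: "('g::{topological_group_add, t2_space, second_countable_topology}, 'n::finite) chart set"
    and c0 T J C +
  assumes conn: "connected (UNIV :: 'g set)" and sconn: "simply_connected (UNIV :: 'g set)"
begin

lemma smooth_fun_continuous: assumes f: "smooth_fun A f" shows "continuous_on UNIV f"
  unfolding continuous_on_eq_continuous_at[OF open_UNIV]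
proof
  fix p
  obtain c where c: "c \<in> A" "p \<in> fst c" using chart_cover by blast
  have "continuous_on (fst c) (snd c)" using chart_homeo[OF c(1)] homeomorphism_def by blast
  moreover have "continuous_on (snd c ` fst c) (\<lambda>x. f (chart_inv c x))"
    by (rule smooth_on_continuous[OF smooth_fun_chart[OF c(1) f]])
  ultimately have "continuous_on (fst c) (\<lambda>q. f (chart_inv c (snd c q)))"
    using continuous_on_compose2 by blast
  then have "continuous_on (fst c) f"
    by (rule continuous_on_eq) (simp add: chart_inv_chart[OF c(1)])
  then show "isCont f p" using continuous_on_eq_continuous_at[OF chart_open[OF c(1)]] c(2) by blast
qed

lemma continuous_translate: "continuous_on S (\<lambda>q. (a::'g) + q)"
  by (intro continuous_on_add continuous_on_const continuous_on_id)

lemma mul_continuous: "continuous_on S f \<Longrightarrow> continuous_on S h \<Longrightarrow> continuous_on S (\<lambda>x. mul (f x) (h x))"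
  unfolding mul_def by (intro continuous_intros C.continuous_on)

text \<open>If \<open>\<Phi> x = 0\<close>, then \<open>t \<mapsto> \<Phi> (t x)\<close> is a loop. The ordered product of the increments of the
  loops of a null homotopy \<open>h\<close>, read through the local inverse of \<open>\<Phi>\<close>, depends continuously
  on the homotopy parameter and lies in the discrete kernel. It is \<open>x\<close> at the start and \<open>0\<close> at the end.\<close>

lemma kernel_trivial:
  assumes hom: "\<And>x y. \<Phi> (mul x y) = \<Phi> x + \<Phi> y" and cont: "continuous_on UNIV \<Phi>"
    and d: "d > 0" and N: "open N" "0 \<in> N" "\<And>x. norm x < d \<Longrightarrow> lg (\<Phi> x) = x \<and> \<Phi> x \<in> N"
      "\<And>p. p \<in> N \<Longrightarrow> \<Phi> (lg p) = p" "continuous_on N lg"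
    and x0: "\<Phi> x0 = (0::'g)"
  shows "x0 = 0"
proof -
  have "\<Phi> 0 = \<Phi> 0 + \<Phi> 0" using hom[of 0 0] by (simp add: mul_0)
  then have \<Phi>0: "\<Phi> 0 = 0" by (rule idem_zero)
  have lg0: "lg 0 = 0" using N(3)[of 0] d \<Phi>0 by simp
  have \<Phi>m: "\<Phi> (- x) = - \<Phi> x" for x
    by (rule minus_unique[symmetric]) (simp only: hom[symmetric] mul_minus \<Phi>0)
  let ?p = "\<lambda>t::real. \<Phi> (t *\<^sub>R x0)"
  have "path ?p" unfolding path_def by (rule continuous_on_compose2[OF cont]) (auto intro!: continuous_intros)
  moreover have "path (\<lambda>t. 0 :: 'g)" unfolding path_def by simp
  ultimately have "homotopic_loops UNIV ?p (\<lambda>t. 0)"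
    using sconn x0 \<Phi>0 unfolding simply_connected_def by (simp add: pathfinish_def pathstart_def)
  then obtain h :: "real \<times> real \<Rightarrow> 'g" where h: "continuous_on ({0..1} \<times> {0..1}) h"
    "\<And>t. t \<in> {0..1} \<Longrightarrow> h (0, t) = ?p t" "\<And>t. t \<in> {0..1} \<Longrightarrow> h (1, t) = 0"
    "\<And>s. s \<in> {0..1} \<Longrightarrow> h (s, 1) = h (s, 0)"
    unfolding homotopic_loops by (auto simp: pathfinish_def pathstart_def)
  let ?K = "{0..1} \<times> {0..1} \<times> {0..1} :: (real \<times> real \<times> real) set"
  let ?D = "\<lambda>z. - h (fst z, fst (snd z)) + h (fst z, snd (snd z))"
  have "continuous_on ?K (\<lambda>z. h (fst z, fst (snd z)))" "continuous_on ?K (\<lambda>z. h (fst z, snd (snd z)))"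
    by (rule continuous_on_compose2[OF h(1)], auto intro!: continuous_intros)+
  then have D: "continuous_on ?K ?D"
    by (intro continuous_on_add) (auto simp: continuous_on_def intro: tendsto_minus)
  then obtain O' where O: "open O'" "?K \<inter> O' = {z\<in>?K. ?D z \<in> N}" by (rule continuous_on_open_preimage[OF _ N(1)])
  \<comment> \<open>A substitute for uniform continuity. The distance between the two times is
    continuous and positive on the compact set where the increment lies outside \<open>N\<close>, so
    it has a positive minimum there.\<close>
  obtain \<delta> where \<delta>: "\<delta> > 0" "\<And>z. z \<in> ?K \<Longrightarrow> \<bar>fst (snd z) - snd (snd z)\<bar> < \<delta> \<Longrightarrow> ?D z \<in> N"
  proof (cases "?K - O' = {}")
    case True
    then have "?D z \<in> N" if "z \<in> ?K" for z using that O(2) by blast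
    then show ?thesis using that[of 1] by simp
  next
    case False
    have K: "compact (?K - O')" by (intro compact_diff compact_Times compact_Icc O(1))
    let ?f = "\<lambda>z::real \<times> real \<times> real. \<bar>fst (snd z) - snd (snd z)\<bar>"
    have fc: "continuous_on (?K - O') ?f" by (intro continuous_intros)
    obtain z0 where z0: "z0 \<in> ?K - O'" "\<And>z. z \<in> ?K - O' \<Longrightarrow> ?f z0 \<le> ?f z"
      using continuous_attains_inf[OF K False fc] by blast
    have pos: "?f z0 > 0"
    proof (rule ccontr)
      assume "\<not> ?f z0 > 0"
      then have "fst (snd z0) = snd (snd z0)" by simp
      then have "?D z0 \<in> N" using N(2) by simp
      then have "z0 \<in> ?K \<inter> O'" unfolding O(2) using z0(1) by blast
      then show False using z0(1) by blast
    qed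
    have "?D z \<in> N" if "z \<in> ?K" "?f z < ?f z0" for z
    proof -
      have "z \<in> O'" using z0(2)[of z] that by force
      then have "z \<in> ?K \<inter> O'" using that by blast
      then show ?thesis unfolding O(2) by blast
    qed
    then show ?thesis using that[OF pos] by blast
  qed
  \<comment> \<open>The first bound puts every increment of every loop into \<open>N\<close>. The
    second lets \<open>lg\<close> recover the increments \<open>x0 / j\<close> of the initial
    loop.\<close>
  obtain j :: nat where j: "j > 0" "1 / real j < \<delta>" "norm x0 / real j < d"
  proof -
    define j where "j = Suc (nat \<lceil>max (1 / \<delta>) (norm x0 / d)\<rceil>)"
    have "max (1 / \<delta>) (norm x0 / d) < real j" unfolding j_def
      using real_nat_ceiling_ge[of "max (1 / \<delta>) (norm x0 / d)"] by linarith
    then have "1 / \<delta> < real j" "norm x0 / d < real j" by auto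
    then have "1 / real j < \<delta>" "norm x0 / real j < d" using \<delta>(1) d by (auto simp: field_simps j_def)
    then show ?thesis using that[of j] by (simp add: j_def)
  qed
  define inc where "inc s i = - h (s, real i / real j) + h (s, real (Suc i) / real j)" for s i
  have ij: "real i / real j \<in> {0..1}" if "i \<le> j" for i using that j by simp
  have inc: "inc s i \<in> N" if "s \<in> {0..1}" "i < j" for s i
  proof -
    have "real (Suc i) / real j - real i / real j = 1 / real j" by (simp add: diff_divide_distrib[symmetric])
    moreover have "1 / real j \<ge> 0" by simp
    ultimately have "\<bar>real i / real j - real (Suc i) / real j\<bar> < \<delta>" using j(2) by linarith
    then show ?thesis using \<delta>(2)[of "(s, real i / real j, real (Suc i) / real j)"] that ij[of i] ij[of "Suc i"]
      by (simp add: inc_def)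
  qed
  define w where "w s = rec_nat 0 (\<lambda>i y. mul y (lg (inc s i)))" for s
  have w0: "w s 0 = 0" and wS: "w s (Suc i) = mul (w s i) (lg (inc s i))" for s i by (simp_all add: w_def)
  have wc: "continuous_on {0..1} (\<lambda>s. w s i)" if "i \<le> j" for i
    using that
  proof (induction i)
    case (Suc i)
    have "continuous_on {0..1} (\<lambda>s. h (s, real i / real j))" "continuous_on {0..1} (\<lambda>s. h (s, real (Suc i) / real j))"
      by (rule continuous_on_compose2[OF h(1)]; use ij[of i] ij[of "Suc i"] Suc.prems in \<open>auto intro!: continuous_intros\<close>)+
    then have "continuous_on {0..1} (\<lambda>s. inc s i)" unfolding inc_def
      by (intro continuous_on_add) (auto simp: continuous_on_def intro: tendsto_minus)
    then have "continuous_on {0..1} (\<lambda>s. lg (inc s i))"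
      by (rule continuous_on_compose2[OF N(5)]) (use inc Suc.prems in auto)
    then show ?case unfolding wS using Suc by (intro mul_continuous) auto
  qed (simp add: w0)
  have w\<Phi>: "\<Phi> (w s i) = - h (s, 0) + h (s, real i / real j)" if "i \<le> j" "s \<in> {0..1}" for s i
    using that
  proof (induction i)
    case (Suc i)
    then have "\<Phi> (w s (Suc i)) = - h (s, 0) + h (s, real i / real j) + inc s i"
      using N(4)[OF inc] by (simp add: wS hom)
    then show ?case by (simp add: inc_def add.assoc)
  qed (simp add: w0 \<Phi>0)
  have ker: "\<Phi> (w s j) = 0" if "s \<in> {0..1}" for s
    using w\<Phi>[OF order_refl that] h(4)[OF that] j by simp
  have "w 0 j = w 1 j"
  proof (rule connected_local_const[of "{0..1::real}" 0 1 "\<lambda>s. w s j"])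
    show "connected {0..1::real}" "0 \<in> {0..1::real}" "1 \<in> {0..1::real}" by simp_all
    show "\<forall>s\<in>{0..1}. \<forall>\<^sub>F t in at s within {0..1}. w s j = w t j"
    proof
    fix s :: real assume s: "s \<in> {0..1}"
    let ?y = "w s j"
    have "continuous_on UNIV (\<lambda>y. mul (- ?y) y)" by (intro mul_continuous continuous_on_const continuous_on_id)
    then have "isCont (\<lambda>y. mul (- ?y) y) ?y" by (simp add: continuous_on_eq_continuous_at)
    then obtain \<epsilon> where \<epsilon>: "\<epsilon> > 0" "\<And>y. dist y ?y < \<epsilon> \<Longrightarrow> dist (mul (- ?y) y) (mul (- ?y) ?y) < d"
      unfolding continuous_at_eps_delta using d by blast
    have eq: "?y = w t j" if t: "t \<in> {0..1}" "dist (w t j) ?y < \<epsilon>" for t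
    proof -
      from \<epsilon>(2)[OF t(2)] have n: "norm (mul (- ?y) (w t j)) < d" by (simp add: mul_minus)
      have "\<Phi> (mul (- ?y) (w t j)) = 0" using ker[OF s] ker[OF t(1)] by (simp add: hom \<Phi>m)
      then have "mul (- ?y) (w t j) = 0" using N(3)[OF n] lg0 by metis
      then have "mul ?y (mul (- ?y) (w t j)) = ?y" by (simp add: mul_0)
      then show ?thesis by (simp add: mul_assoc[symmetric] mul_minus mul_0)
    qed
    have "((\<lambda>t. w t j) \<longlongrightarrow> ?y) (at s within {0..1})" using wc[OF order_refl] s by (simp add: continuous_on_def)
    then have "\<forall>\<^sub>F t in at s within {0..1}. dist (w t j) ?y < \<epsilon>" using \<epsilon>(1) by (rule tendstoD)
    moreover have "\<forall>\<^sub>F t in at s within {0..1}. t \<in> {0..1}" by (simp add: eventually_at_filter)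
    ultimately show "\<forall>\<^sub>F t in at s within {0..1}. ?y = w t j" by eventually_elim (rule eq)
    qed
  qed
  moreover have "w 1 i = 0" if "i \<le> j" for i using that
  proof (induction i)
    case (Suc i)
    then have "inc 1 i = 0" using h(3)[OF ij[of i]] h(3)[OF ij[of "Suc i"]] by (simp add: inc_def)
    then show ?case using Suc by (simp add: wS lg0 mul_0)
  qed (simp add: w0)
  moreover have "w 0 i = (real i / real j) *\<^sub>R x0" if "i \<le> j" for i using that
  proof (induction i)
    case (Suc i)
    have "inc 0 i = - \<Phi> ((real i / real j) *\<^sub>R x0) + \<Phi> ((real (Suc i) / real j) *\<^sub>R x0)"
      using h(2)[OF ij[of i]] h(2)[OF ij[of "Suc i"]] Suc.prems by (simp add: inc_def)
    also have "\<dots> = \<Phi> (mul ((- (real i / real j)) *\<^sub>R x0) ((real (Suc i) / real j) *\<^sub>R x0))"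
      by (simp add: hom \<Phi>m)
    also have "mul ((- (real i / real j)) *\<^sub>R x0) ((real (Suc i) / real j) *\<^sub>R x0) = (1 / real j) *\<^sub>R x0"
      unfolding mul_line by (simp add: add_divide_distrib)
    finally have "lg (inc 0 i) = (1 / real j) *\<^sub>R x0" using N(3)[of "(1 / real j) *\<^sub>R x0"] j by simp
    then show ?case using Suc by (simp add: wS mul_line add_divide_distrib add.commute)
  qed (simp add: w0)
  ultimately show ?thesis using j by force
qed

text \<open>Near any point, \<open>\<Phi>\<close> and its inverse are obtained from
  \<open>\<sigma>\<close> and \<open>lg\<close> by left translations, which makes them smooth
  everywhere. The inverse is stated by components because \<open>smooth_fun\<close> concerns
  real-valued functions.\<close>

lemma global_exp:
  obtains \<Phi> where "bij \<Phi>" "\<And>x y. \<Phi> (mul x y) = \<Phi> x + \<Phi> y" "plot A UNIV \<Phi>"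
    "\<And>i. smooth_fun A (\<lambda>p. inv \<Phi> p $ i)"
    "\<And>f. smooth_fun A f \<Longrightarrow> ((\<lambda>x. f (\<Phi> x)) has_derivative (\<lambda>a. frame a 0 f)) (at 0)"
proof -
  obtain \<sigma> lg V W e where loc: "open V" "0 \<in> V" "open W" "0 \<in> W" "plot A V \<sigma>" "\<sigma> 0 = 0"
    "\<And>y. y \<in> V \<Longrightarrow> \<sigma> y \<in> W \<and> lg (\<sigma> y) = y" "\<And>p. p \<in> W \<Longrightarrow> lg p \<in> V \<and> \<sigma> (lg p) = p"
    "\<And>(Z::(real^'n) set) f. plot A Z f \<Longrightarrow> f ` Z \<subseteq> W \<Longrightarrow> smooth_on Z (\<lambda>x. lg (f x))"
    "e > 0" "\<And>x y. x \<in> ball 0 e \<Longrightarrow> y \<in> ball 0 e \<Longrightarrow> x \<in> V \<and> y \<in> V \<and> mul x y \<in> V \<and> \<sigma> (mul x y) = \<sigma> x + \<sigma> y"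
    "\<And>f. smooth_fun A f \<Longrightarrow> ((\<lambda>x. f (\<sigma> x)) has_derivative (\<lambda>a. frame a 0 f)) (at 0)"
    "continuous_on W lg"
    by (rule local_exp; (rule that; assumption))
  have hom0: "\<sigma> (mul x y) = \<sigma> x + \<sigma> y" if "norm x < e" "norm y < e" for x y using loc(11)[of x y] that by simp
  obtain \<Phi> where \<Phi>\<sigma>: "\<And>x. norm x < e \<Longrightarrow> \<Phi> x = \<sigma> x" and hom: "\<And>x y. \<Phi> (mul x y) = \<Phi> x + \<Phi> y"
    by (rule hom_extension[OF loc(10) hom0]; (assumption | (rule that; assumption)))
  have eV: "x \<in> V" if "norm x < e" for x using loc(11)[of x 0] that loc(10) by simp
  have \<Phi>0: "\<Phi> 0 = 0" using \<Phi>\<sigma>[of 0] loc(6,10) by simp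
  have \<Phi>m: "\<Phi> (- x) = - \<Phi> x" for x
    by (rule minus_unique[symmetric]) (simp only: hom[symmetric] mul_minus \<Phi>0)
  obtain X where X: "open X" "W \<inter> X = {p\<in>W. lg p \<in> ball 0 e}" by (rule continuous_on_open_preimage[OF loc(13) open_ball])
  define N where "N = W \<inter> X"
  have lg0: "lg 0 = 0" using loc(2,6,7) by metis
  have N: "open N" "0 \<in> N" "N \<subseteq> W" "\<And>p. p \<in> N \<Longrightarrow> norm (lg p) < e" "\<And>p. p \<in> W \<Longrightarrow> norm (lg p) < e \<Longrightarrow> p \<in> N"
  proof -
    show "open N" using loc(3) X(1) by (auto simp: N_def)
    show "0 \<in> N" unfolding N_def X(2) using loc(4,10) lg0 by simp
    show "N \<subseteq> W" by (auto simp: N_def)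
    show "\<And>p. p \<in> N \<Longrightarrow> norm (lg p) < e" "\<And>p. p \<in> W \<Longrightarrow> norm (lg p) < e \<Longrightarrow> p \<in> N" unfolding N_def X(2) by auto
  qed
  have \<Phi>lg: "\<Phi> (lg p) = p" if "p \<in> N" for p using \<Phi>\<sigma>[OF N(4)[OF that]] loc(8)[of p] N(3) that by auto
  have lg\<Phi>: "lg (\<Phi> x) = x \<and> \<Phi> x \<in> N" if "norm x < e" for x
    using \<Phi>\<sigma>[OF that] loc(7)[OF eV[OF that]] N(5)[of "\<Phi> x"] that by simp
  have plot\<Phi>: "plot A UNIV \<Phi>"
  proof (rule plot_local[OF thick_UNIV])
    fix x0 :: "real^'n"
    let ?f = "\<lambda>x. mul (- x0) x"
    have fs: "smooth_on S ?f" for S by (rule mul_smooth[OF smooth_on_const smooth_on_id])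
    obtain Y where Y: "open Y" "UNIV \<inter> Y = {x\<in>UNIV. ?f x \<in> ball 0 e}"
      by (rule continuous_on_open_preimage[OF smooth_on_continuous[OF fs] open_ball])
    then have Y2: "Y = {x. norm (?f x) < e}" by auto
    have "plot A Y (\<lambda>x. \<Phi> x0 + \<sigma> (?f x))"
      by (rule plot_add[OF plot_const plot_compose[OF loc(5) fs] thick_open[OF Y(1)]]) (use Y2 eV in blast)
    moreover have "\<Phi> x0 + \<sigma> (?f x) = \<Phi> x" if "x \<in> Y" for x
    proof -
      have "\<sigma> (?f x) = \<Phi> (?f x)" using that \<Phi>\<sigma> Y2 by simp
      then show ?thesis by (simp add: hom \<Phi>m)
    qed
    ultimately have "plot A (UNIV \<inter> Y) \<Phi>" using plot_cong[of Y "\<lambda>x. \<Phi> x0 + \<sigma> (?f x)" \<Phi> A] by simp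
    moreover have "x0 \<in> Y" using loc(10) by (simp add: Y2 mul_minus)
    ultimately show "\<exists>U. open U \<and> x0 \<in> U \<and> plot A (UNIV \<inter> U) \<Phi>" using Y(1) by blast
  qed (rule chart_open)
  have surj: "range \<Phi> = UNIV"
  proof -
    have op: "\<exists>U. open U \<and> p \<in> U \<and> (\<forall>q\<in>U. - p + q \<in> N)" for p
    proof -
      obtain U where "open U" "UNIV \<inter> U = {q\<in>UNIV. - p + q \<in> N}"
        by (rule continuous_on_open_preimage[OF continuous_translate N(1)])
      then show ?thesis using N(2) by (intro exI[of _ U]) auto
    qed
    \<comment> \<open>The range is a subgroup that contains the neighbourhood \<open>N\<close> of
      the identity. It and its complement are therefore unions of translates of \<open>N\<close>, so
      both are open and connectedness applies.\<close>
    have sh: "q \<in> range \<Phi> \<longleftrightarrow> p \<in> range \<Phi>" if pq: "- p + q \<in> N" for p q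
    proof
      assume "p \<in> range \<Phi>"
      then obtain x where "p = \<Phi> x" by blast
      then have "\<Phi> (mul x (lg (- p + q))) = q" using \<Phi>lg[OF pq] by (simp add: hom)
      then show "q \<in> range \<Phi>" by (metis rangeI)
    next
      assume "q \<in> range \<Phi>"
      then obtain x where "q = \<Phi> x" by blast
      then have "\<Phi> (mul x (- lg (- p + q))) = p" using \<Phi>lg[OF pq] by (simp add: hom \<Phi>m minus_add)
      then show "p \<in> range \<Phi>" by (metis rangeI)
    qed
    have "open (range \<Phi>)" "open (- range \<Phi>)"
      unfolding open_subopen[of "range \<Phi>"] open_subopen[of "- range \<Phi>"]
      using op sh by (metis subsetI) (metis op sh subsetI ComplD ComplI)
    from connectedD[OF conn this] have "range \<Phi> = {} \<or> - range \<Phi> = {}" by simp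
    then show ?thesis by auto
  qed
  have contN: "continuous_on N lg" by (rule continuous_on_subset[OF loc(13) N(3)])
  have cont\<Phi>: "continuous_on UNIV \<Phi>" using plot\<Phi> by (simp add: plot_def)
  have "inj \<Phi>"
  proof (rule injI)
    fix x y assume "\<Phi> x = \<Phi> y"
    then have "\<Phi> (mul (- x) y) = 0" by (simp add: hom \<Phi>m)
    then have "mul (- x) y = 0"
      using kernel_trivial[of \<Phi> e N lg "mul (- x) y"] hom cont\<Phi> loc(10) N(1,2) lg\<Phi> \<Phi>lg contN by blast
    then have "mul x (mul (- x) y) = x" by (simp add: mul_0)
    then show "x = y" by (simp add: mul_assoc[symmetric] mul_minus mul_0)
  qed
  then have bij: "bij \<Phi>" using surj by (simp add: bij_def)
  have inv\<Phi>: "inv \<Phi> (\<Phi> x) = x" "\<Phi> (inv \<Phi> p) = p" for x p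
    using bij by (simp_all add: bij_is_inj bij_is_surj surj_f_inv_f)
  have sm: "smooth_fun A (\<lambda>p. inv \<Phi> p $ i)" for i
  proof (rule smooth_funI)
    fix c assume c: "c \<in> A"
    let ?Z = "snd c ` fst c" and ?f = "chart_inv c"
    have Z: "open ?Z" by (rule chart_image_open[OF c])
    have pl: "plot A ?Z ?f" by (rule plot_chart_inv[OF c])
    have "smooth_on ?Z (\<lambda>z. inv \<Phi> (?f z))"
    proof (rule smooth_on_local[OF thick_open[OF Z]])
      fix z0 assume z0: "z0 \<in> ?Z"
      let ?g = "\<lambda>z. - ?f z0 + ?f z"
      have pg: "plot A ?Z ?g" by (rule plot_add[OF plot_const pl thick_open[OF Z]])
      then have "continuous_on ?Z ?g" by (simp add: plot_def)
      then obtain Y where Y: "open Y" "?Z \<inter> Y = {z\<in>?Z. ?g z \<in> N}" by (rule continuous_on_open_preimage[OF _ N(1)])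
      have gN: "?g z \<in> N" if "z \<in> ?Z \<inter> Y" for z using that unfolding Y(2) by blast
      have "smooth_on (?Z \<inter> Y) (\<lambda>z. lg (?g z))"
        by (rule loc(9)[OF plot_subset[OF pg]]) (use gN N(3) in auto)
      then have "smooth_on (?Z \<inter> Y) (\<lambda>z. mul (inv \<Phi> (?f z0)) (lg (?g z)))" by (rule mul_smooth[OF smooth_on_const])
      then have "smooth_on (?Z \<inter> Y) (\<lambda>z. inv \<Phi> (?f z))"
      proof (rule smooth_on_eqI)
        fix z assume z: "z \<in> ?Z \<inter> Y"
        have "\<Phi> (mul (inv \<Phi> (?f z0)) (lg (?g z))) = ?f z" by (simp add: hom inv\<Phi> \<Phi>lg[OF gN[OF z]])
        then show "inv \<Phi> (?f z) = mul (inv \<Phi> (?f z0)) (lg (?g z))" using inv\<Phi>(1) by metis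
      qed
      moreover have "z0 \<in> ?Z \<inter> Y" unfolding Y(2) using z0 N(2) by simp
      ultimately show "\<exists>U. open U \<and> z0 \<in> U \<and> smooth_on (?Z \<inter> U) (\<lambda>z. inv \<Phi> (?f z))" using Y(1) by blast
    qed
    then show "smooth_on ?Z (\<lambda>z. inv \<Phi> (?f z) $ i)" by (rule smooth_on_nth)
  qed
  have "((\<lambda>x. f (\<Phi> x)) has_derivative (\<lambda>a. frame a 0 f)) (at 0)" if f: "smooth_fun A f" for f
    by (rule has_derivative_transform_within_open[OF loc(12)[OF f] open_ball[of 0 e]]) (use loc(10) \<Phi>\<sigma> in auto)
  with that[OF bij hom plot\<Phi> sm] show ?thesis by blast
qed

end

section \<open>Lengths and balls in exponential coordinates\<close>

definition vel :: "(real \<Rightarrow> 'a::real_normed_vector) \<Rightarrow> real \<Rightarrow> 'a"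
  where "vel \<gamma> t = vector_derivative \<gamma> (at t within {0..1})"

lemma vel_eqI: "(\<gamma> has_vector_derivative v) (at t within {0..1}) \<Longrightarrow> t \<in> {0..1} \<Longrightarrow> vel \<gamma> t = v"
  unfolding vel_def using vector_derivative_within_cbox[of 0 1 t \<gamma> v] by simp

lemma smooth_vel:
  fixes \<gamma> :: "real \<Rightarrow> 'a::euclidean_space"
  assumes "smooth_on {0..1} \<gamma>"
  shows "t \<in> {0..1} \<Longrightarrow> (\<gamma> has_vector_derivative vel \<gamma> t) (at t within {0..1})"
    and "smooth_on {0..1} (vel \<gamma>)"
proof -
  let ?D = "\<lambda>t. frechet_derivative \<gamma> (at t within {0..1}) 1"
  have *: "(\<gamma> has_vector_derivative ?D t) (at t within {0..1})" if "t \<in> {0..1}" for t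
  proof -
    have D: "(\<gamma> has_derivative frechet_derivative \<gamma> (at t within {0..1})) (at t within {0..1})"
      by (rule smooth_on_has_derivative_within[OF assms that])
    have "frechet_derivative \<gamma> (at t within {0..1}) s = s *\<^sub>R ?D t" for s
      using linear_scale[OF has_derivative_linear[OF D], of s 1] by simp
    then show ?thesis unfolding has_vector_derivative_def by (intro has_derivative_eq_rhs[OF D] ext)
  qed
  show "t \<in> {0..1} \<Longrightarrow> (\<gamma> has_vector_derivative vel \<gamma> t) (at t within {0..1})" for t
    using * vel_eqI by metis
  show "smooth_on {0..1} (vel \<gamma>)"
    by (rule smooth_on_eqI[OF smooth_on_derivative_within[OF thick_unit_interval assms, of 1]]) (rule vel_eqI[OF *])
qed

lemma norm_increment_le:
  fixes f :: "real \<Rightarrow> 'a::euclidean_space"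
  assumes "\<And>t. t \<in> {0..s} \<Longrightarrow> (f has_vector_derivative f' t) (at t within {0..s})"
    and "\<And>t. t \<in> {0..s} \<Longrightarrow> norm (f' t) \<le> h t" "h integrable_on {0..s}" "0 \<le> s"
  shows "norm (f s - f 0) \<le> integral {0..s} h"
proof -
  have "(f' has_integral f s - f 0) {0..s}" by (rule fundamental_theorem_of_calculus[OF assms(4,1)])
  then show ?thesis
    using integral_norm_bound_integral[of f' "{0..s}" h] assms(2,3) by (metis has_integral_integrable integral_unique)
qed

context carnot_frame
begin

text \<open>The Maurer-Cartan form in exponential coordinates. It inverts the map taking
  \<open>v\<close> to \<open>v + C x v / 2\<close>, which is the differential at the identity of
  left translation by \<open>x\<close>.\<close>

definition \<xi> :: "real^'n \<Rightarrow> real^'n \<Rightarrow> real^'n" where "\<xi> x v = v - (1/2) *\<^sub>R C x v"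

definition len :: "(real \<Rightarrow> real^'n) \<Rightarrow> real"
  where "len \<gamma> = integral {0..1} (\<lambda>t. norm (\<xi> (\<gamma> t) (vel \<gamma> t)))"

text \<open>The ball around the identity in exponential coordinates. The infimum of lengths is
  replaced by the existence of a path, which is equivalent for a strict bound.\<close>

definition coord_ball :: "real \<Rightarrow> (real^'n) set"
  where "coord_ball r = {q. \<exists>\<gamma>. smooth_on {0..1} \<gamma> \<and> \<gamma> 0 = 0 \<and> \<gamma> 1 = q \<and> len \<gamma> < r}"

lemma \<xi>_smooth: "smooth_on S f \<Longrightarrow> smooth_on S h \<Longrightarrow> smooth_on S (\<lambda>t. \<xi> (f t) (h t))"
  unfolding \<xi>_def by (intro smooth_on_diff smooth_on_scaleR smooth_on_const smooth_on_bilinear[OF C_bounded])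

lemma speed_continuous:
  assumes "smooth_on {0..1} \<gamma>" shows "continuous_on {0..1} (\<lambda>t. norm (\<xi> (\<gamma> t) (vel \<gamma> t)))"
  by (intro continuous_on_norm smooth_on_continuous[OF \<xi>_smooth[OF assms smooth_vel(2)[OF assms]]])

lemma speed_integrable:
  "smooth_on {0..1} \<gamma> \<Longrightarrow> (\<lambda>t. norm (\<xi> (\<gamma> t) (vel \<gamma> t))) integrable_on {0..1}"
  by (rule integrable_continuous_interval[OF speed_continuous])

lemma len_nonneg: "len \<gamma> \<ge> 0"
  \<comment> \<open>A speed that is not integrable has \<open>integral\<close> 0 by
    convention.\<close>
  unfolding len_def by (cases "(\<lambda>t. norm (\<xi> (\<gamma> t) (vel \<gamma> t))) integrable_on {0..1}")
    (auto simp: integral_nonneg not_integrable_integral)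

lemma mul_vector_derivative:
  assumes "(f has_vector_derivative f') (at t within S)" "(h has_vector_derivative h') (at t within S)"
  shows "((\<lambda>t. mul (f t) (h t)) has_vector_derivative (f' + h' + (1/2) *\<^sub>R (C (f t) h' + C f' (h t)))) (at t within S)"
proof -
  have "((\<lambda>t. C (f t) (h t)) has_vector_derivative (C (f t) h' + C f' (h t))) (at t within S)"
    by (rule bounded_bilinear.has_vector_derivative[OF C_bounded assms])
  then have "((\<lambda>t. (1/2) *\<^sub>R C (f t) (h t)) has_vector_derivative ((1/2) *\<^sub>R (C (f t) h' + C f' (h t)))) (at t within S)"
    by (rule bounded_linear.has_vector_derivative[OF bounded_linear_scaleR_right])
  then show ?thesis unfolding mul_def by (intro has_vector_derivative_add assms)
qed

text \<open>The product rule for velocities moved back to the identity. The velocity of the first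
  factor is conjugated by the second factor, which in step two just adds
  \<open>C x' y\<close>.\<close>

lemma \<xi>_mul: "\<xi> (mul x y) (x' + y' + (1/2) *\<^sub>R (C x y' + C x' y)) = \<xi> x x' + \<xi> y y' + C x' y"
proof -
  have "(1/2) *\<^sub>R C x' y - (1/2) *\<^sub>R C y x' = C x' y"
    using C_antisym[of y x'] by (simp add: scaleR_add_left[symmetric])
  moreover have "\<xi> (mul x y) (x' + y' + (1/2) *\<^sub>R (C x y' + C x' y)) = \<xi> x x' + \<xi> y y' + ((1/2) *\<^sub>R C x' y - (1/2) *\<^sub>R C y x')"
    by (simp add: \<xi>_def mul_def C.add_left C.add_right C.scaleR_left C.scaleR_right C_C algebra_simps)
  ultimately show ?thesis by simp
qed

lemma \<xi>_left: "\<xi> (mul p x) (x' + (1/2) *\<^sub>R C p x') = \<xi> x x'"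
  using \<xi>_mul[of p x 0 x'] by (simp add: \<xi>_def C.zero_left C.zero_right)

lemma vel_mul:
  assumes f: "smooth_on {0..1} f" and h: "smooth_on {0..1} h" and t: "t \<in> {0..1}"
  shows "\<xi> (mul (f t) (h t)) (vel (\<lambda>t. mul (f t) (h t)) t) = \<xi> (f t) (vel f t) + \<xi> (h t) (vel h t) + C (vel f t) (h t)"
  using vel_eqI[OF mul_vector_derivative[OF smooth_vel(1)[OF f t] smooth_vel(1)[OF h t]] t] by (simp add: \<xi>_mul)

lemma line_smooth: "smooth_on S (\<lambda>t::real. t *\<^sub>R a)"
  by (intro smooth_on_scaleR smooth_on_id smooth_on_const)

lemma vel_line: "t \<in> {0..1} \<Longrightarrow> vel (\<lambda>t. t *\<^sub>R a) t = a"
  by (rule vel_eqI) (auto intro!: derivative_eq_intros)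

lemma \<xi>_line: "\<xi> (t *\<^sub>R a) a = a"
  by (simp add: \<xi>_def C.scaleR_left C_self)

subsection \<open>Dilations\<close>

definition dil :: "real \<Rightarrow> real^'n \<Rightarrow> real^'n"
  where "dil s x = (\<chi> i. if i \<in> J then s\<^sup>2 * x $ i else s * x $ i)"

lemma dil_linear: "bounded_linear (dil s)"
  unfolding linear_conv_bounded_linear[symmetric] by (rule linearI) (auto simp: dil_def vec_eq_iff algebra_simps)

lemma dil_C: "dil s (C x y) = s\<^sup>2 *\<^sub>R C x y"
  by (auto simp: dil_def vec_eq_iff C_range)

text \<open>Only the components outside \<open>J\<close> enter the bracket, and these are scaled by
  \<open>s\<close>. With \<open>dil_C\<close> this makes \<open>dil s\<close> an automorphism of the
  bracket.\<close>

lemma C_dil: "C (dil s x) y = s *\<^sub>R C x y" "C x (dil s y) = s *\<^sub>R C x y"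
proof -
  have "P (dil s x) = s *\<^sub>R P x" for x by (auto simp: dil_def P_def vec_eq_iff)
  then show "C (dil s x) y = s *\<^sub>R C x y" "C x (dil s y) = s *\<^sub>R C x y"
    by (metis C_P(1) C.scaleR_left) (metis C_P(2) C.scaleR_right \<open>\<And>x. P (dil s x) = s *\<^sub>R P x\<close>)
qed

lemma dil_\<xi>: "\<xi> (dil s x) (dil s v) = dil s (\<xi> x v)"
proof -
  interpret d: bounded_linear "dil s" by (rule dil_linear)
  show ?thesis by (simp add: \<xi>_def C_dil d.diff d.scaleR dil_C power2_eq_square)
qed

lemma dil_dil: "dil s (dil t x) = dil (s * t) x" and dil_1: "dil 1 x = x"
  by (auto simp: dil_def vec_eq_iff power2_eq_square)

lemma norm_dil_le: assumes "0 \<le> s" "s \<le> 1" shows "norm (dil s v) \<le> s * norm v"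
proof -
  have "norm (dil s v) \<le> norm (s *\<^sub>R v)"
  proof (rule norm_le_componentwise_cart)
    fix i
    have "s * (s * \<bar>v $ i\<bar>) \<le> 1 * (s * \<bar>v $ i\<bar>)" using assms by (intro mult_right_mono) auto
    then show "norm (dil s v $ i) \<le> norm ((s *\<^sub>R v) $ i)"
      using assms by (simp add: dil_def abs_mult power2_eq_square mult.assoc)
  qed
  then show ?thesis using assms by simp
qed

lemma coord_ball_dil: "coord_ball (2 * r) \<subseteq> dil 2 ` coord_ball r"
proof
  fix q assume "q \<in> coord_ball (2 * r)"
  then obtain \<gamma> where \<gamma>: "smooth_on {0..1} \<gamma>" "\<gamma> 0 = 0" "\<gamma> 1 = q" "len \<gamma> < 2 * r" by (auto simp: coord_ball_def)
  let ?h = "\<lambda>t. dil (1/2) (\<gamma> t)"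
  have h: "smooth_on {0..1} ?h" by (rule smooth_on_linear[OF dil_linear \<gamma>(1)])
  have v: "vel ?h t = dil (1/2) (vel \<gamma> t)" if "t \<in> {0..1}" for t
    by (rule vel_eqI[OF bounded_linear.has_vector_derivative[OF dil_linear smooth_vel(1)[OF \<gamma>(1) that]] that])
  have "len ?h \<le> integral {0..1} (\<lambda>t. (1/2) *\<^sub>R norm (\<xi> (\<gamma> t) (vel \<gamma> t)))"
    unfolding len_def
  proof (rule integral_le[OF speed_integrable[OF h] integrable_cmul[OF speed_integrable[OF \<gamma>(1)]]])
    fix t :: real assume "t \<in> {0..1}"
    then show "norm (\<xi> (?h t) (vel ?h t)) \<le> (1/2) *\<^sub>R norm (\<xi> (\<gamma> t) (vel \<gamma> t))"
      using norm_dil_le[of "1/2" "\<xi> (\<gamma> t) (vel \<gamma> t)"] by (simp add: v dil_\<xi>)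
  qed
  also have "\<dots> = (1/2) * len \<gamma>" unfolding len_def by simp
  finally have "len ?h < r" using \<gamma>(4) by simp
  moreover have "?h 0 = 0" using \<gamma>(2) by (simp add: dil_def vec_eq_iff)
  ultimately have "dil (1/2) q \<in> coord_ball r" using h \<gamma>(3) unfolding coord_ball_def by blast
  moreover have "q = dil 2 (dil (1/2) q)" by (simp add: dil_dil dil_1)
  ultimately show "q \<in> dil 2 ` coord_ball r" by blast
qed

definition Q :: nat where "Q = card (- J) + 2 * card J"

lemma emeasure_dil:
  assumes B: "B \<in> sets borel" and s: "s > 0"
  shows "dil s ` B \<in> sets borel" "emeasure lborel (dil s ` B) = ennreal (s ^ Q) * emeasure lborel B"
proof -
  have inv: "dil (1/s) (dil s x) = x" "dil s (dil (1/s) x) = x" for x using s by (simp_all add: dil_dil dil_1)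
  have im: "dil s ` B = dil (1/s) -` B" using inv by (auto simp: image_iff) metis
  have meas: "dil t \<in> borel_measurable borel" for t
    using bounded_linear.linear[OF dil_linear] by (intro borel_measurable_continuous_onI linear_continuous_on dil_linear)
  show 1: "dil s ` B \<in> sets borel" unfolding im using measurable_sets[OF meas B] by simp
  \<comment> \<open>The scaling factors are indexed by basis vectors, as
    \<open>lborel_affine_euclidean\<close> expects.\<close>
  define c where "c j = (if \<exists>i\<in>J. j = axis i 1 then s\<^sup>2 else s)" for j :: "real^'n"
  have ca: "c (axis i 1) = (if i \<in> J then s\<^sup>2 else s)" for i by (auto simp: c_def axis_eq_axis)
  have B': "(Basis :: (real^'n) set) = range (\<lambda>i. axis i 1)" by (auto simp: Basis_vec_def)
  have inj: "inj (\<lambda>i. axis i 1 :: real^'n)" by (auto simp: inj_on_def axis_eq_axis)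
  have dil_eq: "dil s = (\<lambda>x. 0 + (\<Sum>j\<in>Basis. (c j * (x \<bullet> j)) *\<^sub>R j))"
  proof (rule ext)
    fix x
    have "dil s x $ i = c (axis i 1) * (x \<bullet> axis i 1)" for i by (simp add: dil_def ca inner_axis)
    then show "dil s x = 0 + (\<Sum>j\<in>Basis. (c j * (x \<bullet> j)) *\<^sub>R j)"
      unfolding B' sum.reindex[OF inj] using vec_expand[of "dil s x"] by simp
  qed
  have "(\<Prod>j\<in>Basis. \<bar>c j\<bar>) = (\<Prod>i\<in>UNIV. if i \<in> J then s\<^sup>2 else s)"
    unfolding B' prod.reindex[OF inj] using s by (simp add: ca comp_def if_distrib cong: if_cong)
  also have "\<dots> = (\<Prod>i\<in>J. s\<^sup>2) * (\<Prod>i\<in>-J. s)"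
    by (subst prod.If_cases) simp_all
  also have "\<dots> = s ^ Q" by (simp add: Q_def power_add power_mult[symmetric] mult.commute)
  finally have prod: "(\<Prod>j\<in>Basis. \<bar>c j\<bar>) = s ^ Q" .
  have "c j \<noteq> 0" for j using s by (simp add: c_def)
  then have "lborel = density (distr lborel borel (dil s)) (\<lambda>_. ennreal (s ^ Q))"
    using lborel_affine_euclidean[of c 0] unfolding dil_eq prod by simp
  then have "emeasure lborel (dil s ` B) = emeasure (density (distr lborel borel (dil s)) (\<lambda>_. ennreal (s ^ Q))) (dil s ` B)" by metis
  also have "\<dots> = ennreal (s ^ Q) * emeasure (distr lborel borel (dil s)) (dil s ` B)"
    using 1 by (subst emeasure_density) (auto simp: nn_integral_cmult)
  also have "emeasure (distr lborel borel (dil s)) (dil s ` B) = emeasure lborel (dil s -` (dil s ` B))"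
    using meas 1 by (subst emeasure_distr) auto
  also have "dil s -` (dil s ` B) = B" using inv(1) by (metis inj_on_def inj_vimage_image_eq)
  finally show "emeasure lborel (dil s ` B) = ennreal (s ^ Q) * emeasure lborel B" .
qed

section \<open>Topology of the balls\<close>

lemma C_bound: obtains K where "K > 0" "\<And>x y. norm (C x y) \<le> norm x * norm y * K"
  using C.pos_bounded by blast

text \<open>If \<open>\<gamma>\<close> reaches \<open>q\<close>, then the product of
  \<open>\<gamma> t\<close> with \<open>t z\<close> reaches \<open>mul q z\<close>. The added length
  is at most \<open>norm z * (1 + M * K)\<close>, where \<open>M\<close> bounds the derivative of
  \<open>\<gamma>\<close> and \<open>K\<close> the bracket. The points \<open>mul q z\<close> with
  small \<open>z\<close> cover a neighbourhood of \<open>q\<close>.\<close>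

lemma open_coord_ball: "open (coord_ball r)"
  unfolding open_contains_ball
proof
  fix q assume "q \<in> coord_ball r"
  then obtain \<gamma> where \<gamma>: "smooth_on {0..1} \<gamma>" "\<gamma> 0 = 0" "\<gamma> 1 = q" "len \<gamma> < r" by (auto simp: coord_ball_def)
  obtain K where K: "K > 0" "\<And>x y. norm (C x y) \<le> norm x * norm y * K" using C_bound by blast
  have "bounded (vel \<gamma> ` {0..1})"
    by (rule compact_imp_bounded[OF compact_continuous_image[OF smooth_on_continuous[OF smooth_vel(2)[OF \<gamma>(1)]] compact_Icc]])
  then obtain M where M: "M > 0" "\<And>t. t \<in> {0..1} \<Longrightarrow> norm (vel \<gamma> t) \<le> M" by (auto simp: bounded_pos)
  define \<epsilon> where "\<epsilon> = (r - len \<gamma>) / (1 + M * K)"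
  have MK: "1 + M * K > 0" using M K by (simp add: add_pos_pos)
  have \<epsilon>: "\<epsilon> > 0" using \<gamma>(4) MK by (simp add: \<epsilon>_def)
  have near: "mul q z \<in> coord_ball r" if z: "norm z < \<epsilon>" for z
  proof -
    let ?h = "\<lambda>t. mul (\<gamma> t) (t *\<^sub>R z)"
    have h: "smooth_on {0..1} ?h" by (rule mul_smooth[OF \<gamma>(1) line_smooth])
    have "len ?h \<le> integral {0..1} (\<lambda>t. norm (\<xi> (\<gamma> t) (vel \<gamma> t)) + norm z * (1 + M * K))"
      unfolding len_def
    proof (rule integral_le[OF speed_integrable[OF h] integrable_add[OF speed_integrable[OF \<gamma>(1)] integrable_const_ivl]])
      fix t :: real assume t: "t \<in> {0..1}"
      have "norm (\<xi> (?h t) (vel ?h t)) \<le> norm (\<xi> (\<gamma> t) (vel \<gamma> t)) + norm z + norm (C (vel \<gamma> t) (t *\<^sub>R z))"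
        unfolding vel_mul[OF \<gamma>(1) line_smooth t] vel_line[OF t] \<xi>_line by (intro norm_triangle_le add_mono order_refl norm_triangle_ineq)
      also have "norm (C (vel \<gamma> t) (t *\<^sub>R z)) \<le> norm (vel \<gamma> t) * norm (t *\<^sub>R z) * K" by (rule K(2))
      also have "\<dots> \<le> M * norm z * K"
      proof (intro mult_right_mono mult_mono)
        show "norm (t *\<^sub>R z) \<le> norm z" using t mult_right_mono[of t 1 "norm z"] by simp
      qed (use M t K in auto)
      finally show "norm (\<xi> (?h t) (vel ?h t)) \<le> norm (\<xi> (\<gamma> t) (vel \<gamma> t)) + norm z * (1 + M * K)"
        by (simp add: algebra_simps)
    qed
    also have "\<dots> = len \<gamma> + norm z * (1 + M * K)"
      unfolding len_def by (subst integral_add[OF speed_integrable[OF \<gamma>(1)] integrable_const_ivl]) simp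
    also have "\<dots> < r"
    proof -
      have "norm z * (1 + M * K) < \<epsilon> * (1 + M * K)" using z MK by simp
      also have "\<dots> = r - len \<gamma>" using MK by (simp add: \<epsilon>_def)
      finally show ?thesis by simp
    qed
    finally have "len ?h < r" .
    moreover have "?h 0 = 0" "?h 1 = mul q z" using \<gamma>(2,3) by (simp_all add: mul_0)
    ultimately show ?thesis using h unfolding coord_ball_def by blast
  qed
  have "continuous_on UNIV (\<lambda>y. mul (- q) y)"
    by (rule smooth_on_continuous[OF mul_smooth[OF smooth_on_const smooth_on_id]])
  then have "isCont (\<lambda>y. mul (- q) y) q" by (simp add: continuous_on_eq_continuous_at)
  then obtain d where d: "d > 0" "\<And>y. dist y q < d \<Longrightarrow> dist (mul (- q) y) (mul (- q) q) < \<epsilon>"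
    unfolding continuous_at_eps_delta using \<epsilon> by blast
  have "ball q d \<subseteq> coord_ball r"
  proof
    fix y assume "y \<in> ball q d"
    then have "norm (mul (- q) y) < \<epsilon>" using d(2)[of y] by (simp add: mul_minus dist_commute)
    from near[OF this] show "y \<in> coord_ball r" by (simp add: mul_assoc[symmetric] mul_minus mul_0)
  qed
  then show "\<exists>e>0. ball q e \<subseteq> coord_ball r" using d(1) by blast
qed

text \<open>As \<open>P\<close> kills brackets, \<open>P \<gamma>\<close> has velocity
  \<open>P \<xi>\<close> and is bounded by the length. The bracket term in the full velocity only
  involves \<open>P \<gamma>\<close> and \<open>P \<xi>\<close>, so the full velocity is at most a
  constant times the speed. Boundedness serves to make the volumes finite.\<close>

lemma bounded_coord_ball: "bounded (coord_ball r)"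
proof -
  obtain K where K: "K > 0" "\<And>x y. norm (C x y) \<le> norm x * norm y * K" using C_bound by blast
  have "norm q \<le> (1 + r * K) * r" if "q \<in> coord_ball r" for q
  proof -
    obtain \<gamma> where \<gamma>: "smooth_on {0..1} \<gamma>" "\<gamma> 0 = 0" "\<gamma> 1 = q" "len \<gamma> < r" using \<open>q \<in> coord_ball r\<close> by (auto simp: coord_ball_def)
    have r: "r > 0" using \<gamma>(4) len_nonneg[of \<gamma>] by linarith
    let ?s = "\<lambda>t. norm (\<xi> (\<gamma> t) (vel \<gamma> t))"
    note si = speed_integrable[OF \<gamma>(1)]
    note dv = smooth_vel(1)[OF \<gamma>(1)]
    have Pv: "P (vel \<gamma> t) = P (\<xi> (\<gamma> t) (vel \<gamma> t))" for t by (simp add: \<xi>_def P.diff P.scaleR P_C)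
    have nP: "norm (P x) \<le> norm x" for x by (rule norm_le_componentwise_cart) (simp add: P_def)
    have P\<gamma>: "norm (P (\<gamma> s)) \<le> r" if s: "s \<in> {0..1}" for s
    proof -
      have sub: "{0..s} \<subseteq> {0..1}" using s by auto
      have "norm (P (\<gamma> s) - P (\<gamma> 0)) \<le> integral {0..s} ?s"
      proof (rule norm_increment_le)
        fix t assume t: "t \<in> {0..s}"
        have "(\<gamma> has_vector_derivative vel \<gamma> t) (at t within {0..s})"
          using has_vector_derivative_within_subset[OF dv sub] t sub by blast
        then show "((\<lambda>t. P (\<gamma> t)) has_vector_derivative P (vel \<gamma> t)) (at t within {0..s})"
          by (rule bounded_linear.has_vector_derivative[OF P_linear])
        show "norm (P (vel \<gamma> t)) \<le> ?s t" unfolding Pv by (rule nP)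
      qed (use s integrable_on_subinterval[OF si sub] in auto)
      also have "\<dots> \<le> integral {0..1} ?s"
        by (rule integral_subset_le[OF sub integrable_on_subinterval[OF si sub] si]) simp
      also have "\<dots> \<le> r" using \<gamma>(4) by (simp add: len_def)
      finally show ?thesis using \<gamma>(2) by (simp add: P.zero)
    qed
    have "norm (\<gamma> 1 - \<gamma> 0) \<le> integral {0..1} (\<lambda>t. (1 + r * K) *\<^sub>R ?s t)"
    proof (rule norm_increment_le[OF dv])
      fix t :: real assume t: "t \<in> {0..1}"
      have "vel \<gamma> t = \<xi> (\<gamma> t) (vel \<gamma> t) + (1/2) *\<^sub>R C (P (\<gamma> t)) (P (\<xi> (\<gamma> t) (vel \<gamma> t)))"
        by (simp add: Pv[symmetric] C_P) (simp add: \<xi>_def)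
      then have "norm (vel \<gamma> t) \<le> ?s t + norm ((1/2) *\<^sub>R C (P (\<gamma> t)) (P (\<xi> (\<gamma> t) (vel \<gamma> t))))" by (metis norm_triangle_ineq)
      also have "norm ((1/2) *\<^sub>R C (P (\<gamma> t)) (P (\<xi> (\<gamma> t) (vel \<gamma> t)))) \<le> norm (C (P (\<gamma> t)) (P (\<xi> (\<gamma> t) (vel \<gamma> t))))" by simp
      also have "\<dots> \<le> norm (P (\<gamma> t)) * norm (P (\<xi> (\<gamma> t) (vel \<gamma> t))) * K" by (rule K(2))
      also have "\<dots> \<le> r * ?s t * K" by (intro mult_right_mono mult_mono P\<gamma>[OF t] nP) (use K r in auto)
      finally show "norm (vel \<gamma> t) \<le> (1 + r * K) *\<^sub>R ?s t" by (simp add: algebra_simps)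
    qed (use integrable_cmul[OF si] in auto)
    also have "\<dots> = (1 + r * K) * len \<gamma>" unfolding len_def by simp
    also have "\<dots> \<le> (1 + r * K) * r" using \<gamma>(4) r K by (intro mult_left_mono) auto
    finally show ?thesis using \<gamma> by simp
  qed
  then show ?thesis unfolding bounded_iff by blast
qed

subsection \<open>Reachability with bounded speed\<close>

text \<open>A pointwise bound on the speed bounds the length as well, and it is simple to follow
  through a reparametrisation.\<close>

definition reach :: "real \<Rightarrow> real^'n \<Rightarrow> bool"
  where "reach c q \<longleftrightarrow> (\<exists>\<gamma>. smooth_on {0..1} \<gamma> \<and> \<gamma> 0 = 0 \<and> \<gamma> 1 = q \<and> (\<forall>t\<in>{0..1}. norm (\<xi> (\<gamma> t) (vel \<gamma> t)) \<le> c))"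

lemma reach_mono: "reach c q \<Longrightarrow> c \<le> c' \<Longrightarrow> reach c' q"
  unfolding reach_def by (elim exE conjE, intro exI conjI, assumption+) (auto intro: order_trans)

lemma reach_coord_ball: assumes "reach c q" "c < r" shows "q \<in> coord_ball r"
proof -
  obtain \<gamma> where \<gamma>: "smooth_on {0..1} \<gamma>" "\<gamma> 0 = 0" "\<gamma> 1 = q" "\<forall>t\<in>{0..1}. norm (\<xi> (\<gamma> t) (vel \<gamma> t)) \<le> c"
    using assms(1) reach_def by blast
  have "len \<gamma> \<le> integral {0..1::real} (\<lambda>t. c)"
    unfolding len_def by (rule integral_le[OF speed_integrable[OF \<gamma>(1)]]) (use \<gamma>(4) in auto)
  then show ?thesis using \<gamma> assms(2) unfolding coord_ball_def by force
qed

lemma reach_line: "reach (norm a) a"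
  unfolding reach_def by (intro exI[of _ "\<lambda>t. t *\<^sub>R a"]) (auto simp: line_smooth vel_line \<xi>_line)

text \<open>The concatenation is the product of the two reparametrised paths. The smooth step is
  stationary outside \<open>[0, 1]\<close>, so one factor rests while the other moves.\<close>

lemma reach_mul: "\<exists>K\<ge>1. \<forall>c1 c2 p q. reach c1 p \<longrightarrow> reach c2 q \<longrightarrow> reach (K * (c1 + c2)) (mul p q)"
proof -
  have step: "smooth_on {0..1} (\<lambda>t::real. smooth_step (2 * t + b))" for b
    by (rule smooth_on_compose[OF smooth_on_smooth_step]) (auto intro!: smooth_on_add smooth_on_mult smooth_on_const smooth_on_id)
  have "bounded (vel (\<lambda>t::real. smooth_step (2 * t + b)) ` {0..1})" for b
    by (rule compact_imp_bounded[OF compact_continuous_image[OF smooth_on_continuous[OF smooth_vel(2)[OF step]] compact_Icc]])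
  then obtain M where M: "\<And>b t. t \<in> {0..1} \<Longrightarrow> \<bar>vel (\<lambda>t::real. smooth_step (2 * t + b)) t\<bar> \<le> M b"
    unfolding bounded_iff by (metis imageI real_norm_def)
  \<comment> \<open>The shifts 0 and -1 are those of the two reparametrisations, and
    \<open>K\<close> bounds the speed of both.\<close>
  define K where "K = max 1 (max (M 0) (M (-1)))"
  have "reach (K * (c1 + c2)) (mul p q)" if r1: "reach c1 p" and r2: "reach c2 q" for c1 c2 p q
  proof -
    obtain f where f: "smooth_on {0..1} f" "f 0 = 0" "f 1 = p" "\<forall>t\<in>{0..1}. norm (\<xi> (f t) (vel f t)) \<le> c1"
      using r1 reach_def by blast
    obtain h where h: "smooth_on {0..1} h" "h 0 = 0" "h 1 = q" "\<forall>t\<in>{0..1}. norm (\<xi> (h t) (vel h t)) \<le> c2"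
      using r2 reach_def by blast
    have sm: "smooth_on {0..1} (\<lambda>t. f (smooth_step (2 * t + b)))" if "smooth_on {0..1} f" for f :: "real \<Rightarrow> real^'n" and b
      by (rule smooth_on_compose[OF that step]) (auto simp: smooth_step_range)
    have vl: "vel (\<lambda>t. f (smooth_step (2 * t + b))) t = vel (\<lambda>t. smooth_step (2 * t + b)) t *\<^sub>R vel f (smooth_step (2 * t + b))"
      if f: "smooth_on {0..1} f" and t: "t \<in> {0..1}" for f :: "real \<Rightarrow> real^'n" and b t
    proof (rule vel_eqI[OF _ t])
      let ?s = "\<lambda>t. smooth_step (2 * t + b)"
      have s01: "?s t \<in> {0..1}" for t by (simp add: smooth_step_range)
      have "(f has_vector_derivative vel f (?s t)) (at (?s t) within ?s ` {0..1})"
        by (rule has_vector_derivative_within_subset[OF smooth_vel(1)[OF f s01]]) (use s01 in blast)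
      from vector_diff_chain_within[OF smooth_vel(1)[OF step t] this]
      show "((\<lambda>t. f (?s t)) has_vector_derivative vel ?s t *\<^sub>R vel f (?s t)) (at t within {0..1})" by (simp add: comp_def)
    qed
    let ?f = "\<lambda>t. f (smooth_step (2 * t + 0))" and ?h = "\<lambda>t. h (smooth_step (2 * t + (-1)))"
    have bnd: "norm (\<xi> (f (smooth_step (2 * t + b))) (vel (\<lambda>t. f (smooth_step (2 * t + b))) t)) \<le> K * c"
      if f: "smooth_on {0..1} f" "\<forall>t\<in>{0..1}. norm (\<xi> (f t) (vel f t)) \<le> c" and t: "t \<in> {0..1}" and b: "b = 0 \<or> b = -1" for f c t b
    proof -
      let ?s = "smooth_step (2 * t + b)"
      have "\<bar>vel (\<lambda>t. smooth_step (2 * t + b)) t\<bar> \<le> K" using M[OF t, of b] b by (auto simp: K_def)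
      moreover have "norm (\<xi> (f ?s) (vel f ?s)) \<le> c" using f(2) by (simp add: smooth_step_range)
      moreover have "\<xi> (f ?s) (a *\<^sub>R v) = a *\<^sub>R \<xi> (f ?s) v" for a v by (simp add: \<xi>_def C.scaleR_right algebra_simps)
      ultimately show ?thesis unfolding vl[OF f(1) t] by (simp add: mult_mono)
    qed
    have fh: "smooth_on {0..1} (\<lambda>t. mul (?f t) (?h t))" by (rule mul_smooth[OF sm[OF f(1)] sm[OF h(1)]])
    have "norm (\<xi> (mul (?f t) (?h t)) (vel (\<lambda>t. mul (?f t) (?h t)) t)) \<le> K * (c1 + c2)" if t: "t \<in> {0..1}" for t
    proof -
      have "C (vel ?f t) (?h t) = 0"
      proof (cases "t \<le> 1/2")
        case True
        then have "?h t = 0" using h(2) by (simp add: smooth_step_le_0)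
        then show ?thesis by (simp add: C.zero_right)
      next
        case False
        have "((\<lambda>t::real. 1) has_vector_derivative (0::real)) (at t)" by simp
        then have "((\<lambda>t::real. smooth_step (2 * t + 0)) has_vector_derivative 0) (at t)"
          by (rule has_vector_derivative_transform_within_open[of _ _ _ "{1/2<..}"]) (use False in \<open>auto simp: smooth_step_ge_1\<close>)
        then have "vel (\<lambda>t. smooth_step (2 * t + 0)) t = 0"
          by (rule vel_eqI[OF has_vector_derivative_at_within t])
        then show ?thesis unfolding vl[OF f(1) t] by (simp add: C.zero_left)
      qed
      then have "\<xi> (mul (?f t) (?h t)) (vel (\<lambda>t. mul (?f t) (?h t)) t) = \<xi> (?f t) (vel ?f t) + \<xi> (?h t) (vel ?h t)"
        unfolding vel_mul[OF sm[OF f(1)] sm[OF h(1)] t] by simp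
      then have "norm (\<xi> (mul (?f t) (?h t)) (vel (\<lambda>t. mul (?f t) (?h t)) t)) \<le> K * c1 + K * c2"
        by (simp only:) (rule norm_triangle_le[OF add_mono[OF bnd[OF f(1,4) t] bnd[OF h(1,4) t]]]; simp)
      then show ?thesis by (simp add: distrib_left)
    qed
    moreover have "mul (?f 0) (?h 0) = 0" "mul (?f 1) (?h 1) = mul p q"
      using f(2,3) h(2,3) by (simp_all add: smooth_step_le_0 smooth_step_ge_1 mul_0)
    ultimately show ?thesis unfolding reach_def using fh by blast
  qed
  then show ?thesis by (intro exI[of _ K]) (simp add: K_def)
qed

definition unit_cube :: "(real^'n) set" where "unit_cube = {q. \<forall>i. \<bar>q $ i\<bar> \<le> 1}"

text \<open>Reachability at a cost of order \<open>R\<close>, uniformly over the unit cube. The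
  class is closed under products, so \<open>dil\<close> can be assembled from simple
  factors.\<close>

definition reach_family :: "(real \<Rightarrow> real^'n \<Rightarrow> real^'n) \<Rightarrow> bool"
  where "reach_family F \<longleftrightarrow> (\<exists>c\<ge>0. \<forall>R\<ge>1. \<forall>q\<in>unit_cube. reach (c * R) (F R q))"

lemma reach_family_mul:
  assumes "reach_family F" "reach_family G" shows "reach_family (\<lambda>R q. mul (F R q) (G R q))"
proof -
  obtain K where K: "K \<ge> 1" "\<And>c1 c2 p q. reach c1 p \<Longrightarrow> reach c2 q \<Longrightarrow> reach (K * (c1 + c2)) (mul p q)"
    using reach_mul by blast
  obtain c d where c: "c \<ge> 0" "\<And>R q. R \<ge> 1 \<Longrightarrow> q \<in> unit_cube \<Longrightarrow> reach (c * R) (F R q)"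
    and d: "d \<ge> 0" "\<And>R q. R \<ge> 1 \<Longrightarrow> q \<in> unit_cube \<Longrightarrow> reach (d * R) (G R q)"
    using assms unfolding reach_family_def by blast
  have "reach ((K * (c + d)) * R) (mul (F R q) (G R q))" if "R \<ge> 1" "q \<in> unit_cube" for R q
    using K(2)[OF c(2)[OF that] d(2)[OF that]] by (simp add: algebra_simps)
  moreover have "K * (c + d) \<ge> 0" using K c d by simp
  ultimately show ?thesis unfolding reach_family_def by blast
qed

lemma reach_family_line:
  assumes "\<And>R q. R \<ge> 1 \<Longrightarrow> q \<in> unit_cube \<Longrightarrow> norm (F R q) \<le> c * R"
  shows "reach_family F"
proof -
  have "reach (max 0 c * R) (F R q)" if "R \<ge> 1" "q \<in> unit_cube" for R q
  proof (rule reach_mono[OF reach_line])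
    have "c * R \<le> max 0 c * R" using that by (intro mult_right_mono) auto
    then show "norm (F R q) \<le> max 0 c * R" using assms[OF that] by linarith
  qed
  then show ?thesis unfolding reach_family_def by (intro exI[of _ "max 0 c"]) auto
qed

lemma mul_commutator: "mul (mul x y) (mul (- x) (- y)) = C x y"
proof -
  define z where "z = x + y"
  define h where "h = (1/2) *\<^sub>R C x y"
  have h: "C h a = 0" "C a h = 0" for a by (simp_all add: h_def C.scaleR_left C.scaleR_right C_C)
  have "mul x y = z + h" "mul (- x) (- y) = - z + h"
    by (simp_all add: mul_def z_def h_def C.minus_left C.minus_right)
  moreover have "mul (z + h) (- z + h) = h + h"
    unfolding mul_def C.add_left C.add_right C.minus_right C_self h by simp
  moreover have "h + h = C x y" by (simp add: h_def scaleR_add_left[symmetric])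
  ultimately show ?thesis by simp
qed

text \<open>A second-layer displacement of size \<open>R\<^sup>2\<close> costs only order
  \<open>R\<close>, being built from commutators of elements whose size is of order
  \<open>R\<close>. This is the source of the weight 2 of the second layer in \<open>Q\<close>.
  Centrality is proved along with it, since it turns the product of the contributions into their
  sum.\<close>

lemma reach_family_central:
  assumes "v \<in> span (range (\<lambda>(a, b). C a b))"
  shows "(\<forall>y. C v y = 0) \<and> reach_family (\<lambda>R q. (R\<^sup>2 * q $ j) *\<^sub>R v)"
  using assms
proof (induction v rule: span_induct_alt)
  case base
  have "reach_family (\<lambda>R q. 0)" by (rule reach_family_line[of _ 0]) simp
  then show ?case by (simp add: C.zero_left)
next
  case (step r x y)
  then obtain a b where x: "x = C a b" by auto
  \<comment> \<open>The commutator is bilinear, so the whole coefficient \<open>q $ j * r\<close>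
    can be put into the first factor.\<close>
  let ?X = "\<lambda>R q. (R * q $ j * r) *\<^sub>R a" and ?Y = "\<lambda>(R::real) (q::real^'n). R *\<^sub>R b"
  have X: "reach_family (\<lambda>R q. s *\<^sub>R ?X R q)" if "\<bar>s\<bar> = 1" for s
  proof (rule reach_family_line[of _ "\<bar>r\<bar> * norm a"])
    fix R :: real and q :: "real^'n" assume R: "R \<ge> 1" and q: "q \<in> unit_cube"
    have "\<bar>q $ j\<bar> * (R * \<bar>r\<bar> * norm a) \<le> 1 * (R * \<bar>r\<bar> * norm a)"
      using q R by (intro mult_right_mono) (auto simp: unit_cube_def)
    then show "norm (s *\<^sub>R ?X R q) \<le> \<bar>r\<bar> * norm a * R" using R that by (simp add: abs_mult mult_ac)
  qed
  have Y: "reach_family (\<lambda>R q. s *\<^sub>R ?Y R q)" if "\<bar>s\<bar> = 1" for s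
    by (rule reach_family_line[of _ "norm b"]) (use that in \<open>simp add: abs_mult\<close>)
  have "reach_family (\<lambda>R q. mul (mul (1 *\<^sub>R ?X R q) (1 *\<^sub>R ?Y R q)) (mul ((-1) *\<^sub>R ?X R q) ((-1) *\<^sub>R ?Y R q)))"
    by (intro reach_family_mul X Y) simp_all
  moreover have "mul (mul (1 *\<^sub>R ?X R q) (1 *\<^sub>R ?Y R q)) (mul ((-1) *\<^sub>R ?X R q) ((-1) *\<^sub>R ?Y R q)) = (R\<^sup>2 * q $ j) *\<^sub>R r *\<^sub>R x" for R q
    using mul_commutator[of "?X R q" "?Y R q"] by (simp add: x C.scaleR_left C.scaleR_right power2_eq_square mult_ac)
  ultimately have "reach_family (\<lambda>R q. (R\<^sup>2 * q $ j) *\<^sub>R r *\<^sub>R x)" by simp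
  then have "reach_family (\<lambda>R q. mul ((R\<^sup>2 * q $ j) *\<^sub>R r *\<^sub>R x) ((R\<^sup>2 * q $ j) *\<^sub>R y))"
    by (rule reach_family_mul) (use step in blast)
  moreover have cx: "C (r *\<^sub>R x) z = 0" for z by (simp add: x C.scaleR_left C_C)
  moreover have "mul ((R\<^sup>2 * q $ j) *\<^sub>R r *\<^sub>R x) ((R\<^sup>2 * q $ j) *\<^sub>R y) = (R\<^sup>2 * q $ j) *\<^sub>R (r *\<^sub>R x + y)" for R q
    using cx by (simp add: mul_def C.scaleR_left scaleR_add_right)
  ultimately show ?case using step cx by (simp add: C.add_left)
qed

text \<open>\<open>dil R q\<close> is the product of \<open>R *\<^sub>R P q\<close> with the
  multiples \<open>R\<^sup>2 * q $ j\<close> of the basis vectors for \<open>j\<close> in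
  \<open>J\<close>. The latter are central, so these products are plain sums.\<close>

lemma reach_dil:
  assumes span: "\<And>j. j \<in> J \<Longrightarrow> axis j 1 \<in> span (range (\<lambda>(a, b). C a b))"
  shows "reach_family dil"
proof -
  let ?G = "\<lambda>I R (q::real^'n). \<Sum>j\<in>I. (R\<^sup>2 * q $ j) *\<^sub>R (axis j 1 :: real^'n)"
  have "reach_family (?G I)" if "I \<subseteq> J" for I
    using finite[of I] that
  proof (induction I rule: finite_induct)
    case empty
    show ?case by (rule reach_family_line[of _ 0]) simp
  next
    case (insert j I)
    have c: "C (axis j 1) z = 0" for z using reach_family_central[OF span] insert by blast
    have "reach_family (\<lambda>R q. mul ((R\<^sup>2 * q $ j) *\<^sub>R axis j 1) (?G I R q))"
      using insert reach_family_central[OF span] by (intro reach_family_mul) auto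
    moreover have "mul ((R\<^sup>2 * q $ j) *\<^sub>R axis j 1) (?G I R q) = ?G (insert j I) R q" for R q
      using insert c by (simp add: mul_def C.scaleR_left)
    ultimately show ?case by simp
  qed
  then have G: "reach_family (?G J)" by blast
  have "reach_family (\<lambda>R q. R *\<^sub>R P q)"
  \<comment> \<open>On the unit cube the l1 norm, which bounds the Euclidean norm, is at most the
    number of coordinates.\<close>
  proof (rule reach_family_line[of _ "real CARD('n)"])
    fix R :: real and q :: "real^'n" assume R: "R \<ge> 1" and q: "q \<in> unit_cube"
    have "norm (P q) \<le> (\<Sum>i\<in>UNIV. \<bar>P q $ i\<bar>)" by (rule norm_le_l1_cart)
    also have "\<dots> \<le> (\<Sum>i\<in>(UNIV::'n set). 1)" by (rule sum_mono) (use q in \<open>simp add: P_def unit_cube_def\<close>)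
    finally show "norm (R *\<^sub>R P q) \<le> real CARD('n) * R" using R by (simp add: mult.commute mult_left_mono)
  qed
  from reach_family_mul[OF this G]
  have "reach_family (\<lambda>R q. mul (R *\<^sub>R P q) (?G J R q))" .
  moreover have "mul (R *\<^sub>R P q) (?G J R q) = dil R q" for R q
  proof -
    have "C z (?G J R q) = 0" for z
    proof -
      have "C (?G J R q) z = 0"
        by (rule C_center) (auto simp: axis_def if_distrib cong: if_cong)
      then show ?thesis using C_antisym[of z] by simp
    qed
    then show ?thesis by (auto simp: mul_def dil_def P_def vec_eq_iff axis_def if_distrib cong: if_cong)
  qed
  ultimately show ?thesis by simp
qed

section \<open>Volume growth of the balls\<close>

lemma volume_lower_bound:
  assumes span: "\<And>j. j \<in> J \<Longrightarrow> axis j 1 \<in> span (range (\<lambda>(a, b). C a b))"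
  obtains c where "c > 0" "\<And>R. R \<ge> 1 \<Longrightarrow> emeasure lborel (coord_ball (c * R)) \<ge> ennreal (R ^ Q)"
proof -
  obtain c where c: "c \<ge> 0" "\<And>R q. R \<ge> 1 \<Longrightarrow> q \<in> unit_cube \<Longrightarrow> reach (c * R) (dil R q)"
    using reach_dil[OF span] unfolding reach_family_def by blast
  \<comment> \<open>\<open>coord_ball\<close> is defined by a strict inequality, hence the radius
    \<open>c + 1\<close> in place of \<open>c\<close>. This also makes the constant
    positive.\<close>
  have "emeasure lborel (coord_ball ((c + 1) * R)) \<ge> ennreal (R ^ Q)" if R: "R \<ge> 1" for R
  proof -
    let ?B = "cbox (0::real^'n) One"
    have "?B \<subseteq> unit_cube" by (auto simp: unit_cube_def mem_box_cart cart_eq_inner_axis)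
    then have "dil R ` ?B \<subseteq> coord_ball ((c + 1) * R)"
      using c(2)[OF R] reach_coord_ball[of "c * R" _ "(c + 1) * R"] R by (auto simp: algebra_simps)
    then have "emeasure lborel (dil R ` ?B) \<le> emeasure lborel (coord_ball ((c + 1) * R))"
      by (rule emeasure_mono) (use open_coord_ball in auto)
    moreover have "emeasure lborel (dil R ` ?B) = ennreal (R ^ Q) * emeasure lborel ?B"
      by (rule emeasure_dil(2)) (use R in auto)
    moreover have "emeasure lborel ?B = 1" by (simp add: emeasure_lborel_cbox_eq)
    ultimately show ?thesis by simp
  qed
  then show ?thesis using that[of "c + 1"] c(1) by simp
qed

lemma volume_upper_bound: "emeasure lborel (coord_ball (2 * r)) \<le> 2 ^ Q * emeasure lborel (coord_ball r)"
proof -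
  have B: "coord_ball r \<in> sets borel" by (rule borel_open[OF open_coord_ball])
  have "emeasure lborel (coord_ball (2 * r)) \<le> emeasure lborel (dil 2 ` coord_ball r)"
    by (rule emeasure_mono[OF coord_ball_dil]) (use emeasure_dil(1)[OF B] in simp)
  also have "\<dots> = ennreal (2 ^ Q) * emeasure lborel (coord_ball r)" by (rule emeasure_dil(2)[OF B]) simp
  also have "ennreal (2 ^ Q) = 2 ^ Q" by (simp add: ennreal_power[symmetric])
  finally show ?thesis .
qed

lemma volume_ratio_sup:
  assumes span: "\<And>j. j \<in> J \<Longrightarrow> axis j 1 \<in> span (range (\<lambda>(a, b). C a b))"
    and s: "\<And>r. r > 0 \<Longrightarrow> emeasure lborel (coord_ball (2 * r)) / emeasure lborel (coord_ball r) \<le> s"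
  shows "2 ^ Q \<le> s"
proof (rule ccontr)
  assume "\<not> 2 ^ Q \<le> s"
  then have less: "s < 2 ^ Q" by simp
  have p2: "(2::ennreal) ^ Q = ennreal (2 ^ Q)" by (simp add: ennreal_power[symmetric])
  then obtain \<sigma> where \<sigma>: "\<sigma> \<ge> 0" "s = ennreal \<sigma>" using less by (cases s) auto
  have \<sigma>2: "\<sigma> < 2 ^ Q" using less unfolding p2 \<sigma>(2) using \<sigma>(1) by (simp add: ennreal_less_iff)
  obtain c where c: "c > 0" "\<And>R. R \<ge> 1 \<Longrightarrow> emeasure lborel (coord_ball (c * R)) \<ge> ennreal (R ^ Q)"
    by (rule volume_lower_bound[OF span]; (assumption | (rule that; assumption)))
  have fin: "emeasure lborel (coord_ball r) < \<infinity>" for r by (rule emeasure_bounded_finite[OF bounded_coord_ball])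
  define v where "v r = measure lborel (coord_ball r)" for r
  have v: "emeasure lborel (coord_ball r) = ennreal (v r)" for r
    unfolding v_def using fin by (simp add: emeasure_eq_ennreal_measure less_top[symmetric])
  have v0: "v r \<ge> 0" for r by (simp add: v_def)
  have lower: "R ^ Q \<le> v (c * R)" if "R \<ge> 1" for R using c(2)[OF that] v0 by (simp add: v)
  have step: "v (2 * r) \<le> \<sigma> * v r" if r: "r > 0" "v r > 0" for r
  proof -
    have "ennreal (v (2 * r)) / ennreal (v r) \<le> ennreal \<sigma>" using s[OF r(1)] by (simp add: v \<sigma>)
    then have "v (2 * r) / v r \<le> \<sigma>" using r v0 \<sigma>(1) by (simp add: divide_ennreal)
    then show ?thesis using r by (simp add: field_simps)
  qed
  \<comment> \<open>The lower bound keeps every volume in the iteration positive, so the quotient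
    can be cleared.\<close>
  have pos: "v (c * 2 ^ j) > 0" for j :: nat
  proof -
    have "(1::real) \<le> 2 ^ j" "(1::real) \<le> (2 ^ j) ^ Q" by simp_all
    then show ?thesis using lower[of "2 ^ j"] by linarith
  qed
  have iter: "v (c * 2 ^ j) \<le> \<sigma> ^ j * v c" for j :: nat
  proof (induction j)
    case (Suc j)
    have "v (c * 2 ^ Suc j) \<le> \<sigma> * v (c * 2 ^ j)" using step[of "c * 2 ^ j"] c(1) pos by (simp add: mult_ac)
    also have "\<dots> \<le> \<sigma> * (\<sigma> ^ j * v c)" by (rule mult_left_mono[OF Suc \<sigma>(1)])
    finally show ?case by simp
  qed simp
  have bnd: "(2 ^ Q) ^ j \<le> \<sigma> ^ j * v c" for j :: nat
    using lower[of "2 ^ j"] iter[of j] by (simp add: power_mult[symmetric] mult.commute)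
  have "(2::real) ^ Q > 0" by simp
  have "\<sigma> \<noteq> 0"
  proof
    assume "\<sigma> = 0"
    then have "2 ^ Q \<le> (0::real)" using bnd[of 1] by simp
    then show False using \<open>(2::real) ^ Q > 0\<close> by linarith
  qed
  then have "\<sigma> > 0" using \<sigma>(1) by simp
  then have "1 < 2 ^ Q / \<sigma>" using \<sigma>2 by simp
  then obtain j where "v c < (2 ^ Q / \<sigma>) ^ j" using real_arch_pow by blast
  then have "v c * \<sigma> ^ j < (2 ^ Q) ^ j" using \<open>\<sigma> > 0\<close> by (simp add: power_divide field_simps)
  then show False using bnd[of j] by (simp add: mult.commute)
qed

end

section \<open>Change of variables\<close>

text \<open>The change of variables theorem of the library requires a well-ordered index type. Any finite
  type is in bijection with the following one.\<close>

typedef ('n::finite) windex = "{..<CARD('n)}"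
  by (rule exI[of _ 0]) simp

instantiation windex :: (finite) wellorder
begin

definition less_eq_windex :: "'a windex \<Rightarrow> 'a windex \<Rightarrow> bool"
  where "less_eq_windex x y \<longleftrightarrow> Rep_windex x \<le> Rep_windex y"

definition less_windex :: "'a windex \<Rightarrow> 'a windex \<Rightarrow> bool"
  where "less_windex x y \<longleftrightarrow> Rep_windex x < Rep_windex y"

instance
proof
  fix P :: "'a windex \<Rightarrow> bool" and a
  assume step: "\<And>x. (\<And>y. y < x \<Longrightarrow> P y) \<Longrightarrow> P x"
  show "P a"
    by (induction a rule: measure_induct_rule[of Rep_windex]) (rule step, simp add: less_windex_def)
qed (auto simp: less_eq_windex_def less_windex_def Rep_windex_inject)

end

instance windex :: (finite) finite
proof
  have "inj_on (Rep_windex :: 'a windex \<Rightarrow> nat) UNIV" by (simp add: inj_on_def Rep_windex_inject)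
  moreover have "finite (range (Rep_windex :: 'a windex \<Rightarrow> nat))"
    by (rule finite_subset[of _ "{..<CARD('a)}"]) (use Rep_windex in auto)
  ultimately show "finite (UNIV :: 'a windex set)" using finite_image_iff by blast
qed

lemma windex_bij: obtains f :: "('n::finite) windex \<Rightarrow> 'n" where "bij f"
proof -
  have "card (UNIV :: 'n windex set) = CARD('n)"
    using type_definition.card[OF type_definition_windex[where 'n='n]] by simp
  then obtain f where "bij_betw f (UNIV :: 'n windex set) (UNIV :: 'n set)"
    using finite_same_card_bij[OF finite_class.finite_UNIV finite_class.finite_UNIV] by metis
  then show ?thesis using that by blast
qed

text \<open>Conjugation by \<open>f\<close> matches the permutations of the two index types and
  preserves their signs, so the Leibniz sums agree term by term.\<close>

lemma det_reindex:
  fixes A :: "real^'n::finite^'n" and f :: "'m::finite \<Rightarrow> 'n"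
  assumes f: "bij f" shows "det (\<chi> i j. A $ f i $ f j) = det A"
proof -
  have bb: "bij_betw (map_permutation UNIV f) {p. p permutes (UNIV :: 'm set)} {p. p permutes (UNIV :: 'n set)}"
  proof -
    have eq: "map_permutation UNIV f = (\<lambda>\<pi> x. if x \<in> (UNIV::'n set) then f (\<pi> (inv_into UNIV f x)) else x)"
      using f by (auto simp: map_permutation_def restrict_id_def fun_eq_iff bij_is_surj)
    show ?thesis unfolding eq by (rule bij_betw_permutations[of f UNIV UNIV]) (use f in simp)
  qed
  have "det A = (\<Sum>p\<in>{p. p permutes (UNIV :: 'm set)}. of_int (sign (map_permutation UNIV f p)) * (\<Prod>i\<in>UNIV. A $ i $ map_permutation UNIV f p i))"
    unfolding det_def by (rule sum.reindex_bij_betw[OF bb, symmetric])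
  also have "\<dots> = (\<Sum>p\<in>{p. p permutes (UNIV :: 'm set)}. of_int (sign p) * (\<Prod>i\<in>UNIV. A $ f i $ f (p i)))"
  proof (rule sum.cong[OF refl])
    fix p :: "'m \<Rightarrow> 'm" assume "p \<in> {p. p permutes UNIV}"
    then have p: "p permutes UNIV" by simp
    have inj: "inj f" using f by (rule bij_is_inj)
    have "(\<Prod>i\<in>UNIV. A $ i $ map_permutation UNIV f p i) = (\<Prod>i\<in>UNIV. A $ f i $ map_permutation UNIV f p (f i))"
      by (rule prod.reindex_bij_betw[OF f, symmetric])
    also have "\<dots> = (\<Prod>i\<in>UNIV. A $ f i $ f (p i))" by (simp add: map_permutation_apply[OF inj])
    finally show "real_of_int (sign (map_permutation UNIV f p)) * (\<Prod>i\<in>UNIV. A $ i $ map_permutation UNIV f p i)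
      = of_int (sign p) * (\<Prod>i\<in>UNIV. A $ f i $ f (p i))"
      by (simp add: sign_map_permutation[OF inj p finite_class.finite_UNIV])
  qed
  also have "\<dots> = det (\<chi> i j. A $ f i $ f j)" by (simp add: det_def)
  finally show ?thesis by simp
qed

definition reindex :: "('m \<Rightarrow> 'n) \<Rightarrow> real^'n \<Rightarrow> real^'m"
  where "reindex f x = (\<chi> i. x $ f i)"

lemma reindex_linear: "bounded_linear (reindex f :: real^'n::finite \<Rightarrow> real^'m::finite)"
  unfolding linear_conv_bounded_linear[symmetric] by (rule linearI) (auto simp: reindex_def vec_eq_iff)

lemma reindex_inverse:
  assumes "bij f" shows "reindex (inv f) (reindex f x) = x" "reindex f (reindex (inv f) y) = y"
  using assms by (auto simp: reindex_def vec_eq_iff bij_is_inj bij_is_surj surj_f_inv_f)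

lemma reindex_measurable: "(reindex f :: real^'n::finite \<Rightarrow> real^'m::finite) \<in> borel_measurable borel"
  by (intro borel_measurable_continuous_onI linear_continuous_on reindex_linear)

lemma lborel_reindex:
  fixes f :: "'m::finite \<Rightarrow> 'n::finite"
  assumes f: "bij f" shows "distr lborel borel (reindex f) = lborel"
proof (rule lborel_eqI[symmetric])
  have prod_Basis: "(\<Prod>b\<in>Basis. (x::real^'k::finite) \<bullet> b) = (\<Prod>i\<in>UNIV. x $ i)" for x
  proof -
    have B': "(Basis :: (real^'k) set) = range (\<lambda>i. axis i 1)" by (auto simp: Basis_vec_def)
    have inj: "inj (\<lambda>i. axis i 1 :: real^'k)" by (auto simp: inj_on_def axis_eq_axis)
    show ?thesis unfolding B' prod.reindex[OF inj] by (simp add: inner_axis)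
  qed
  fix l u :: "real^'m" assume lu: "\<And>b. b \<in> Basis \<Longrightarrow> l \<bullet> b \<le> u \<bullet> b"
  have lu': "l $ i \<le> u $ i" for i using lu[of "axis i 1"] by (simp add: inner_axis)
  let ?l = "reindex (inv f) l" and ?u = "reindex (inv f) u"
  have "reindex f -` box l u = box ?l ?u"
    using f by (auto simp: mem_box_cart reindex_def) (metis bij_inv_eq_iff)+
  then have "emeasure (distr lborel borel (reindex f)) (box l u) = emeasure lborel (box ?l ?u)"
    by (subst emeasure_distr) (simp_all add: reindex_measurable)
  also have "\<dots> = (\<Prod>b\<in>Basis. (?u - ?l) \<bullet> b)"
    by (rule emeasure_lborel_box) (auto simp: Basis_vec_def inner_axis reindex_def lu')
  also have "(\<Prod>b\<in>Basis. (?u - ?l) \<bullet> b) = (\<Prod>b\<in>Basis. (u - l) \<bullet> b)"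
  proof -
    have "(\<Prod>i\<in>UNIV. (u - l) $ inv f i) = (\<Prod>i\<in>UNIV. (u - l) $ i)"
      by (rule prod.reindex_bij_betw) (use f in \<open>simp add: bij_imp_bij_inv\<close>)
    then show ?thesis unfolding prod_Basis by (simp add: reindex_def)
  qed
  finally show "emeasure (distr lborel borel (reindex f)) (box l u) = (\<Prod>b\<in>Basis. (u - l) \<bullet> b)" .
qed simp

text \<open>\<open>has_measure_differentiable_image\<close> is applied to images of finite measure.
  To this end the image is cut into the bounded shells \<open>E j\<close>, and the formula is summed
  over their preimages.\<close>

lemma emeasure_image_wellorder:
  fixes g :: "real^'m::{finite,wellorder} \<Rightarrow> real^'m::_"
  assumes B: "B \<in> sets borel" and gB: "g ` B \<in> sets borel"
    and der: "\<And>x. x \<in> B \<Longrightarrow> (g has_derivative g' x) (at x)" and inj: "inj_on g B"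
    and meas: "(\<lambda>x. \<bar>det (matrix (g' x))\<bar> * indicator B x) \<in> borel_measurable borel"
    and g_meas: "\<And>E. E \<in> sets borel \<Longrightarrow> {x\<in>B. g x \<in> E} \<in> sets borel"
  shows "emeasure lborel (g ` B) = (\<integral>\<^sup>+x. ennreal \<bar>det (matrix (g' x))\<bar> * indicator B x \<partial>lborel)"
proof -
  define E where "E j = {y :: real^'m::_. real j \<le> norm y \<and> norm y < real (Suc j)}" for j
  have E: "E j \<in> sets borel" for j
  proof -
    have "E j = - ball 0 (real j) \<inter> ball 0 (real (Suc j))" by (auto simp: E_def)
    then show ?thesis by simp
  qed
  have dis: "disjoint_family E" unfolding disjoint_family_on_def
  proof (intro ballI impI)
    fix i j :: nat assume "i \<noteq> j"
    show "E i \<inter> E j = {}"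
    proof (rule ccontr)
      assume "E i \<inter> E j \<noteq> {}"
      then obtain y where "y \<in> E i" "y \<in> E j" by blast
      then have "real i < real (Suc j)" "real j < real (Suc i)" unfolding E_def mem_Collect_eq by linarith+
      then show False using \<open>i \<noteq> j\<close> by simp
    qed
  qed
  have un: "(\<Union>j. E j) = UNIV"
  proof -
    have "y \<in> E (nat \<lfloor>norm y\<rfloor>)" for y by (simp add: E_def) linarith
    then show ?thesis by blast
  qed
  define Bj where "Bj j = {x\<in>B. g x \<in> E j}" for j
  have Bj: "Bj j \<in> sets borel" for j unfolding Bj_def by (rule g_meas[OF E])
  have gBj: "g ` Bj j = g ` B \<inter> E j" for j by (auto simp: Bj_def)
  have each: "emeasure lborel (g ` Bj j) = (\<integral>\<^sup>+x. ennreal \<bar>det (matrix (g' x))\<bar> * indicator (Bj j) x \<partial>lborel)" for j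
  proof -
    have s: "g ` Bj j \<in> sets borel" unfolding gBj using gB E by blast
    have bnd: "bounded (g ` Bj j)"
      unfolding gBj bounded_iff by (rule exI[of _ "real (Suc j)"]) (auto simp: E_def)
    have fin: "emeasure lborel (g ` Bj j) < \<infinity>" by (rule emeasure_bounded_finite[OF bnd])
    have lm: "g ` Bj j \<in> lmeasurable" using s fin by (intro fmeasurableI) auto
    have "((\<lambda>x. \<bar>det (matrix (g' x))\<bar>) has_integral measure lebesgue (g ` Bj j)) (Bj j)"
    proof (rule has_measure_differentiable_image[THEN iffD1, OF _ _ _ conjI[OF lm refl]])
      show "Bj j \<in> sets lebesgue" using Bj by simp
      show "(g has_derivative g' x) (at x within Bj j)" if "x \<in> Bj j" for x
        using der[of x] that by (auto simp: Bj_def intro: has_derivative_at_withinI)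
      show "inj_on g (Bj j)" by (rule inj_on_subset[OF inj]) (auto simp: Bj_def)
    qed
    then have "(\<integral>\<^sup>+x. ennreal \<bar>det (matrix (g' x))\<bar> * indicator (Bj j) x \<partial>lborel) = ennreal (measure lebesgue (g ` Bj j))"
      by (intro nn_integral_has_integral_lebesgue') auto
    also have "\<dots> = emeasure lborel (g ` Bj j)"
      using s fin by (simp add: measure_def less_top)
    finally show ?thesis by simp
  qed
  have "emeasure lborel (g ` B) = emeasure lborel (\<Union>j. g ` Bj j)" using un by (simp add: gBj flip: Int_UN_distrib)
  also have "\<dots> = (\<Sum>j. emeasure lborel (g ` Bj j))"
    by (rule suminf_emeasure[symmetric]) (use gB E dis in \<open>auto simp: gBj disjoint_family_on_def\<close>)
  also have "\<dots> = (\<Sum>j. \<integral>\<^sup>+x. ennreal \<bar>det (matrix (g' x))\<bar> * indicator (Bj j) x \<partial>lborel)" by (simp only: each)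
  also have "\<dots> = (\<integral>\<^sup>+x. (\<Sum>j. ennreal \<bar>det (matrix (g' x))\<bar> * indicator (Bj j) x) \<partial>lborel)"
  proof (rule nn_integral_suminf[symmetric])
    fix j
    have "(\<lambda>x. ennreal (\<bar>det (matrix (g' x))\<bar> * indicator B x) * indicator (Bj j) x) \<in> borel_measurable lborel"
      using meas Bj by measurable
    moreover have "(\<lambda>x. ennreal (\<bar>det (matrix (g' x))\<bar> * indicator B x) * indicator (Bj j) x) = (\<lambda>x. ennreal \<bar>det (matrix (g' x))\<bar> * indicator (Bj j) x)"
      by (auto simp: Bj_def indicator_def)
    ultimately show "(\<lambda>x. ennreal \<bar>det (matrix (g' x))\<bar> * indicator (Bj j) x) \<in> borel_measurable lborel" by metis
  qed
  also have "\<dots> = (\<integral>\<^sup>+x. ennreal \<bar>det (matrix (g' x))\<bar> * indicator B x \<partial>lborel)"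
  proof (rule nn_integral_cong)
    fix x
    have "(\<Sum>j. indicator (Bj j) x) = (indicator (\<Union>j. Bj j) x :: ennreal)"
      by (rule suminf_indicator) (use dis in \<open>auto simp: Bj_def disjoint_family_on_def\<close>)
    also have "(\<Union>j. Bj j) = B" using un by (auto simp: Bj_def)
    finally show "(\<Sum>j. ennreal \<bar>det (matrix (g' x))\<bar> * indicator (Bj j) x) = ennreal \<bar>det (matrix (g' x))\<bar> * indicator B x"
      by simp
  qed
  finally show ?thesis .
qed

text \<open>Conjugating \<open>g\<close> with a reindexing of the coordinates changes neither
  Lebesgue measure nor the Jacobian determinant, which reduces the claim to the well-ordered index
  type.\<close>

lemma emeasure_smooth_image:
  fixes g :: "real^'n::finite \<Rightarrow> real^'n"
  assumes S: "open S" and g: "smooth_on S g" and inj: "inj_on g S" and B: "B \<in> sets borel" "B \<subseteq> S"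
    and gB: "g ` B \<in> sets borel"
  shows "emeasure lborel (g ` B) = (\<integral>\<^sup>+x. ennreal \<bar>det (matrix (frechet_derivative g (at x)))\<bar> * indicator B x \<partial>lborel)"
proof -
  let ?g' = "\<lambda>x. frechet_derivative g (at x)"
  obtain f :: "'n windex \<Rightarrow> 'n" where f: "bij f" by (rule windex_bij)
  let ?R = "reindex f" and ?I = "reindex (inv f)"
  note R = reindex_inverse[OF f]
  interpret R: bounded_linear ?R by (rule reindex_linear)
  let ?h = "\<lambda>y. ?R (g (?I y))" and ?h' = "\<lambda>y v. ?R (?g' (?I y) (?I v))"
  have im: "?R ` X = ?I -` X" for X using R by (auto simp: image_iff) metis
  have bor: "?R ` X \<in> sets borel" if "X \<in> sets borel" for X
    unfolding im using measurable_sets[OF reindex_measurable that, of "inv f"] by simp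
  have him: "?h ` ?R ` B = ?R ` g ` B" using R by (simp add: image_image)
  have der: "(g has_derivative ?g' x) (at x)" if "x \<in> S" for x by (rule smooth_on_has_derivative[OF S g that])
  have detc: "det (matrix (?h' y)) = det (matrix (?g' (?I y)))" for y
  proof -
    have "?I (axis j 1) = axis (f j) 1" for j
      using f by (auto simp: reindex_def axis_def vec_eq_iff bij_is_inj bij_is_surj surj_f_inv_f)
    then have "matrix (?h' y) = (\<chi> i j. matrix (?g' (?I y)) $ f i $ f j)"
      by (simp add: matrix_def reindex_def vec_eq_iff)
    then show ?thesis using det_reindex[OF f] by metis
  qed
  have cont: "continuous_on S (\<lambda>x. \<bar>det (matrix (?g' x))\<bar>)"
  proof -
    have c: "continuous_on S (\<lambda>x. ?g' x (axis j 1) $ i)" for i j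
      by (rule smooth_on_continuous[OF smooth_on_nth[OF smooth_on_derivative[OF S g]]])
    have "det (matrix (?g' x)) = (\<Sum>p\<in>{p. p permutes UNIV}. of_int (sign p) * (\<Prod>i\<in>UNIV. ?g' x (axis (p i) 1) $ i))" for x
      by (simp add: det_def matrix_def)
    moreover have "continuous_on S (\<lambda>x. \<bar>\<Sum>p\<in>{p. p permutes UNIV}. of_int (sign p) * (\<Prod>i\<in>UNIV. ?g' x (axis (p i) 1) $ i)\<bar>)"
      by (rule continuous_on_rabs, rule continuous_on_sum, rule continuous_on_mult[OF continuous_on_const], rule continuous_on_prod, rule c)
    ultimately show ?thesis by simp
  qed
  have m0: "(\<lambda>x. \<bar>det (matrix (?g' x))\<bar> * indicator B x) \<in> borel_measurable borel"
  proof -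
    have "(\<lambda>x. indicator S x *\<^sub>R \<bar>det (matrix (?g' x))\<bar>) \<in> borel_measurable borel"
      by (rule borel_measurable_continuous_on_indicator[OF _ cont]) (use S in simp)
    then have "(\<lambda>x. (indicator S x *\<^sub>R \<bar>det (matrix (?g' x))\<bar>) * indicator B x) \<in> borel_measurable borel"
      using B(1) by measurable
    moreover have "(\<lambda>x. (indicator S x *\<^sub>R \<bar>det (matrix (?g' x))\<bar>) * indicator B x) = (\<lambda>x. \<bar>det (matrix (?g' x))\<bar> * indicator B x)"
      using B(2) by (auto simp: indicator_def fun_eq_iff)
    ultimately show ?thesis by metis
  qed
  have ind: "indicator (?R ` B) y = indicator B (?I y)" for y unfolding im by (simp add: indicator_def)
  have m1: "(\<lambda>y. \<bar>det (matrix (?h' y))\<bar> * indicator (?R ` B) y) \<in> borel_measurable borel"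
    unfolding detc ind by (rule measurable_compose[OF reindex_measurable m0])
  have "emeasure lborel (?h ` ?R ` B) = (\<integral>\<^sup>+y. ennreal \<bar>det (matrix (?h' y))\<bar> * indicator (?R ` B) y \<partial>lborel)"
  proof (rule emeasure_image_wellorder[OF bor[OF B(1)] _ _ _ m1])
    show "?h ` ?R ` B \<in> sets borel" unfolding him by (rule bor[OF gB])
    show "(?h has_derivative ?h' y) (at y)" if "y \<in> ?R ` B" for y
    proof -
      have y: "?I y \<in> S" using that B(2) R by auto
      have "((\<lambda>y. g (?I y)) has_derivative (\<lambda>v. ?g' (?I y) (?I v))) (at y)"
        by (rule has_derivative_comp[OF bounded_linear_imp_has_derivative[OF reindex_linear] der[OF y]]) simp
      then show ?thesis by (rule bounded_linear.has_derivative[OF reindex_linear])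
    qed
    show "inj_on ?h (?R ` B)"
    proof (rule inj_onI)
      fix y z assume yz: "y \<in> ?R ` B" "z \<in> ?R ` B" "?h y = ?h z"
      then have "g (?I y) = g (?I z)" using R(1) by metis
      moreover have "?I y \<in> S" "?I z \<in> S" using yz B(2) R by auto
      ultimately have "?I y = ?I z" using inj by (meson inj_onD)
      then show "y = z" using R(2) by metis
    qed
    fix E :: "(real^'n windex) set" assume E: "E \<in> sets borel"
    \<comment> \<open>\<open>g\<close> is controlled on \<open>S\<close> only. Extending it by zero
      gives a Borel map that agrees with \<open>g\<close> on \<open>B\<close>.\<close>
    have "(\<lambda>x. indicator S x *\<^sub>R g x) \<in> borel_measurable borel"
      by (rule borel_measurable_continuous_on_indicator[OF _ smooth_on_continuous[OF g]]) (use S in simp)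
    then have "(\<lambda>x. ?R (indicator S x *\<^sub>R g x)) \<in> borel_measurable borel"
      by (rule measurable_compose[OF _ reindex_measurable])
    from measurable_sets[OF this E] have "(\<lambda>x. ?R (indicator S x *\<^sub>R g x)) -` E \<in> sets borel" by simp
    then have "?R ` (B \<inter> (\<lambda>x. ?R (indicator S x *\<^sub>R g x)) -` E) \<in> sets borel" using B(1) by (intro bor sets.Int)
    moreover have "?R ` (B \<inter> (\<lambda>x. ?R (indicator S x *\<^sub>R g x)) -` E) = {y \<in> ?R ` B. ?h y \<in> E}"
      using B(2) R by (auto simp: indicator_def subset_iff)
    ultimately show "{y \<in> ?R ` B. ?h y \<in> E} \<in> sets borel" by simp
  qed
  also have "\<dots> = (\<integral>\<^sup>+y. ennreal (\<bar>det (matrix (?g' (?I y)))\<bar> * indicator B (?I y)) \<partial>lborel)"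
    unfolding detc ind by (rule nn_integral_cong) (simp add: indicator_def)
  also have "\<dots> = (\<integral>\<^sup>+x. ennreal (\<bar>det (matrix (?g' x))\<bar> * indicator B x) \<partial>distr lborel borel ?I)"
    by (rule nn_integral_distr[symmetric]) (use m0 in \<open>simp_all add: reindex_measurable\<close>)
  also have "distr lborel borel ?I = lborel" by (rule lborel_reindex) (use f in \<open>simp add: bij_imp_bij_inv\<close>)
  also have "(\<integral>\<^sup>+x. ennreal (\<bar>det (matrix (?g' x))\<bar> * indicator B x) \<partial>lborel) = (\<integral>\<^sup>+x. ennreal \<bar>det (matrix (?g' x))\<bar> * indicator B x \<partial>lborel)"
    by (rule nn_integral_cong) (simp add: indicator_def)
  finally have 1: "emeasure lborel (?R ` g ` B) = (\<integral>\<^sup>+x. ennreal \<bar>det (matrix (?g' x))\<bar> * indicator B x \<partial>lborel)"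
    unfolding him .
  have "emeasure lborel (?R ` g ` B) = emeasure (distr lborel borel ?R) (?R ` g ` B)" by (simp add: lborel_reindex[OF f])
  also have "\<dots> = emeasure lborel (?R -` (?R ` g ` B))"
    using bor[OF gB] by (subst emeasure_distr) (simp_all add: reindex_measurable)
  also have "?R -` (?R ` g ` B) = g ` B"
    by (rule inj_vimage_image_eq) (use R(1) in \<open>metis injI\<close>)
  finally show ?thesis using 1 by simp
qed

section \<open>The Jacobian of left translations\<close>

context carnot_frame
begin

text \<open>The matrix is the identity plus a block with rows in \<open>J\<close> and columns
  outside \<open>J\<close>. A permutation with nonzero Leibniz term fixes every index outside
  \<open>J\<close> and can move an index of \<open>J\<close> only to the outside. Its image there is
  already fixed, so injectivity excludes such a move.\<close>

lemma det_unipotent: "det (matrix (\<lambda>v. v + s *\<^sub>R C x v)) = 1"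
proof -
  let ?A = "matrix (\<lambda>v. v + s *\<^sub>R C x v)"
  have A: "?A $ i $ j = (if i = j then 1 else 0) + s * C x (axis j 1) $ i" for i j
    by (auto simp: matrix_def axis_def)
  have AJ: "?A $ i $ j = (if i = j then 1 else 0)" if "i \<notin> J \<or> j \<in> J" for i j
  proof -
    have "C x (axis j 1) $ i = 0"
    proof (cases "i \<in> J")
      case True
      then have "j \<in> J" using that by blast
      then have "C (axis j 1) x = 0" by (intro C_center) (auto simp: axis_def)
      then show ?thesis using C_antisym[of x "axis j 1"] by simp
    qed (simp add: C_range)
    then show ?thesis by (simp add: A)
  qed
  have zero: "(\<Prod>i\<in>UNIV. ?A $ i $ p i) = 0" if p: "p permutes UNIV" "p \<noteq> id" for p
  proof (rule ccontr)
    assume nz: "(\<Prod>i\<in>UNIV. ?A $ i $ p i) \<noteq> 0"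
    have n: "?A $ i $ p i \<noteq> 0" for i using nz unfolding prod_zero_iff[OF finite_class.finite_UNIV] by blast
    have 1: "p i = i" if "i \<notin> J" for i using n[of i] AJ[of i "p i"] that by (auto split: if_splits)
    have 2: "p i = i" if "i \<in> J" for i
    proof (cases "p i \<in> J")
      case True
      then show ?thesis using n[of i] AJ[of i "p i"] by (auto split: if_splits)
    next
      case False
      then have "p (p i) = p i" by (rule 1)
      then show ?thesis using permutes_inj[OF p(1)] by (meson injD)
    qed
    show False using p(2) 1 2 by (auto simp: fun_eq_iff)
  qed
  have "det ?A = (\<Sum>p\<in>{p. p permutes UNIV}. of_int (sign p) * (\<Prod>i\<in>UNIV. ?A $ i $ p i))" by (simp add: det_def)
  also have "\<dots> = (\<Sum>p\<in>{id}. of_int (sign p) * (\<Prod>i\<in>UNIV. ?A $ i $ p i))"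
    by (rule sum.mono_neutral_right) (auto simp: permutes_id zero finite_permutations)
  also have "\<dots> = 1"
  proof -
    have "?A $ i $ i = 1" for i
      using AJ[of i i] by (cases "i \<in> J") auto
    then show ?thesis by (simp add: sign_id)
  qed
  finally show ?thesis .
qed

text \<open>Left translations have unipotent derivative, so Lebesgue measure is a left Haar measure
  for \<open>mul\<close>.\<close>

lemma emeasure_mul:
  assumes B: "B \<in> sets borel"
  shows "mul p ` B \<in> sets borel" "emeasure lborel (mul p ` B) = emeasure lborel B"
proof -
  have sm: "smooth_on UNIV (mul p)" for p by (rule mul_smooth[OF smooth_on_const smooth_on_id])
  have inv: "mul (- p) (mul p x) = x" "mul p (mul (- p) x) = x" for x
    by (simp_all add: mul_assoc[symmetric] mul_minus mul_0)
  have im: "mul p ` B = mul (- p) -` B" using inv by (auto simp: image_iff) metis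
  have m: "mul (- p) \<in> borel_measurable borel"
    by (rule borel_measurable_continuous_onI[OF smooth_on_continuous[OF sm]])
  show s: "mul p ` B \<in> sets borel" unfolding im using measurable_sets[OF m B] by simp
  have inj: "inj (mul p)" using inv(1) by (metis injI)
  have D: "frechet_derivative (mul p) (at x) = (\<lambda>v. v + (1/2) *\<^sub>R C p v)" for x
  proof (rule frechet_derivative_at[symmetric])
    have "((\<lambda>y. p + y + (1/2) *\<^sub>R C p y) has_derivative (\<lambda>v. 0 + v + (1/2) *\<^sub>R C p v)) (at x)"
      by (intro has_derivative_add has_derivative_const has_derivative_ident has_derivative_scaleR_right
          bounded_linear_imp_has_derivative[OF C.bounded_linear_right])
    then show "(mul p has_derivative (\<lambda>v. v + (1/2) *\<^sub>R C p v)) (at x)" by (simp add: mul_def[abs_def])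
  qed
  show "emeasure lborel (mul p ` B) = emeasure lborel B"
    using emeasure_smooth_image[OF open_UNIV sm inj B subset_UNIV s] B
    unfolding D det_unipotent by simp
qed

end

section \<open>Left-invariant metrics in exponential coordinates\<close>

context carnot
begin

text \<open>Collects the conclusions of \<open>global_exp\<close>, so that one map with these
  properties can be fixed by choice.\<close>

definition is_exp :: "(real^'n \<Rightarrow> 'g) \<Rightarrow> bool"
  where "is_exp \<Phi> \<longleftrightarrow> bij \<Phi> \<and> (\<forall>x y. \<Phi> (mul x y) = \<Phi> x + \<Phi> y) \<and> plot A UNIV \<Phi> \<and>
    (\<forall>i. smooth_fun A (\<lambda>p. inv \<Phi> p $ i)) \<and>
    (\<forall>f. smooth_fun A f \<longrightarrow> ((\<lambda>x. f (\<Phi> x)) has_derivative (\<lambda>a. frame a 0 f)) (at 0))"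

definition \<Phi> :: "real^'n \<Rightarrow> 'g" where "\<Phi> = (SOME \<Phi>. is_exp \<Phi>)"

definition \<Psi> :: "'g \<Rightarrow> real^'n" where "\<Psi> = inv \<Phi>"

lemma is_exp_\<Phi>: "is_exp \<Phi>"
proof -
  obtain E where E: "bij E" "\<And>x y. E (mul x y) = E x + E y" "plot A UNIV E" "\<And>i. smooth_fun A (\<lambda>p. inv E p $ i)"
    "\<And>f. smooth_fun A f \<Longrightarrow> ((\<lambda>x. f (E x)) has_derivative (\<lambda>a. frame a 0 f)) (at 0)"
    by (rule global_exp; (rule that; assumption))
  then have "is_exp E" unfolding is_exp_def by simp
  then show ?thesis unfolding \<Phi>_def by (rule someI[of is_exp])
qed

lemma \<Phi>_bij: "bij \<Phi>" and \<Phi>_mul: "\<Phi> (mul x y) = \<Phi> x + \<Phi> y" and plot_\<Phi>: "plot A UNIV \<Phi>"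
  and smooth_fun_\<Psi>: "smooth_fun A (\<lambda>p. \<Psi> p $ i)"
  and \<Phi>_derivative_0: "smooth_fun A f \<Longrightarrow> ((\<lambda>x. f (\<Phi> x)) has_derivative (\<lambda>a. frame a 0 f)) (at 0)"
  using is_exp_\<Phi> unfolding is_exp_def \<Psi>_def by blast+

lemma \<Psi>_\<Phi>: "\<Psi> (\<Phi> x) = x" and \<Phi>_\<Psi>: "\<Phi> (\<Psi> p) = p"
  using \<Phi>_bij by (simp_all add: \<Psi>_def bij_is_inj bij_is_surj surj_f_inv_f)

lemma \<Psi>_add: "\<Psi> (p + q) = mul (\<Psi> p) (\<Psi> q)"
  using \<Psi>_\<Phi>[of "mul (\<Psi> p) (\<Psi> q)"] by (simp add: \<Phi>_mul \<Phi>_\<Psi>)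

lemma \<Psi>_0: "\<Psi> 0 = 0"
proof -
  have "mul (\<Psi> 0) (\<Psi> 0) = \<Psi> 0" using \<Psi>_add[of 0 0] by simp
  then have "mul (- \<Psi> 0) (mul (\<Psi> 0) (\<Psi> 0)) = mul (- \<Psi> 0) (\<Psi> 0)" by simp
  then show ?thesis by (simp add: mul_assoc[symmetric] mul_minus mul_0)
qed

lemma \<Psi>_plot: "plot A W f \<Longrightarrow> thick W \<Longrightarrow> smooth_on W (\<lambda>x. \<Psi> (f x))"
  by (rule smooth_on_vec) (rule smooth_fun_plot[OF smooth_fun_\<Psi>])

lemma smooth_fun_\<Phi>: "smooth_fun A f \<Longrightarrow> smooth_on UNIV (\<lambda>x. f (\<Phi> x))"
  by (rule smooth_fun_plot[OF _ plot_\<Phi> thick_UNIV])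

lemma \<Phi>_continuous: "continuous_on UNIV \<Phi>"
  using plot_\<Phi> by (simp add: plot_def)

text \<open>The tangent vector with coordinates \<open>w\<close> in the global chart
  \<open>\<Psi>\<close>. That chart may lie outside the atlas, so \<open>chart_vector\<close> does
  not cover it.\<close>

definition tv :: "'g \<Rightarrow> real^'n \<Rightarrow> 'g tvec"
  where "tv p w = (\<lambda>f. if smooth_fun A f then frechet_derivative (\<lambda>x. f (\<Phi> x)) (at (\<Psi> p)) w else 0)"

lemma tv_derivative:
  assumes "smooth_fun A f" shows "((\<lambda>x. f (\<Phi> x)) has_derivative (\<lambda>w. tv p w f)) (at (\<Psi> p))"
  using smooth_on_has_derivative[OF open_UNIV smooth_fun_\<Phi>[OF assms], of "\<Psi> p"] assms by (simp add: tv_def)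

lemma tvI:
  assumes "\<And>f. smooth_fun A f \<Longrightarrow> ((\<lambda>x. f (\<Phi> x)) has_derivative (\<lambda>w. v w f)) (at (\<Psi> p))"
    and "\<And>f w. \<not> smooth_fun A f \<Longrightarrow> v w f = 0"
  shows "tv p w = v w"
proof
  fix f show "tv p w f = v w f"
  proof (cases "smooth_fun A f")
    case True
    show ?thesis by (rule fun_cong[OF has_derivative_unique[OF tv_derivative[OF True] assms(1)[OF True]]])
  next
    case False
    then show ?thesis using assms(2) by (simp add: tv_def)
  qed
qed

lemma chart_vector_tv:
  assumes c: "c \<in> A" "p \<in> fst c"
  shows "chart_vector c p u = tv p (frechet_derivative (\<lambda>x. \<Psi> (chart_inv c x)) (at (snd c p)) u)"
proof
  fix f
  show "chart_vector c p u f = tv p (frechet_derivative (\<lambda>x. \<Psi> (chart_inv c x)) (at (snd c p)) u) f"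
  proof (cases "smooth_fun A f")
    case True
    have sm: "smooth_on (snd c ` fst c) (\<lambda>x. \<Psi> (chart_inv c x))"
      by (rule \<Psi>_plot[OF plot_chart_inv[OF c(1)] thick_open[OF chart_image_open[OF c(1)]]])
    have "((\<lambda>x. \<Psi> (chart_inv c x)) has_derivative frechet_derivative (\<lambda>x. \<Psi> (chart_inv c x)) (at (snd c p))) (at (snd c p))"
      by (rule smooth_on_has_derivative[OF chart_image_open[OF c(1)] sm]) (use c in blast)
    then have "((\<lambda>x. f (\<Phi> (\<Psi> (chart_inv c x)))) has_derivative
        (\<lambda>u. tv p (frechet_derivative (\<lambda>x. \<Psi> (chart_inv c x)) (at (snd c p)) u) f)) (at (snd c p))"
      by (rule has_derivative_comp[OF _ tv_derivative[OF True]]) (simp add: chart_inv_chart[OF c])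
    then have "((\<lambda>x. f (chart_inv c x)) has_derivative
        (\<lambda>u. tv p (frechet_derivative (\<lambda>x. \<Psi> (chart_inv c x)) (at (snd c p)) u) f)) (at (snd c p))"
      by (simp only: \<Phi>_\<Psi>)
    from has_derivative_unique[OF smooth_fun_chart_derivative[OF c True] this] show ?thesis by (rule fun_cong)
  next
    case False
    then show ?thesis by (simp add: tv_def chart_vector_def)
  qed
qed

lemma tangent_eq_tv:
  assumes "v \<in> tangent_space A p" obtains w where "v = tv p w"
proof -
  obtain c where c: "c \<in> A" "p \<in> fst c" using chart_cover by blast
  obtain u where "v = chart_vector c p u" by (rule tangent_eq_chart_vector[OF c assms])
  then show ?thesis using that chart_vector_tv[OF c] by metis
qed

lemma tv_\<Psi>: "tv p w (\<lambda>q. \<Psi> q $ i) = w $ i"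
proof -
  have "((\<lambda>x. \<Psi> (\<Phi> x) $ i) has_derivative (\<lambda>w. w $ i)) (at (\<Psi> p))"
    unfolding \<Psi>_\<Phi> by (rule bounded_linear_imp_has_derivative[OF bounded_linear_vec_nth])
  from has_derivative_unique[OF tv_derivative[OF smooth_fun_\<Psi>] this] show ?thesis by (rule fun_cong)
qed

lemma dL_tv: "dL a (tv p w) = tv (a + p) (w + (1/2) *\<^sub>R C (\<Psi> a) w)"
proof
  fix f show "dL a (tv p w) f = tv (a + p) (w + (1/2) *\<^sub>R C (\<Psi> a) w) f"
  proof (cases "smooth_fun A f")
    case True
    have 1: "((\<lambda>x. f (a + \<Phi> x)) has_derivative (\<lambda>w. tv p w (\<lambda>q. f (a + q)))) (at (\<Psi> p))"
      by (rule tv_derivative[OF smooth_fun_translate[OF True]])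
    have D: "((\<lambda>x. mul (\<Psi> a) x) has_derivative (\<lambda>v. (0 + v) + (1/2) *\<^sub>R C (\<Psi> a) v)) (at (\<Psi> p))"
      unfolding mul_def
      by (intro has_derivative_add has_derivative_const has_derivative_ident has_derivative_scaleR_right
          bounded_linear_imp_has_derivative[OF C.bounded_linear_right])
    have "((\<lambda>x. f (\<Phi> (mul (\<Psi> a) x))) has_derivative (\<lambda>v. tv (a + p) ((0 + v) + (1/2) *\<^sub>R C (\<Psi> a) v) f)) (at (\<Psi> p))"
      by (rule has_derivative_comp[OF D tv_derivative[OF True]]) (simp add: \<Psi>_add)
    then have "((\<lambda>x. f (a + \<Phi> x)) has_derivative (\<lambda>v. tv (a + p) (v + (1/2) *\<^sub>R C (\<Psi> a) v) f)) (at (\<Psi> p))"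
      by (simp add: \<Phi>_mul \<Phi>_\<Psi>)
    from has_derivative_unique[OF 1 this] show ?thesis unfolding dL_def by (rule fun_cong)
  next
    case False
    then show ?thesis by (simp add: dL_def tv_def smooth_fun_translate_iff)
  qed
qed

lemma tv_0: "tv 0 a = frame a 0"
  by (rule tvI) (simp_all add: \<Psi>_0 \<Phi>_derivative_0 lie_algebra_nonsmooth[OF frame_in])

lemma \<xi>_inverse: "\<xi> x w + (1/2) *\<^sub>R C x (\<xi> x w) = w"
  by (simp add: \<xi>_def C.diff_right C.scaleR_right C_C)

lemma tv_frame: "tv p w = dL p (frame (\<xi> (\<Psi> p) w) 0)"
  using dL_tv[of p 0 "\<xi> (\<Psi> p) w"] by (simp add: tv_0 \<xi>_inverse)

lemma \<xi>_linear: "bounded_linear (\<xi> x)"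
  unfolding \<xi>_def[abs_def]
  by (intro bounded_linear_sub bounded_linear_ident bounded_linear_const_scaleR C.bounded_linear_right)

lemma velocity_tv:
  assumes \<gamma>: "smooth_path A \<gamma>" and t: "t \<in> {0..1}"
  shows "velocity A \<gamma> t = tv (\<gamma> t) (vel (\<lambda>s. \<Psi> (\<gamma> s)) t)"
proof
  fix f show "velocity A \<gamma> t f = tv (\<gamma> t) (vel (\<lambda>s. \<Psi> (\<gamma> s)) t) f"
  proof (cases "smooth_fun A f")
    case True
    have sm: "smooth_on {0..1} (\<lambda>s. \<Psi> (\<gamma> s))"
      by (rule \<Psi>_plot[OF \<gamma>[unfolded smooth_path_iff_plot] thick_unit_interval])
    have "((\<lambda>s. \<Psi> (\<gamma> s)) has_derivative (\<lambda>h. h *\<^sub>R vel (\<lambda>s. \<Psi> (\<gamma> s)) t)) (at t within {0..1})"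
      using smooth_vel(1)[OF sm t] by (simp add: has_vector_derivative_def)
    then have "((\<lambda>s. f (\<Phi> (\<Psi> (\<gamma> s)))) has_derivative (\<lambda>h. tv (\<gamma> t) (h *\<^sub>R vel (\<lambda>s. \<Psi> (\<gamma> s)) t) f)) (at t within {0..1})"
      by (rule has_derivative_comp[OF _ tv_derivative[OF True]]) simp
    then have "((\<lambda>s. f (\<gamma> s)) has_vector_derivative tv (\<gamma> t) (vel (\<lambda>s. \<Psi> (\<gamma> s)) t) f) (at t within {0..1})"
      using linear_scale[OF has_derivative_linear[OF tv_derivative[OF True, of "\<gamma> t"]]]
      by (simp add: has_vector_derivative_def \<Phi>_\<Psi>)
    then have "vector_derivative (\<lambda>s. f (\<gamma> s)) (at t within {0..1}) = tv (\<gamma> t) (vel (\<lambda>s. \<Psi> (\<gamma> s)) t) f"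
      using vector_derivative_within_cbox[of 0 1 t "\<lambda>s. f (\<gamma> s)"] t by simp
    then show ?thesis using True by (simp add: velocity_def comp_def)
  next
    case False
    then show ?thesis by (simp add: velocity_def tv_def)
  qed
qed

end

section \<open>Balls and volume of a left-invariant metric\<close>

locale carnot_metric = carnot A c0 T J C
  for A :: "('g::{topological_group_add, t2_space, second_countable_topology}, 'n::finite) chart set"
    and c0 T J C +
  fixes g :: "'g metric_tensor"
  assumes g: "g \<in> left_invariant_metrics A"
    and orthonormal: "g 0 (frame a 0) (frame b 0) = a \<bullet> b"
    and C_span: "j \<in> J \<Longrightarrow> axis j 1 \<in> span (range (\<lambda>(a, b). C a b))"
begin

text \<open>Left invariance carries both vectors back to the identity, where the frame is
  orthonormal.\<close>

lemma g_tv: "g p (tv p v) (tv p w) = \<xi> (\<Psi> p) v \<bullet> \<xi> (\<Psi> p) w"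
proof -
  have "frame a 0 \<in> tangent_space A 0" for a by (rule lie_algebra_tangent[OF frame_in])
  then have "g (p + 0) (dL p (frame a 0)) (dL p (frame b 0)) = g 0 (frame a 0) (frame b 0)" for a b
    using g unfolding left_invariant_metrics_def by blast
  then show ?thesis unfolding tv_frame by (simp add: orthonormal)
qed

lemma path_length_eq:
  assumes \<gamma>: "smooth_path A \<gamma>" shows "path_length A g \<gamma> = len (\<lambda>t. \<Psi> (\<gamma> t))"
  unfolding path_length_def len_def
proof (rule integral_cong)
  fix t :: real assume "t \<in> {0..1}"
  then show "sqrt (g (\<gamma> t) (velocity A \<gamma> t) (velocity A \<gamma> t)) = norm (\<xi> (\<Psi> (\<gamma> t)) (vel (\<lambda>t. \<Psi> (\<gamma> t)) t))"
    by (simp add: velocity_tv[OF \<gamma>] g_tv norm_eq_sqrt_inner)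
qed

lemma len_left:
  assumes "smooth_on {0..1} \<eta>" shows "len (\<lambda>t. mul x (\<eta> t)) = len \<eta>"
  unfolding len_def
proof (rule integral_cong)
  fix t :: real assume t: "t \<in> {0..1}"
  have "((\<lambda>t. x) has_vector_derivative 0) (at t within {0..1})" by simp
  from vel_eqI[OF mul_vector_derivative[OF this smooth_vel(1)[OF assms t]] t]
  have "vel (\<lambda>t. mul x (\<eta> t)) t = vel \<eta> t + (1/2) *\<^sub>R C x (vel \<eta> t)" by (simp add: C.zero_left)
  then show "norm (\<xi> (mul x (\<eta> t)) (vel (\<lambda>t. mul x (\<eta> t)) t)) = norm (\<xi> (\<eta> t) (vel \<eta> t))" by (simp add: \<xi>_left)
qed

lemma riemannian_ball_eq: "riemannian_ball A g p r = \<Phi> ` mul (\<Psi> p) ` coord_ball r"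
proof -
  let ?L = "\<lambda>q. {path_length A g \<gamma> | \<gamma>. smooth_path A \<gamma> \<and> \<gamma> 0 = p \<and> \<gamma> 1 = q}"
  have sm: "smooth_on {0..1} (\<lambda>t. \<Psi> (\<gamma> t))" if "smooth_path A \<gamma>" for \<gamma>
    by (rule \<Psi>_plot[OF that[unfolded smooth_path_iff_plot] thick_unit_interval])
  have path: "smooth_path A (\<lambda>t. \<Phi> (mul (\<Psi> p) (\<eta> t)))" if "smooth_on {0..1} \<eta>" for \<eta>
    unfolding smooth_path_iff_plot
    by (rule plot_compose[OF plot_\<Phi> mul_smooth[OF smooth_on_const that]]) simp
  have len: "path_length A g (\<lambda>t. \<Phi> (mul (\<Psi> p) (\<eta> t))) = len \<eta>" if "smooth_on {0..1} \<eta>" for \<eta>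
    using path_length_eq[OF path[OF that]] len_left[OF that] by (simp add: \<Psi>_\<Phi>)
  have in_L: "len \<eta> \<in> ?L q" if "smooth_on {0..1} \<eta>" "\<eta> 0 = 0" "\<eta> 1 = mul (- \<Psi> p) (\<Psi> q)" for \<eta> q
  proof -
    have "\<Phi> (mul (\<Psi> p) (\<eta> 0)) = p" "\<Phi> (mul (\<Psi> p) (\<eta> 1)) = q"
      using that by (simp_all add: mul_0 \<Phi>_\<Psi> mul_assoc[symmetric] mul_minus)
    then show ?thesis using path[OF that(1)] len[OF that(1)] by (metis (mono_tags, lifting) mem_Collect_eq)
  qed
  \<comment> \<open>An \<open>Inf\<close> of reals is an infimum only for nonempty sets that are
    bounded below. A left-translated line in exponential coordinates joins any two points.\<close>
  have ne: "?L q \<noteq> {}" for q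
    using in_L[of "\<lambda>t. t *\<^sub>R mul (- \<Psi> p) (\<Psi> q)" q] line_smooth by force
  have bdd: "bdd_below (?L q)" for q
    unfolding bdd_below_def using path_length_eq len_nonneg by (intro exI[of _ 0]) auto
  have "riemannian_dist A g p q < r \<longleftrightarrow> mul (- \<Psi> p) (\<Psi> q) \<in> coord_ball r" for q
  proof
    assume "riemannian_dist A g p q < r"
    then obtain \<gamma> where \<gamma>: "smooth_path A \<gamma>" "\<gamma> 0 = p" "\<gamma> 1 = q" "path_length A g \<gamma> < r"
      unfolding riemannian_dist_def using cInf_lessD[OF ne] by blast
    let ?\<eta> = "\<lambda>t. mul (- \<Psi> p) (\<Psi> (\<gamma> t))"
    have "smooth_on {0..1} ?\<eta>" by (rule mul_smooth[OF smooth_on_const sm[OF \<gamma>(1)]])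
    moreover have "?\<eta> 0 = 0" "?\<eta> 1 = mul (- \<Psi> p) (\<Psi> q)" using \<gamma> by (simp_all add: mul_minus)
    moreover have "len ?\<eta> < r" using \<gamma>(4) path_length_eq[OF \<gamma>(1)] len_left[OF sm[OF \<gamma>(1)]] by simp
    ultimately show "mul (- \<Psi> p) (\<Psi> q) \<in> coord_ball r" unfolding coord_ball_def by blast
  next
    assume "mul (- \<Psi> p) (\<Psi> q) \<in> coord_ball r"
    then obtain \<eta> where \<eta>: "smooth_on {0..1} \<eta>" "\<eta> 0 = 0" "\<eta> 1 = mul (- \<Psi> p) (\<Psi> q)" "len \<eta> < r"
      unfolding coord_ball_def by blast
    then show "riemannian_dist A g p q < r"
      unfolding riemannian_dist_def using cInf_lower[OF in_L[OF \<eta>(1-3)] bdd] by linarith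
  qed
  moreover have "mul (- \<Psi> p) (\<Psi> q) \<in> coord_ball r \<longleftrightarrow> q \<in> \<Phi> ` mul (\<Psi> p) ` coord_ball r" for q
  proof
    assume "mul (- \<Psi> p) (\<Psi> q) \<in> coord_ball r"
    moreover have "\<Phi> (mul (\<Psi> p) (mul (- \<Psi> p) (\<Psi> q))) = q" by (simp add: mul_assoc[symmetric] mul_minus mul_0 \<Phi>_\<Psi>)
    ultimately show "q \<in> \<Phi> ` mul (\<Psi> p) ` coord_ball r" by (metis imageI)
  next
    assume "q \<in> \<Phi> ` mul (\<Psi> p) ` coord_ball r"
    then obtain x where "x \<in> coord_ball r" "q = \<Phi> (mul (\<Psi> p) x)" by blast
    then show "mul (- \<Psi> p) (\<Psi> q) \<in> coord_ball r" by (simp add: \<Psi>_\<Phi> mul_assoc[symmetric] mul_minus mul_0)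
  qed
  ultimately show ?thesis unfolding riemannian_ball_def by blast
qed

lemma \<Phi>_measurable: "\<Phi> \<in> borel_measurable borel"
  by (rule borel_measurable_continuous_onI[OF \<Phi>_continuous])

text \<open>Let \<open>?M\<close> be \<open>\<xi>\<close> composed with the Jacobian of the
  transition to exponential coordinates. The Gram matrix is the transpose of \<open>?M\<close> times
  \<open>?M\<close>, and \<open>\<xi>\<close> has determinant 1.\<close>

lemma volume_density_eq:
  assumes c: "c \<in> A" and x: "x \<in> snd c ` fst c"
  shows "volume_density A g c x = \<bar>det (matrix (frechet_derivative (\<lambda>x. \<Psi> (chart_inv c x)) (at x)))\<bar>"
proof -
  let ?p = "chart_inv c x" and ?D = "frechet_derivative (\<lambda>x. \<Psi> (chart_inv c x)) (at x)"
  have p: "?p \<in> fst c" "snd c ?p = x" using chart_inv_in[OF c x] chart_chart_inv[OF c x] by auto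
  have sm: "smooth_on (snd c ` fst c) (\<lambda>x. \<Psi> (chart_inv c x))"
    by (rule \<Psi>_plot[OF plot_chart_inv[OF c] thick_open[OF chart_image_open[OF c]]])
  have D: "linear ?D" by (rule has_derivative_linear[OF smooth_on_has_derivative[OF chart_image_open[OF c] sm x]])
  let ?M = "\<lambda>v. \<xi> (\<Psi> ?p) (?D v)"
  have "coord_vector A c ?p i = tv ?p (?D (axis i 1))" for i
    unfolding coord_vector_eq chart_vector_tv[OF c p(1)] p(2) ..
  then have "(\<chi> i j. g ?p (coord_vector A c ?p i) (coord_vector A c ?p j)) = transpose (matrix ?M) ** matrix ?M"
    by (simp add: g_tv vec_eq_iff matrix_matrix_mult_def transpose_def matrix_def inner_vec_def)
  then have "volume_density A g c x = sqrt (det (matrix ?M) * det (matrix ?M))"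
    by (simp add: volume_density_def Let_def det_mul det_transpose)
  also have "\<dots> = \<bar>det (matrix ?M)\<bar>" by simp
  also have "matrix ?M = matrix (\<xi> (\<Psi> ?p)) ** matrix ?D"
    using matrix_compose[OF D bounded_linear.linear[OF \<xi>_linear]] by (simp add: comp_def)
  also have "det \<dots> = det (matrix ?D)"
  proof -
    have "\<xi> (\<Psi> ?p) = (\<lambda>v. v + (-1/2) *\<^sub>R C (\<Psi> ?p) v)" by (auto simp: \<xi>_def)
    then show ?thesis using det_unipotent[of "-1/2" "\<Psi> ?p"] by (simp only: det_mul mult_1_left)
  qed
  finally show ?thesis .
qed

lemma chart_borel:
  assumes c: "c \<in> A" and B: "B \<in> sets borel" "B \<subseteq> fst c" shows "snd c ` B \<in> sets borel"
proof -
  let ?S = "snd c ` fst c"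
  have S: "?S \<in> sets borel" by (rule borel_open[OF chart_image_open[OF c]])
  have "continuous_on ?S (chart_inv c)" using plot_chart_inv[OF c] by (simp add: plot_def)
  then have m: "chart_inv c \<in> borel_measurable (restrict_space borel ?S)" by (rule borel_measurable_continuous_on_restrict)
  have "chart_inv c -` B \<inter> space (restrict_space borel ?S) \<in> sets (restrict_space borel ?S)"
    by (rule measurable_sets[OF m B(1)])
  moreover have "chart_inv c -` B \<inter> space (restrict_space borel ?S) = snd c ` B"
  proof (intro set_eqI iffI)
    fix x assume "x \<in> chart_inv c -` B \<inter> space (restrict_space borel ?S)"
    then have "chart_inv c x \<in> B" "x \<in> ?S" by (auto simp: space_restrict_space)
    then show "x \<in> snd c ` B" using chart_chart_inv[OF c] by (metis imageI)
  next
    fix x assume "x \<in> snd c ` B"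
    then obtain q where "q \<in> B" "x = snd c q" by blast
    then show "x \<in> chart_inv c -` B \<inter> space (restrict_space borel ?S)"
      using B(2) chart_inv_chart[OF c, of q] by (auto simp: space_restrict_space)
  qed
  ultimately show ?thesis using S by (simp add: sets_restrict_space_iff)
qed

text \<open>The density in a chart is the Jacobian of the transition to exponential coordinates, so
  the required formula is the change of variables along this transition.\<close>

lemma is_riemannian_volume_distr: "is_riemannian_volume A g (distr lborel borel \<Phi>)"
  unfolding is_riemannian_volume_def
proof (intro conjI ballI impI)
  fix c and B :: "'g set" assume c: "c \<in> A" and B: "B \<in> sets borel" "B \<subseteq> fst c"
  let ?S = "snd c ` fst c" and ?h = "\<lambda>x. \<Psi> (chart_inv c x)"
  have sm: "smooth_on ?S ?h" by (rule \<Psi>_plot[OF plot_chart_inv[OF c] thick_open[OF chart_image_open[OF c]]])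
  have inj: "inj_on ?h ?S"
  proof (rule inj_onI)
    fix x y assume xy: "x \<in> ?S" "y \<in> ?S" "?h x = ?h y"
    then have "chart_inv c x = chart_inv c y" using \<Phi>_\<Psi> by metis
    then show "x = y" using chart_chart_inv[OF c] xy by metis
  qed
  have im: "?h ` snd c ` B = \<Phi> -` B"
  proof (intro set_eqI iffI)
    fix y assume "y \<in> ?h ` snd c ` B"
    then obtain q where "q \<in> B" "y = \<Psi> (chart_inv c (snd c q))" by blast
    then show "y \<in> \<Phi> -` B" using B(2) chart_inv_chart[OF c, of q] by (auto simp: \<Phi>_\<Psi>)
  next
    fix y assume "y \<in> \<Phi> -` B"
    then have "\<Phi> y \<in> B" by simp
    moreover have "?h (snd c (\<Phi> y)) = y" using \<open>\<Phi> y \<in> B\<close> B(2) chart_inv_chart[OF c, of "\<Phi> y"] by (auto simp: \<Psi>_\<Phi>)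
    ultimately show "y \<in> ?h ` snd c ` B" by (metis imageI)
  qed
  have hB: "?h ` snd c ` B \<in> sets borel" unfolding im using measurable_sets[OF \<Phi>_measurable B(1)] by simp
  have "emeasure (distr lborel borel \<Phi>) B = emeasure lborel (?h ` snd c ` B)"
    unfolding im using B \<Phi>_measurable by (subst emeasure_distr) auto
  also have "\<dots> = (\<integral>\<^sup>+x. ennreal \<bar>det (matrix (frechet_derivative ?h (at x)))\<bar> * indicator (snd c ` B) x \<partial>lborel)"
    by (rule emeasure_smooth_image[OF chart_image_open[OF c] sm inj chart_borel[OF c B] image_mono[OF B(2)] hB])
  also have "\<dots> = (\<integral>\<^sup>+x. ennreal (volume_density A g c x) * indicator (snd c ` B) x \<partial>lborel)"
    by (rule nn_integral_cong) (use B(2) volume_density_eq[OF c] in \<open>auto simp: indicator_def\<close>)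
  finally show "emeasure (distr lborel borel \<Phi>) B = (\<integral>\<^sup>+x. ennreal (volume_density A g c x) * indicator (snd c ` B) x \<partial>lborel)" .
qed simp

text \<open>The defining property only compares Borel sets inside a chart. Second countability
  yields countably many charts that cover the group, and making their domains disjoint cuts any
  Borel set into such pieces.\<close>

lemma riemannian_volume_unique:
  assumes \<mu>: "is_riemannian_volume A g \<mu>" and \<nu>: "is_riemannian_volume A g \<nu>" shows "\<mu> = \<nu>"
proof (rule measure_eqI)
  show s: "sets \<mu> = sets \<nu>" using \<mu> \<nu> unfolding is_riemannian_volume_def by simp
  fix B assume "B \<in> sets \<mu>"
  then have B: "B \<in> sets borel" using \<mu> unfolding is_riemannian_volume_def by simp
  have "\<And>X. X \<in> fst ` A \<Longrightarrow> open X" using chart_open by auto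
  then obtain F where F: "F \<subseteq> fst ` A" "countable F" "\<Union>F = \<Union>(fst ` A)" by (rule Lindelof)
  have UF: "\<Union>F = UNIV" unfolding F(3) using chart_cover by blast
  then have "F \<noteq> {}" by auto
  define X where "X = from_nat_into F"
  have X: "range X = F" unfolding X_def by (rule range_from_nat_into[OF \<open>F \<noteq> {}\<close> F(2)])
  define D where "D j = B \<inter> disjointed X j" for j
  have Xc: "X j \<in> fst ` A" for j using X F(1) by blast
  have Xb: "X j \<in> sets borel" for j using Xc[of j] chart_open by (auto intro: borel_open)
  then have "range X \<subseteq> sets borel" by blast
  then have "range (disjointed X) \<subseteq> sets borel" by (rule sets.range_disjointed_sets)
  then have Db: "D j \<in> sets borel" for j unfolding D_def using B by blast
  have DB: "(\<Union>j. D j) = B" unfolding D_def using UF X by (simp add: UN_disjointed_eq flip: Int_UN_distrib)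
  have dis: "disjoint_family D" unfolding D_def
    using disjoint_family_disjointed[of X] by (auto simp: disjoint_family_on_def)
  have eq: "emeasure \<mu> (D j) = emeasure \<nu> (D j)" for j
  proof -
    obtain c where c: "c \<in> A" "X j = fst c" using Xc by blast
    have "D j \<subseteq> fst c" unfolding D_def c(2)[symmetric] using disjointed_subset[of X j] by blast
    then show ?thesis using \<mu> \<nu> c(1) Db unfolding is_riemannian_volume_def by metis
  qed
  have "emeasure \<mu> B = (\<Sum>j. emeasure \<mu> (D j))"
    unfolding DB[symmetric] by (rule suminf_emeasure[symmetric, OF _ dis]) (use Db \<mu> in \<open>auto simp: is_riemannian_volume_def\<close>)
  also have "\<dots> = (\<Sum>j. emeasure \<nu> (D j))" by (simp only: eq)
  also have "\<dots> = emeasure \<nu> B"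
    unfolding DB[symmetric] by (rule suminf_emeasure[OF _ dis]) (use Db \<nu> in \<open>auto simp: is_riemannian_volume_def\<close>)
  finally show "emeasure \<mu> B = emeasure \<nu> B" .
qed

lemma riemannian_volume_eq: "riemannian_volume A g = distr lborel borel \<Phi>"
  unfolding riemannian_volume_def
  by (rule the_equality[where P = "is_riemannian_volume A g", OF is_riemannian_volume_distr])
    (rule riemannian_volume_unique[OF _ is_riemannian_volume_distr])

text \<open>Left translation preserves Lebesgue measure, so the centre drops out.\<close>

lemma volume_ball: "emeasure (riemannian_volume A g) (riemannian_ball A g p r) = emeasure lborel (coord_ball r)"
proof -
  have b: "coord_ball r \<in> sets borel" by (rule borel_open[OF open_coord_ball])
  have im: "\<Phi> ` X = \<Psi> -` X" for X
    using \<Psi>_\<Phi> \<Phi>_\<Psi> by (auto simp: image_iff) metis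
  have "continuous_on UNIV \<Psi>"
    by (subst continuous_on_componentwise) (auto simp: Basis_vec_def inner_axis intro: smooth_fun_continuous[OF smooth_fun_\<Psi>])
  then have \<Psi>m: "\<Psi> \<in> borel_measurable borel" by (rule borel_measurable_continuous_onI)
  have "\<Phi> ` mul (\<Psi> p) ` coord_ball r \<in> sets borel"
    unfolding im using measurable_sets[OF \<Psi>m emeasure_mul(1)[OF b]] by simp
  then have "emeasure (distr lborel borel \<Phi>) (\<Phi> ` mul (\<Psi> p) ` coord_ball r) = emeasure lborel (\<Phi> -` \<Phi> ` mul (\<Psi> p) ` coord_ball r)"
    using \<Phi>_measurable by (subst emeasure_distr) auto
  also have "\<Phi> -` \<Phi> ` mul (\<Psi> p) ` coord_ball r = mul (\<Psi> p) ` coord_ball r"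
    by (rule inj_vimage_image_eq[OF bij_is_inj[OF \<Phi>_bij]])
  also have "emeasure lborel (mul (\<Psi> p) ` coord_ball r) = emeasure lborel (coord_ball r)" by (rule emeasure_mul(2)[OF b])
  finally show ?thesis unfolding riemannian_volume_eq riemannian_ball_eq .
qed

lemma doubling_ratio_le:
  "emeasure (riemannian_volume A g) (riemannian_ball A g p (2 * r)) /
   emeasure (riemannian_volume A g) (riemannian_ball A g p r) \<le> 2 ^ Q"
proof -
  let ?a = "emeasure lborel (coord_ball (2 * r))" and ?b = "emeasure lborel (coord_ball r)"
  have "?a / ?b \<le> 2 ^ Q * ?b / ?b" by (rule divide_right_mono_ennreal[OF volume_upper_bound])
  also have "\<dots> \<le> 2 ^ Q"
  \<comment> \<open>If \<open>?b\<close> is 0 or infinite, the quotient on the left is 0 by the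
    conventions of \<open>ennreal\<close>.\<close>
  proof (cases "?b = 0 \<or> ?b = top")
    case True
    then show ?thesis by (auto simp: divide_ennreal_def)
  next
    case False
    have "2 ^ Q * ?b / ?b = 2 ^ Q * (?b / ?b)" by (simp add: ennreal_times_divide)
    also have "?b / ?b = 1" by (rule ennreal_divide_self) (use False in \<open>auto simp: less_top\<close>)
    finally show ?thesis by simp
  qed
  finally show ?thesis unfolding volume_ball .
qed

lemma doubling_ratio_sup:
  assumes "\<And>p r. r > 0 \<Longrightarrow> emeasure (riemannian_volume A g) (riemannian_ball A g p (2 * r)) /
   emeasure (riemannian_volume A g) (riemannian_ball A g p r) \<le> s"
  shows "2 ^ Q \<le> s"
  using volume_ratio_sup[OF C_span, of s] assms unfolding volume_ball by blast

end

section \<open>Adapted orthonormal bases\<close>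

text \<open>A left-invariant metric, read at the identity through a chart, is such a form.\<close>

locale inner_form =
  fixes G :: "real^'n::finite \<Rightarrow> real^'n \<Rightarrow> real"
  assumes G_add: "G (x + y) z = G x z + G y z" and G_scale: "G (r *\<^sub>R x) z = r * G x z"
    and G_sym: "G x y = G y x" and G_pos: "x \<noteq> 0 \<Longrightarrow> G x x > 0"
begin

lemma G_scale_right: "G z (r *\<^sub>R x) = r * G z x"
  using G_scale[of r x z] by (simp only: G_sym[of z])

lemma G_0: "G 0 z = 0" "G z 0 = 0"
  using G_scale[of 0 0 z] G_scale_right[of z 0 0] by simp_all

lemma G_sum: "finite I \<Longrightarrow> G (\<Sum>i\<in>I. c i *\<^sub>R f i) z = (\<Sum>i\<in>I. c i * G (f i) z)"
  by (induction I rule: finite_induct) (simp_all add: G_0 G_add G_scale)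

lemma G_sum_right: "finite I \<Longrightarrow> G z (\<Sum>i\<in>I. c i *\<^sub>R f i) = (\<Sum>i\<in>I. c i * G z (f i))"
  using G_sum[of I c f z] by (simp add: G_sym[of z])

definition orthonormal_set :: "(real^'n) set \<Rightarrow> bool"
  where "orthonormal_set B \<longleftrightarrow> finite B \<and> (\<forall>x\<in>B. \<forall>y\<in>B. G x y = (if x = y then 1 else 0))"

lemma orthonormal_sum:
  assumes "orthonormal_set B" "y \<in> B" shows "G (\<Sum>x\<in>B. c x *\<^sub>R x) y = c y"
proof -
  have fin: "finite B" using assms(1) by (simp add: orthonormal_set_def)
  have "G (\<Sum>x\<in>B. c x *\<^sub>R x) y = (\<Sum>x\<in>B. c x * G x y)" by (rule G_sum[OF fin])
  also have "\<dots> = (\<Sum>x\<in>B. if x = y then c x else 0)"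
    by (rule sum.cong) (use assms in \<open>auto simp: orthonormal_set_def\<close>)
  also have "\<dots> = c y" using fin assms(2) by simp
  finally show ?thesis .
qed

lemma orthonormal_independent: assumes "orthonormal_set B" shows "independent B"
proof -
  have fin: "finite B" using assms by (simp add: orthonormal_set_def)
  have "c y = 0" if "(\<Sum>x\<in>B. c x *\<^sub>R x) = 0" "y \<in> B" for c y
    using orthonormal_sum[OF assms that(2), of c] that(1) by (simp add: G_0)
  then show ?thesis unfolding independent_explicit using fin by blast
qed

text \<open>A largest orthonormal set between \<open>B\<close> and \<open>W\<close> spans
  \<open>W\<close>, since otherwise one Gram-Schmidt step would enlarge it.\<close>

lemma orthonormal_extend:
  assumes B: "orthonormal_set B" "B \<subseteq> W" and W: "subspace W"
  obtains B' where "B \<subseteq> B'" "orthonormal_set B'" "span B' = W"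
proof -
  let ?P = "\<lambda>X. orthonormal_set X \<and> B \<subseteq> X \<and> X \<subseteq> W"
  have bound: "\<forall>X. ?P X \<longrightarrow> card X < Suc CARD('n)"
    using independent_bound orthonormal_independent by (fastforce simp: less_Suc_eq_le)
  obtain X where X: "?P X" "\<And>Y. ?P Y \<Longrightarrow> card Y \<le> card X"
    using ex_has_greatest_nat[of ?P B card "Suc CARD('n)"] B bound by blast
  have fin: "finite X" using X(1) by (simp add: orthonormal_set_def)
  have "W \<subseteq> span X"
  proof (rule ccontr)
    assume "\<not> W \<subseteq> span X"
    then obtain w where w: "w \<in> W" "w \<notin> span X" by blast
    define s where "s = (\<Sum>x\<in>X. G w x *\<^sub>R x)"
    define v where "v = w + (-1) *\<^sub>R s"
    have s: "s \<in> span X" unfolding s_def by (intro span_sum span_scale span_base)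
    have "v \<noteq> 0" using w s by (auto simp: v_def)
    then have pos: "G v v > 0" by (rule G_pos)
    have orth: "G v y = 0" if "y \<in> X" for y
    proof -
      have "G s y = G w y" unfolding s_def using X(1) that by (intro orthonormal_sum) auto
      then show ?thesis unfolding v_def G_add G_scale by simp
    qed
    define u where "u = (1 / sqrt (G v v)) *\<^sub>R v"
    have uu: "G u u = 1" using pos by (simp add: u_def G_scale G_scale_right)
    have uy: "G u y = 0" "G y u = 0" if "y \<in> X" for y using orth[OF that] G_sym[of y v] by (simp_all add: u_def G_scale G_scale_right)
    have "u \<notin> X" using uu uy by force
    have "s \<in> W" using s X(1) W by (meson span_minimal subsetD)
    then have "u \<in> W" unfolding u_def v_def using w(1) W by (intro subspace_scale subspace_add) auto
    then have "?P (insert u X)" using X(1) uu uy fin by (auto simp: orthonormal_set_def)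
    then have "card (insert u X) \<le> card X" by (rule X(2))
    then show False using fin \<open>u \<notin> X\<close> by simp
  qed
  moreover have "span X \<subseteq> W" using X(1) W by (simp add: span_minimal)
  ultimately show ?thesis using that[of X] X(1) by blast
qed

text \<open>An orthonormal basis of \<open>S\<close> is extended to the whole space, and
  \<open>J\<close> indexes the vectors that come from \<open>S\<close>. The remaining ones are
  orthogonal to \<open>S\<close>, so the components of \<open>x\<close> along them vanish exactly
  when \<open>T x\<close> lies in \<open>S\<close>.\<close>

lemma adapted_basis:
  assumes S: "subspace S"
  obtains T :: "real^'n \<Rightarrow> real^'n" and J where "linear T" "bij T" "card J = dim S" "\<And>x. T x \<in> S \<longleftrightarrow> (\<forall>i. i \<notin> J \<longrightarrow> x $ i = 0)"
    "\<And>a b. G (T a) (T b) = a \<bullet> b"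
proof -
  have "orthonormal_set {}" by (simp add: orthonormal_set_def)
  then obtain B2 where B2: "orthonormal_set B2" "span B2 = S"
    by (rule orthonormal_extend[OF _ _ S]) auto
  obtain B where B: "B2 \<subseteq> B" "orthonormal_set B" "span B = UNIV"
    by (rule orthonormal_extend[OF B2(1) subset_UNIV subspace_UNIV])
  have fin: "finite B" using B(2) by (simp add: orthonormal_set_def)
  have "card B = CARD('n)"
    using basis_card_eq_dim[of B UNIV] orthonormal_independent[OF B(2)] B(3) by simp
  then obtain \<beta> where \<beta>: "bij_betw \<beta> (UNIV :: 'n set) B"
    using finite_same_card_bij[OF finite_class.finite_UNIV fin] by metis
  have \<beta>B: "\<beta> i \<in> B" for i using \<beta> bij_betwE by blast
  have \<beta>i: "\<beta> i = \<beta> j \<longleftrightarrow> i = j" for i j using \<beta> by (auto simp: bij_betw_def inj_on_def)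
  define J where "J = {i. \<beta> i \<in> B2}"
  define T where "T x = (\<Sum>i\<in>UNIV. (x $ i) *\<^sub>R \<beta> i)" for x :: "real^'n"
  have T: "linear T" unfolding T_def
    by (rule linearI) (simp_all add: scaleR_add_left sum.distrib scaleR_sum_right)
  have G\<beta>: "G (\<beta> i) (\<beta> j) = (if i = j then 1 else 0)" for i j
    using B(2) \<beta>B \<beta>i unfolding orthonormal_set_def by auto
  have GT: "G (T a) (T b) = a \<bullet> b" for a b
    by (simp add: T_def G_sum G_sum_right G\<beta> inner_vec_def if_distrib mult.commute cong: if_cong)
  have inj: "inj T"
  proof (subst linear_injective_0[OF T], intro allI impI)
    fix x assume "T x = 0"
    then have "x \<bullet> x = 0" using GT[of x x] by (simp add: G_0)
    then show "x = 0" by simp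
  qed
  then have bij: "bij T" using linear_injective_imp_surjective[OF T inj] by (simp add: bij_def)
  have cJ: "card J = dim S"
  proof -
    have "\<beta> ` J = B2" using \<beta> B(1) by (auto simp: J_def bij_betw_def)
    moreover have "inj_on \<beta> J" using \<beta>i by (auto simp: inj_on_def)
    ultimately have "card J = card B2" using card_image by metis
    also have "\<dots> = dim S"
    proof (rule dim_eq_card[symmetric])
      show "span B2 = span S" by (simp only: B2(2) span_eq_iff[THEN iffD2, OF S])
    qed (rule orthonormal_independent[OF B2(1)])
    finally show ?thesis .
  qed
  have "T x \<in> S \<longleftrightarrow> (\<forall>i. i \<notin> J \<longrightarrow> x $ i = 0)" for x
  proof
    assume x: "\<forall>i. i \<notin> J \<longrightarrow> x $ i = 0"
    have "(x $ i) *\<^sub>R \<beta> i \<in> S" for i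
      using x S B2(2) span_base[of "\<beta> i" B2] by (cases "i \<in> J") (auto simp: J_def subspace_scale subspace_0)
    then show "T x \<in> S" unfolding T_def by (intro subspace_sum[OF S])
  next
    assume "T x \<in> S"
    then have "T x \<in> span B2" using B2(2) by simp
    show "\<forall>i. i \<notin> J \<longrightarrow> x $ i = 0"
    proof (intro allI impI)
      fix i assume i: "i \<notin> J"
      have z: "G y (\<beta> i) = 0" if "y \<in> span B2" for y
        using that
      proof (induction rule: span_induct_alt)
        case (step c y z)
        have "y \<noteq> \<beta> i" using step(1) i by (auto simp: J_def)
        then have "G y (\<beta> i) = 0" using B(1,2) step(1) \<beta>B unfolding orthonormal_set_def by auto
        then show ?case using step by (simp add: G_add G_scale)
      qed (simp add: G_0)
      have "(axis i 1 $ k) *\<^sub>R \<beta> k = (if k = i then \<beta> k else 0)" for k by (simp add: axis_def)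
      then have "T (axis i 1) = \<beta> i" by (simp add: T_def)
      then show "x $ i = 0" using GT[of x "axis i 1"] z[OF \<open>T x \<in> span B2\<close>] by (simp add: inner_axis)
    qed
  qed
  from that[OF T bij cJ this GT] show ?thesis .
qed

end

section \<open>Step-two stratifications\<close>

text \<open>Transfers dimensions from the function space of vector fields to the coordinate
  space.\<close>

lemma dim_vimage:
  fixes f :: "real^'n::finite \<Rightarrow> 'b::real_vector"
  assumes f: "linear f" "inj f" and V: "subspace V" "V \<subseteq> range f"
  shows "subspace (f -` V)" "dim (f -` V) = dim V"
proof -
  show S: "subspace (f -` V)" by (rule linear_subspace_vimage[OF f(1) V(1)])
  obtain B where B: "B \<subseteq> f -` V" "independent B" "f -` V \<subseteq> span B" "card B = dim (f -` V)" using basis_exists by metis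
  have sB: "span B = f -` V" using B S by (simp add: span_subspace)
  have "span (f ` B) = f ` (f -` V)" using linear_span_image[OF f(1), of B] sB by simp
  also have "\<dots> = V" using V(2) by auto
  finally have sf: "span (f ` B) = V" .
  have "independent (f ` B)" by (rule linear_independent_injective_image[OF f(1) B(2) inj_on_subset[OF f(2) subset_UNIV]])
  moreover have "span (f ` B) = span V" by (simp only: sf span_eq_iff[THEN iffD2, OF V(1)])
  ultimately have "dim V = card (f ` B)" by (intro dim_eq_card)
  also have "\<dots> = card B" using f(2) by (intro card_image) (auto simp: inj_on_def)
  finally show "dim (f -` V) = dim V" using B(4) by simp
qed

context lie
begin

lemma tangent_diff:
  assumes v: "v \<in> tangent_space A p" and f: "smooth_fun A f" and h: "smooth_fun A h"
  shows "v (\<lambda>x. f x - h x) = v f - v h"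
proof -
  have mh: "smooth_fun A (\<lambda>x. (-1) * h x)" by (rule smooth_fun_mult[OF smooth_fun_const h])
  have "v (\<lambda>x. f x + (-1) * h x) = v f + (-1) * v h"
    unfolding tangent_add[OF v f mh] tangent_scale[OF v h] ..
  then show ?thesis by simp
qed

text \<open>An instance of the Jacobi identity. As \<open>Z\<close> commutes with \<open>X\<close>
  and \<open>Y\<close> as operators, it can be moved through both of them in
  \<open>lie_bracket X Y\<close>.\<close>

lemma lie_bracket_commuting:
  assumes X: "X \<in> lie_algebra A" and Y: "Y \<in> lie_algebra A" and Z: "Z \<in> lie_algebra A"
    and XZ: "lie_bracket X Z = 0" and YZ: "lie_bracket Y Z = 0"
  shows "lie_bracket (lie_bracket X Y) Z = 0"
proof -
  have XZ': "X p (\<lambda>q. Z q h) = Z p (\<lambda>q. X q h)" and YZ': "Y p (\<lambda>q. Z q h) = Z p (\<lambda>q. Y q h)" for p h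
    using fun_cong[OF fun_cong[OF XZ], of p h] fun_cong[OF fun_cong[OF YZ], of p h] by (simp_all add: lie_bracket_def)
  have split: "Z p (\<lambda>q. X q (\<lambda>r. Y r f) - Y q (\<lambda>r. X r f)) = Z p (\<lambda>q. X q (\<lambda>r. Y r f)) - Z p (\<lambda>q. Y q (\<lambda>r. X r f))" for p f
  proof (cases "smooth_fun A f")
    case True
    show ?thesis
      by (rule tangent_diff[OF lie_algebra_tangent[OF Z]])
        (intro lie_algebra_smooth[OF X] lie_algebra_smooth[OF Y] True)+
  next
    case False
    then show ?thesis
      by (simp add: lie_algebra_nonsmooth[OF X] lie_algebra_nonsmooth[OF Y] tangent_const[OF lie_algebra_tangent[OF X]]
          tangent_const[OF lie_algebra_tangent[OF Y]] tangent_const[OF lie_algebra_tangent[OF Z]])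
  qed
  have "lie_bracket (lie_bracket X Y) Z p f = 0" for p f
    unfolding lie_bracket_def by (simp only: split YZ' XZ' diff_self)
  then show ?thesis by (simp add: fun_eq_iff)
qed

lemma stratification_subset:
  assumes "step_two_stratification A V1 V2"
  shows "V1 \<subseteq> lie_algebra A" "V2 \<subseteq> lie_algebra A"
proof -
  have s: "subspace V1" "subspace V2" "{X + Y | X Y. X \<in> V1 \<and> Y \<in> V2} = lie_algebra A"
    using assms unfolding step_two_stratification_def by auto
  show "V1 \<subseteq> lie_algebra A"
  proof
    fix X assume "X \<in> V1"
    then have "X + 0 \<in> lie_algebra A" unfolding s(3)[symmetric] using subspace_0[OF s(2)] by blast
    then show "X \<in> lie_algebra A" by simp
  qed
  show "V2 \<subseteq> lie_algebra A"
  proof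
    fix X assume "X \<in> V2"
    then have "0 + X \<in> lie_algebra A" unfolding s(3)[symmetric] using subspace_0[OF s(1)] by blast
    then show "X \<in> lie_algebra A" by simp
  qed
qed

text \<open>A stratification is only required to have its first layer commute with its second. The
  second layer commutes with itself because its elements are combinations of brackets from
  \<open>V1\<close>, to which \<open>lie_bracket_commuting\<close> applies. Both claims then follow
  by splitting into layers.\<close>

lemma stratification_bracket:
  assumes st: "step_two_stratification A V1 V2"
  shows "X \<in> lie_algebra A \<Longrightarrow> Z \<in> V2 \<Longrightarrow> lie_bracket X Z = 0"
    and "X \<in> lie_algebra A \<Longrightarrow> Y \<in> lie_algebra A \<Longrightarrow> lie_bracket X Y \<in> V2"
proof -
  note sub = stratification_subset[OF st]
  have s: "subspace V1" "subspace V2" "{X + Y | X Y. X \<in> V1 \<and> Y \<in> V2} = lie_algebra A"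
    "span {lie_bracket X Y | X Y. X \<in> V1 \<and> Y \<in> V1} = V2" "\<And>X Y. X \<in> V1 \<Longrightarrow> Y \<in> V2 \<Longrightarrow> lie_bracket X Y = 0"
    using st unfolding step_two_stratification_def by auto
  have z: "lie_bracket 0 Z = 0" if "Z \<in> lie_algebra A" for Z
    using tangent_const[OF lie_algebra_tangent[OF that], of _ 0] by (simp add: lie_bracket_def fun_eq_iff)
  have V22: "lie_bracket W Z = 0" if Z: "Z \<in> V2" and W: "W \<in> V2" for W Z
  proof -
    have "W \<in> span {lie_bracket X Y | X Y. X \<in> V1 \<and> Y \<in> V1}" using W s(4) by simp
    \<comment> \<open>Membership in \<open>V2\<close> is carried along because the additivity of the
      bracket is available for elements of the Lie algebra.\<close>
    then have "W \<in> V2 \<and> lie_bracket W Z = 0"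
    proof (induction rule: span_induct_alt)
      case base
      show ?case using z Z sub subspace_0[OF s(2)] by blast
    next
      case (step c X Y)
      then obtain X1 X2 where X: "X = lie_bracket X1 X2" "X1 \<in> V1" "X2 \<in> V1" by blast
      have XV: "X \<in> V2" unfolding s(4)[symmetric] using step(1) by (rule span_base)
      have X0: "lie_bracket X Z = 0" unfolding X(1)
        by (rule lie_bracket_commuting) (use X sub Z s(5) in auto)
      have cX: "c *\<^sub>R X \<in> V2" by (rule subspace_scale[OF s(2) XV])
      have mem: "c *\<^sub>R X \<in> lie_algebra A" "X \<in> lie_algebra A" "Y \<in> lie_algebra A" "Z \<in> lie_algebra A"
        using cX XV step(2) Z sub(2) by auto
      have "lie_bracket (c *\<^sub>R X + Y) Z = c *\<^sub>R lie_bracket X Z + lie_bracket Y Z"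
        unfolding lie_bracket_add_left[OF mem(1,3,4)] lie_bracket_scale_left[OF mem(2,4)] ..
      also have "\<dots> = 0" unfolding X0 conjunct2[OF step(2)] by (simp only: scaleR_zero_right add_0_right)
      finally show ?case using subspace_add[OF s(2) cX conjunct1[OF step(2)]] by blast
    qed
    then show ?thesis by blast
  qed
  have central: "lie_bracket X Z = 0" if X: "X \<in> lie_algebra A" and Z: "Z \<in> V2" for X Z
  proof -
    obtain X1 X2 where X12: "X = X1 + X2" "X1 \<in> V1" "X2 \<in> V2" using X s(3) by blast
    then have "lie_bracket X Z = lie_bracket X1 Z + lie_bracket X2 Z"
      unfolding X12(1) using sub Z by (intro lie_bracket_add_left) auto
    also have "\<dots> = 0" unfolding s(5)[OF X12(2) Z] V22[OF Z X12(3)] by (rule add_0_right)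
    finally show ?thesis .
  qed
  show "X \<in> lie_algebra A \<Longrightarrow> Z \<in> V2 \<Longrightarrow> lie_bracket X Z = 0" by (rule central)
  assume X: "X \<in> lie_algebra A" and Y: "Y \<in> lie_algebra A"
  obtain X1 X2 where X12: "X = X1 + X2" "X1 \<in> V1" "X2 \<in> V2" using X s(3) by blast
  obtain Y1 Y2 where Y12: "Y = Y1 + Y2" "Y1 \<in> V1" "Y2 \<in> V2" using Y s(3) by blast
  have mem: "X1 \<in> lie_algebra A" "X2 \<in> lie_algebra A" "Y1 \<in> lie_algebra A" "Y2 \<in> lie_algebra A"
    using X12 Y12 sub by auto
  have "lie_bracket X Y = lie_bracket X1 Y + lie_bracket X2 Y" unfolding X12(1) by (rule lie_bracket_add_left[OF mem(1,2) Y])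
  also have "lie_bracket X2 Y = 0" using lie_bracket_antisym[of X2 Y] central[OF Y X12(3)] by simp
  also have "lie_bracket X1 Y = - lie_bracket Y X1" by (rule lie_bracket_antisym)
  also have "lie_bracket Y X1 = lie_bracket Y1 X1 + lie_bracket Y2 X1" unfolding Y12(1) by (rule lie_bracket_add_left[OF mem(3,4,1)])
  also have "lie_bracket Y2 X1 = 0" using lie_bracket_antisym[of Y2 X1] central[OF mem(1) Y12(3)] by simp
  finally have "lie_bracket X Y = - lie_bracket Y1 X1" by (simp only: add_0_right)
  moreover have "lie_bracket Y1 X1 \<in> V2" unfolding s(4)[symmetric] using X12(2) Y12(2) by (intro span_base) blast
  ultimately show "lie_bracket X Y \<in> V2" using subspace_neg[OF s(2)] by simp
qed

lemma left_field_range: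
  assumes c: "c \<in> A" "0 \<in> fst c" shows "range (\<lambda>w. left_field (chart_vector c 0 w)) = lie_algebra A"
proof (intro set_eqI iffI)
  fix X assume "X \<in> range (\<lambda>w. left_field (chart_vector c 0 w))"
  then show "X \<in> lie_algebra A" using left_field_in_lie_algebra[OF chart_vector_tangent[OF c]] by blast
next
  fix X assume X: "X \<in> lie_algebra A"
  obtain w where "X 0 = chart_vector c 0 w" by (rule tangent_eq_chart_vector[OF c lie_algebra_eq_left_field(2)[OF X]])
  then have "X = left_field (chart_vector c 0 w)" using lie_algebra_eq_left_field(1)[OF X] by simp
  then show "X \<in> range (\<lambda>w. left_field (chart_vector c 0 w))" by blast
qed

text \<open>\<open>G\<close> is arbitrary because the lemma serves twice: with the inner product of
  a given metric, and with the Euclidean one before any metric is known to exist.\<close>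

lemma stratification_frame:
  assumes st: "step_two_stratification A V1 V2" and c: "c \<in> A" "0 \<in> fst c"
    and conn: "connected (UNIV :: 'g set)" "simply_connected (UNIV :: 'g set)"
    and G: "inner_form G"
  obtains T J C where "carnot A c T J C" "\<And>j. j \<in> J \<Longrightarrow> axis j 1 \<in> span (range (\<lambda>(a, b). C a b))"
    "\<And>a b. G (T a) (T b) = a \<bullet> b" "card (- J) + 2 * card J = homogeneous_dim V1 V2"
proof -
  let ?f = "\<lambda>w. left_field (chart_vector c 0 w)"
  note lin = left_field_linear[OF c] and inj = left_field_inj[OF c] and ran = left_field_range[OF c]
  note sub = stratification_subset[OF st] and br = stratification_bracket[OF st]
  have s: "subspace V1" "subspace V2" "{X + Y | X Y. X \<in> V1 \<and> Y \<in> V2} = lie_algebra A" "V1 \<inter> V2 = {0}"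
    "span {lie_bracket X Y | X Y. X \<in> V1 \<and> Y \<in> V1} = V2"
    using st unfolding step_two_stratification_def by auto
  let ?S1 = "?f -` V1" and ?S2 = "?f -` V2"
  have S1: "subspace ?S1" "dim ?S1 = dim V1" using dim_vimage[OF lin inj s(1)] sub ran by auto
  have S2: "subspace ?S2" "dim ?S2 = dim V2" using dim_vimage[OF lin inj s(2)] sub ran by auto
  \<comment> \<open>The indices outside \<open>J\<close> belong to a complement of the second layer
    that may differ from \<open>V1\<close>. This count identifies their number with
    \<open>dim V1\<close>.\<close>
  have dims: "dim V1 + dim V2 = CARD('n)"
  proof -
    have "{x + y |x y. x \<in> ?S1 \<and> y \<in> ?S2} = UNIV"
    proof (intro set_eqI iffI UNIV_I)
      fix w
      have "?f w \<in> lie_algebra A" unfolding ran[symmetric] by (rule rangeI)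
      then obtain X Y where XY: "?f w = X + Y" "X \<in> V1" "Y \<in> V2" using s(3) by blast
      obtain x y where xy: "X = ?f x" "Y = ?f y" using XY sub ran by blast
      have "?f w = ?f (x + y)" using XY(1) xy linear_add[OF lin, of x y] by simp
      then have "w = x + y" by (rule injD[OF inj])
      then show "w \<in> {x + y |x y. x \<in> ?S1 \<and> y \<in> ?S2}" using XY xy by blast
    qed
    moreover have "?S1 \<inter> ?S2 = {0}"
    proof (intro set_eqI iffI)
      fix w assume "w \<in> ?S1 \<inter> ?S2"
      then have "?f w \<in> V1 \<inter> V2" by simp
      then have "?f w = ?f 0" unfolding s(4) linear_0[OF lin] by simp
      then show "w \<in> {0}" using injD[OF inj] by blast
    qed (use subspace_0[OF S1(1)] subspace_0[OF S2(1)] in simp)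
    ultimately show ?thesis using dim_sums_Int[OF S1(1) S2(1)] S1(2) S2(2) by simp
  qed
  obtain T :: "real^'n \<Rightarrow> real^'n" and J where T: "linear T" "bij T" and cJ: "card J = dim ?S2"
    and TJ: "\<And>x. T x \<in> ?S2 \<longleftrightarrow> (\<forall>i. i \<notin> J \<longrightarrow> x $ i = 0)" and GT: "\<And>a b. G (T a) (T b) = a \<bullet> b"
    by (rule inner_form.adapted_basis[OF G S2(1)]; (rule that; assumption))
  define h where "h a = ?f (T a)" for a
  have h: "linear h" unfolding h_def[abs_def] using linear_compose[OF T(1) lin] by (simp add: comp_def)
  have h_inj: "inj h" unfolding h_def[abs_def] using inj_compose[OF inj bij_is_inj[OF T(2)]] by (simp add: comp_def)
  have h_in: "h a \<in> lie_algebra A" for a unfolding h_def ran[symmetric] by (rule rangeI)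
  have h_sur: "\<exists>a. X = h a" if "X \<in> lie_algebra A" for X
  proof -
    have "X \<in> range ?f" unfolding ran by (rule that)
    then obtain w where w: "X = ?f w" by (rule rangeE)
    obtain a where "w = T a" using surjD[OF bij_is_surj[OF T(2)], of w] by (rule exE)
    then have "X = h a" unfolding w h_def by (rule arg_cong)
    then show ?thesis by (rule exI)
  qed
  have h2: "h x \<in> V2 \<longleftrightarrow> (\<forall>i. i \<notin> J \<longrightarrow> x $ i = 0)" for x using TJ[of x] by (simp add: h_def)
  have "\<exists>u. lie_bracket (h a) (h b) = h u" for a b using h_sur br(2)[OF h_in h_in] sub by blast
  then obtain C where C: "\<And>a b. lie_bracket (h a) (h b) = h (C a b)" by metis
  have Cadd: "C (a + a') b = C a b + C a' b" for a a' b
  proof (rule injD[OF h_inj])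
    show "h (C (a + a') b) = h (C a b + C a' b)"
      unfolding linear_add[OF h] C[symmetric] by (rule lie_bracket_add_left[OF h_in h_in h_in])
  qed
  have Cscale: "C (r *\<^sub>R a) b = r *\<^sub>R C a b" for r a b
  proof (rule injD[OF h_inj])
    show "h (C (r *\<^sub>R a) b) = h (r *\<^sub>R C a b)"
      unfolding linear_scale[OF h] C[symmetric] by (rule lie_bracket_scale_left[OF h_in h_in])
  qed
  have Canti: "C a b = - C b a" for a b
  proof (rule injD[OF h_inj])
    show "h (C a b) = h (- C b a)" unfolding linear_neg[OF h] C[symmetric] by (rule lie_bracket_antisym)
  qed
  have Cadd': "C b (a + a') = C b a + C b a'" for a a' b
    using Canti[of b "a + a'"] Canti[of b a] Canti[of b a'] Cadd[of a a' b] by simp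
  have Cscale': "C b (r *\<^sub>R a) = r *\<^sub>R C b a" for r a b
    using Canti[of b "r *\<^sub>R a"] Canti[of b a] Cscale[of r a b] by simp
  have Cbil: "bilinear C" unfolding bilinear_def by (auto intro!: linearI simp: Cadd Cscale Cadd' Cscale')
  have CJ: "C a b $ i = 0" if "i \<notin> J" for a b i
  proof -
    have "h (C a b) \<in> V2" unfolding C[symmetric] by (rule br(2)[OF h_in h_in])
    then show ?thesis using that unfolding h2 by blast
  qed
  have Ccen: "C a b = 0" if "\<And>i. i \<notin> J \<Longrightarrow> a $ i = 0" for a b
  proof -
    have "h a \<in> V2" unfolding h2 using that by blast
    then have "h (C b a) = h 0" unfolding C[symmetric] linear_0[OF h] by (rule br(1)[OF h_in])
    then have "C b a = 0" by (rule injD[OF h_inj])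
    then show ?thesis using Canti[of a b] by simp
  qed
  have car: "carnot A c T J C"
    by unfold_locales (use c T Cbil CJ Ccen conn C in \<open>auto simp: h_def linear_add[OF T(1)] linear_scale[OF T(1)]\<close>)
  have sp: "axis j 1 \<in> span (range (\<lambda>(a, b). C a b))" if j: "j \<in> J" for j
  proof -
    have "h (axis j 1) \<in> V2" unfolding h2 using j by (auto simp: axis_def)
    moreover have "{lie_bracket X Y | X Y. X \<in> V1 \<and> Y \<in> V1} \<subseteq> h ` range (\<lambda>(a, b). C a b)"
    proof
      fix Z assume "Z \<in> {lie_bracket X Y | X Y. X \<in> V1 \<and> Y \<in> V1}"
      then obtain X Y where XY: "Z = lie_bracket X Y" "X \<in> V1" "Y \<in> V1" by blast
      obtain a b where "X = h a" "Y = h b" using h_sur XY sub by blast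
      then have "Z = h (case (a, b) of (a, b) \<Rightarrow> C a b)" using XY C by simp
      then show "Z \<in> h ` range (\<lambda>(a, b). C a b)" by blast
    qed
    then have "V2 \<subseteq> span (h ` range (\<lambda>(a, b). C a b))" unfolding s(5)[symmetric] by (rule span_mono)
    moreover have "span (h ` range (\<lambda>(a, b). C a b)) = h ` span (range (\<lambda>(a, b). C a b))" by (rule linear_span_image[OF h])
    ultimately obtain u where "u \<in> span (range (\<lambda>(a, b). C a b))" "h (axis j 1) = h u" by blast
    then show ?thesis using injD[OF h_inj] by metis
  qed
  have cd: "card (- J) + 2 * card J = homogeneous_dim V1 V2"
  proof -
    have "card J + card (- J) = card (J \<union> - J)" by (rule card_Un_disjoint[symmetric]) auto
    then have "card J + card (- J) = CARD('n)" by simp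
    then show ?thesis using cJ S2(2) dims by (simp add: homogeneous_dim_def)
  qed
  from that[OF car sp GT cd] show ?thesis .
qed

end

section \<open>Existence of a left-invariant metric\<close>

context carnot
begin

text \<open>The metric is the one that makes the frame orthonormal at every point. The map
  \<open>w\<close> recovers the exponential coordinates of a tangent vector from its values on the
  coordinate functions, which gives \<open>g\<close> by an explicit formula and makes its linearity
  and smoothness visible.\<close>

lemma left_invariant_metric_exists: "\<exists>g. g \<in> left_invariant_metrics A"
proof -
  define w where "w u = (\<chi> i. u (\<lambda>q. \<Psi> q $ i))" for u :: "'g tvec"
  define g where "g p u v = \<xi> (\<Psi> p) (w u) \<bullet> \<xi> (\<Psi> p) (w v)" for p :: 'g and u v :: "'g tvec"
  have w_tv: "w (tv p x) = x" for p x by (simp add: w_def tv_\<Psi> vec_eq_iff)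
  have w_add: "w (u + v) = w u + w v" and w_scale: "w (r *\<^sub>R u) = r *\<^sub>R w u" for u v r
    by (simp_all add: w_def vec_eq_iff scaleR_fun_def)
  interpret \<xi>: bounded_linear "\<xi> x" for x by (rule \<xi>_linear)
  have pos: "g p u u > 0" if u: "u \<in> tangent_space A p" "u \<noteq> 0" for p u
  proof -
    obtain x where x: "u = tv p x" by (rule tangent_eq_tv[OF u(1)])
    have "\<xi> (\<Psi> p) x \<noteq> 0"
    proof
      assume "\<xi> (\<Psi> p) x = 0"
      then have "x = 0" using \<xi>_inverse[of "\<Psi> p" x] by (simp add: C.zero_right)
      moreover have "tv p 0 f = 0" for f
        using linear_0[OF has_derivative_linear[OF tv_derivative[of f p]]] by (cases "smooth_fun A f") (auto simp: tv_def)
      ultimately show False using u(2) x by (auto simp: fun_eq_iff)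
    qed
    then show ?thesis by (simp add: g_def x w_tv)
  qed
  have smooth: "smooth_fun A (\<lambda>p. g p (X p) (Y p))" if X: "smooth_vector_field A X" and Y: "smooth_vector_field A Y" for X Y
  proof (rule smooth_funI)
    fix c assume c: "c \<in> A"
    let ?S = "snd c ` fst c"
    have sw: "smooth_on ?S (\<lambda>x. w (X (chart_inv c x)))" if X: "smooth_vector_field A X" for X
    proof (rule smooth_on_vec)
      fix i
      have "smooth_fun A (\<lambda>p. X p (\<lambda>q. \<Psi> q $ i))" using X smooth_fun_\<Psi> unfolding smooth_vector_field_def by blast
      from smooth_fun_chart[OF c this] show "smooth_on ?S (\<lambda>x. w (X (chart_inv c x)) $ i)" by (simp add: w_def)
    qed
    have sp: "smooth_on ?S (\<lambda>x. \<Psi> (chart_inv c x))"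
      by (rule \<Psi>_plot[OF plot_chart_inv[OF c] thick_open[OF chart_image_open[OF c]]])
    show "smooth_on ?S (\<lambda>x. g (chart_inv c x) (X (chart_inv c x)) (Y (chart_inv c x)))"
      unfolding g_def by (rule smooth_on_inner[OF \<xi>_smooth[OF sp sw[OF X]] \<xi>_smooth[OF sp sw[OF Y]]])
  qed
  have inv: "g (a + p) (dL a u) (dL a v) = g p u v" if u: "u \<in> tangent_space A p" and v: "v \<in> tangent_space A p" for a p u v
  proof -
    obtain x where x: "u = tv p x" by (rule tangent_eq_tv[OF u])
    obtain y where y: "v = tv p y" by (rule tangent_eq_tv[OF v])
    show ?thesis by (simp add: x y dL_tv g_def w_tv \<Psi>_add \<xi>_left)
  qed
  have "g p u v = g p v u" for p u v by (simp add: g_def inner_commute)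
  moreover have "g p (u + v) x = g p u x + g p v x" for p u v x by (simp add: g_def w_add \<xi>.add inner_add_left)
  moreover have "g p (r *\<^sub>R u) v = r * g p u v" for p r u v by (simp add: g_def w_scale \<xi>.scaleR)
  ultimately have "riemannian_metric A g" unfolding riemannian_metric_def using pos smooth by blast
  then have "g \<in> left_invariant_metrics A" unfolding left_invariant_metrics_def using inv by blast
  then show ?thesis by blast
qed

end

context lie
begin

lemma metric_inner_form:
  assumes g: "g \<in> left_invariant_metrics A" and c: "c \<in> A" "0 \<in> fst c"
  shows "inner_form (\<lambda>a b. g 0 (chart_vector c 0 a) (chart_vector c 0 b))"
proof -
  note l = chart_vector_linear[OF c] and t = chart_vector_tangent[OF c]
  have r: "riemannian_metric A g" using g unfolding left_invariant_metrics_def by blast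
  have nz: "chart_vector c 0 x \<noteq> 0" if "x \<noteq> 0" for x
    using chart_vector_inj[OF c, of x 0] that linear_0[OF l] by auto
  show ?thesis
  proof
    fix x y z :: "real^'n" and s :: real
    show "g 0 (chart_vector c 0 (x + y)) (chart_vector c 0 z) = g 0 (chart_vector c 0 x) (chart_vector c 0 z) + g 0 (chart_vector c 0 y) (chart_vector c 0 z)"
      unfolding linear_add[OF l] using r t unfolding riemannian_metric_def by blast
    show "g 0 (chart_vector c 0 (s *\<^sub>R x)) (chart_vector c 0 z) = s * g 0 (chart_vector c 0 x) (chart_vector c 0 z)"
      unfolding linear_scale[OF l] using r t unfolding riemannian_metric_def by blast
    show "g 0 (chart_vector c 0 x) (chart_vector c 0 y) = g 0 (chart_vector c 0 y) (chart_vector c 0 x)"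
      using r t unfolding riemannian_metric_def by blast
    show "x \<noteq> 0 \<Longrightarrow> g 0 (chart_vector c 0 x) (chart_vector c 0 x) > 0"
      using r t nz unfolding riemannian_metric_def by blast
  qed
qed

lemma stratification_metric:
  assumes st: "step_two_stratification A V1 V2"
    and conn: "connected (UNIV :: 'g set)" "simply_connected (UNIV :: 'g set)"
    and g: "g \<in> left_invariant_metrics A"
  obtains c T J C where "carnot_metric A c T J C g" "card (- J) + 2 * card J = homogeneous_dim V1 V2"
proof -
  obtain c where c: "c \<in> A" "0 \<in> fst c" using chart_cover by blast
  obtain T J C where C: "carnot A c T J C" "\<And>j. j \<in> J \<Longrightarrow> axis j 1 \<in> span (range (\<lambda>(a, b). C a b))"
    "\<And>a b. g 0 (chart_vector c 0 (T a)) (chart_vector c 0 (T b)) = a \<bullet> b" "card (- J) + 2 * card J = homogeneous_dim V1 V2"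
    by (rule stratification_frame[OF st c conn metric_inner_form[OF g c]]; (rule that; assumption))
  interpret carnot A c T J C by (rule C(1))
  have "carnot_metric A c T J C g"
    by unfold_locales (use g C(2,3) in \<open>auto simp: frame_def left_field_def dL_0\<close>)
  then show ?thesis using that C(4) by blast
qed

end

section \<open>The value of the doubling constant\<close>

theorem theorem1:
  fixes A :: "('g::{topological_group_add, t2_space, second_countable_topology}, 'n::finite) chart set"
    and V1 V2 :: "('g \<Rightarrow> 'g tvec) set"
  assumes "step_two_carnot_group A"
    and "step_two_stratification A V1 V2"
  shows "doubling_constant A = 2 ^ homogeneous_dim V1 V2"
proof -
  have lie: "lie A" and conn: "connected (UNIV :: 'g set)" "simply_connected (UNIV :: 'g set)"
    using assms(1) unfolding step_two_carnot_group_def lie_def by auto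
  let ?ratio = "\<lambda>g p r. emeasure (riemannian_volume A g) (riemannian_ball A g p (2 * r)) /
    emeasure (riemannian_volume A g) (riemannian_ball A g p r)"
  have upper: "?ratio g p r \<le> 2 ^ homogeneous_dim V1 V2" if g: "g \<in> left_invariant_metrics A" for g p r
  proof -
    obtain c T J C where C: "carnot_metric A c T J C g" "card (- J) + 2 * card J = homogeneous_dim V1 V2"
      by (rule lie.stratification_metric[OF lie assms(2) conn g])
    interpret carnot_metric A c T J C g by (rule C(1))
    show ?thesis using doubling_ratio_le[of p r] C(2) by (simp add: Q_def)
  qed
  \<comment> \<open>Without a metric the supremum would range over an empty family and be 0.\<close>
  have "\<exists>g. g \<in> left_invariant_metrics A"
  proof -
    obtain c where c: "c \<in> A" "0 \<in> fst c" using lie.chart_cover[OF lie] by blast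
    have "inner_form (\<lambda>a b :: real^'n. a \<bullet> b)"
      by unfold_locales (auto simp: inner_add_left intro: inner_commute)
    then obtain T J C where C: "carnot A c T J C"
      by (rule lie.stratification_frame[OF lie assms(2) c conn]) 
    show ?thesis by (rule carnot.left_invariant_metric_exists[OF C])
  qed
  then obtain g where g: "g \<in> left_invariant_metrics A" by blast
  \<comment> \<open>The lower bound already comes from the balls of this one metric as the radius
    varies.\<close>
  obtain c T J C where C: "carnot_metric A c T J C g" "card (- J) + 2 * card J = homogeneous_dim V1 V2"
    by (rule lie.stratification_metric[OF lie assms(2) conn g])
  interpret carnot_metric A c T J C g by (rule C(1))
  have le: "?ratio g p r \<le> doubling_constant A" if "r > 0" for p r
  proof -
    have "(g, p, r) \<in> left_invariant_metrics A \<times> UNIV \<times> {0<..}" using g that by simp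
    then show ?thesis unfolding doubling_constant_def by (rule SUP_upper2) simp
  qed
  show ?thesis
  proof (rule antisym)
    show "doubling_constant A \<le> 2 ^ homogeneous_dim V1 V2"
      unfolding doubling_constant_def by (rule SUP_least) (use upper in auto)
    show "2 ^ homogeneous_dim V1 V2 \<le> doubling_constant A"
      using doubling_ratio_sup[OF le] C(2) by (simp add: Q_def)
  qed
qed

end
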